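(* Let $k\in\{0,1,\ldots,k_{\max}\}$, let $y=(y_1^T,y_2^T)^T$ be the unit length eigenvector of $M$ associated with its rightmost eigenvalue $\mu_1$, and assume that $\mathrm{sep}(\mu_1,C_k)>0$. Then $$\sin\angle(s_k,s_{opt})\le c_k\left(1+\frac{\|M\|}{\sqrt{1-\varepsilon_k^2}\;\mathrm{sep}(\mu_1,C_k)}\right)\left(\frac{\sqrt\kappa-1}{\sqrt\kappa+1}\right)^{k+1},$$ where $\varepsilon_k=\sin\angle(y,\widetilde{\mathcal S}_k)$, $\kappa=\frac{\alpha_1+\lambda_{opt}}{\alpha_n+\lambda_{opt}}$, $t=\frac{\sqrt\kappa-1}{\sqrt\kappa+1}$ and $$c_k=2+\frac{16(\alpha_1+\lambda_{opt})}{(\alpha_1-\alpha_n)^2(1-t^2)}\left(1+\frac{k+2}{|\ln t|}\right)\left(\frac{\sqrt\kappa-1}{\sqrt\kappa+1}\right)^2.$$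
   Context: $\|\cdot\|$ is the 2-norm of a vector or matrix. $A\in\mathbb R^{n\times n}$ is symmetric and nonsingular with eigenvalues $\alpha_1\ge\alpha_2\ge\cdots\ge\alpha_n$ (with $\alpha_1>\alpha_n$, so that the expressions are defined), $g\in\mathbb R^n$ is nonzero, $\Delta>0$, and $q(s)=g^Ts+\frac12 s^TAs$. The trust-region subproblem (TRS) is $\min_{\|s\|\le\Delta}q(s)$; $s_{opt}$ is its solution and $\lambda_{opt}\ge0$ its optimal Lagrangian multiplier: $\|s_{opt}\|\le\Delta$, $(A+\lambda_{opt}I)s_{opt}=-g$, $\lambda_{opt}(\Delta-\|s_{opt}\|)=0$, $A+\lambda_{opt}I\succeq0$. Standing assumptions: the easy case, i.e. $A+\lambda_{opt}I\succ0$ (so $s_{opt}$ is unique), and $\|s_{opt}\|=\Delta$. $\mathcal S_k=\mathcal K_k(g,A)=\mathrm{span}\{g,Ag,\ldots,A^kg\}$. $k_{\max}$ is the first iteration at which the symmetric Lanczos process breaks down, i.e. the largest $k$ with $\dim\mathcal S_k=k+1$. For $0\le k\le k_{\max}$, $Q_k=(q_0,\ldots,q_k)$ is the matrix with orthonormal columns produced by the symmetric Lanczos process started at $q_0=g/\|g\|$; its columns form an orthonormal basis of $\mathcal S_k$, and $T_k=Q_k^TAQ_k$ is symmetric tridiagonal. $\beta_0=\|g\|$ and $e_1$ is the first column of the identity matrix. $s_k=Q_kh_k$ solves $\min_{s\in\mathcal S_k,\|s\|\le\Delta}q(s)$; equivalently $h_k$ solves $\min_{\|h\|\le\Delta}\beta_0e_1^Th+\frac12h^TT_kh$,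 with optimal Lagrangian multiplier $\lambda_k\ge0$: $\|h_k\|\le\Delta$, $(T_k+\lambda_kI)h_k=-\beta_0e_1$, $\lambda_k(\Delta-\|h_k\|)=0$, $T_k+\lambda_kI\succeq0$. Standing assumption: $\|s_k\|=\Delta$ and $\lambda_k>0$ for all $k=0,1,\ldots,k_{\max}$. $M=\begin{pmatrix}-A&\frac{gg^T}{\Delta^2}\\ I&-A\end{pmatrix}\in\mathbb R^{2n\times2n}$, $M_k=\begin{pmatrix}-T_k&\frac{\beta_0^2e_1e_1^T}{\Delta^2}\\ I&-T_k\end{pmatrix}\in\mathbb R^{2(k+1)\times2(k+1)}$. It is known that the eigenvalue of largest real part (the rightmost eigenvalue) of $M$, denoted $\mu_1$, is real and simple and equals $\lambda_{opt}$; likewise the rightmost eigenvalue $\mu_1^{(k)}$ of $M_k$ is real and simple and equals $\lambda_k$. $z^{(k)}\in\mathbb R^{2(k+1)}$ is a unit length eigenvector of $M_k$ for $\mu_1^{(k)}$; $Z_\perp^{(k)}$ is a matrix such that $(z^{(k)},Z_\perp^{(k)})$ is an orthogonal matrix, and $C_k=(Z_\perp^{(k)})^TM_kZ_\perp^{(k)}$. $\mathrm{sep}(\mu_1,C_k)=\sigma_{\min}(C_k-\mu_1I)$, the smallest singular value of $C_k-\mu_1I$ (which equals $\|(C_k-\mu_1I)^{-1}\|^{-1}$ when $C_k-\mu_1I$ is nonsingular). $\widetilde{\mathcal S}_k=\mathcal S_k\times\mathcal S_k\subset\mathbb R^{2n}$, and $\sin\angle(y,\widetilde{\mathcal S}_k)=\|(I-\widetilde\pi_k)y\|$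 with $\widetilde\pi_k$ the orthogonal projector onto $\widetilde{\mathcal S}_k$. For nonzero vectors $u,v$, $\angle(u,v)$ is the angle between them. *)

theory Defs
  imports
    Complex_Main
    "Jordan_Normal_Form.Char_Poly"
    "Jordan_Normal_Form.VS_Connect"
begin

definition norm2 :: "real vec \<Rightarrow> real" where
  "norm2 v = sqrt (v \<bullet> v)"

definition mat_norm2 :: "real mat \<Rightarrow> real" where
  "mat_norm2 B = Sup {norm2 (B *\<^sub>v x) | x. x \<in> carrier_vec (dim_col B) \<and> norm2 x = 1}"

definition vec_angle :: "real vec \<Rightarrow> real vec \<Rightarrow> real" where
  "vec_angle u v = arccos ((u \<bullet> v) / (norm2 u * norm2 v))"

definition pos_semidef :: "real mat \<Rightarrow> bool" where
  "pos_semidef B \<longleftrightarrow> transpose_mat B = B \<and>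
     (\<forall>x \<in> carrier_vec (dim_row B). x \<bullet> (B *\<^sub>v x) \<ge> 0)"

definition pos_def :: "real mat \<Rightarrow> bool" where
  "pos_def B \<longleftrightarrow> transpose_mat B = B \<and>
     (\<forall>x \<in> carrier_vec (dim_row B). x \<noteq> 0\<^sub>v (dim_row B) \<longrightarrow> x \<bullet> (B *\<^sub>v x) > 0)"

(* Not orthogonal_mat of Jordan_Normal_Form, whose columns need not have unit length. *)
definition orthonormal_mat :: "nat \<Rightarrow> real mat \<Rightarrow> bool" where
  "orthonormal_mat m U \<longleftrightarrow> U \<in> carrier_mat m m \<and> transpose_mat U * U = 1\<^sub>m m"

definition shift_mat :: "real mat \<Rightarrow> real \<Rightarrow> real mat" where
  "shift_mat B c = B + c \<cdot>\<^sub>m 1\<^sub>m (dim_row B)"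

definition singular_values :: "real mat \<Rightarrow> real set" where
  "singular_values B = sqrt ` {e. eigenvalue (transpose_mat B * B) e}"

definition sigma_min :: "real mat \<Rightarrow> real" where
  "sigma_min B = Min (singular_values B)"

definition sep :: "real \<Rightarrow> real mat \<Rightarrow> real" where
  "sep mu C = sigma_min (shift_mat C (- mu))"

(* The eigenvalues of a real matrix are taken over the complex numbers. *)
definition rightmost_eigenvalue :: "real mat \<Rightarrow> complex \<Rightarrow> bool" where
  "rightmost_eigenvalue B mu \<longleftrightarrow>
     eigenvalue (map_mat complex_of_real B) mu \<and>
     (\<forall>nu. eigenvalue (map_mat complex_of_real B) nu \<longrightarrow> Re nu \<le> Re mu)"

definition orthogonal_projector :: "nat \<Rightarrow> real vec set \<Rightarrow> real mat \<Rightarrow> bool" where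
  "orthogonal_projector m W P \<longleftrightarrow> P \<in> carrier_mat m m \<and> transpose_mat P = P \<and> P * P = P \<and>
     (\<lambda>x. P *\<^sub>v x) ` carrier_vec m = W"

text \<open>The trust-region subproblem \<open>min q(s)\<close> over \<open>norm2 s \<le> \<Delta>\<close>, and its optimal multiplier.
  The same notions serve for the full problem \<open>(A, g)\<close> and for the projected problem
  \<open>(T, \<beta>\<^sub>0 e\<^sub>1)\<close>.\<close>

definition trs_objective :: "real mat \<Rightarrow> real vec \<Rightarrow> real vec \<Rightarrow> real" where
  "trs_objective A g s = g \<bullet> s + (1 / 2) * (s \<bullet> (A *\<^sub>v s))"

definition trs_solution :: "real mat \<Rightarrow> real vec \<Rightarrow> real \<Rightarrow> real vec \<Rightarrow> bool" where
  "trs_solution A g \<Delta> s \<longleftrightarrow>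
     is_arg_min (trs_objective A g) (\<lambda>x. x \<in> carrier_vec (dim_vec g) \<and> norm2 x \<le> \<Delta>) s"

definition trs_multiplier :: "real mat \<Rightarrow> real vec \<Rightarrow> real \<Rightarrow> real vec \<Rightarrow> real \<Rightarrow> bool" where
  "trs_multiplier A g \<Delta> s lam \<longleftrightarrow>
     lam \<ge> 0 \<and> norm2 s \<le> \<Delta> \<and> shift_mat A lam *\<^sub>v s = - g \<and>
     lam * (\<Delta> - norm2 s) = 0 \<and> pos_semidef (shift_mat A lam)"

definition trs_block_mat :: "real mat \<Rightarrow> real vec \<Rightarrow> real \<Rightarrow> real mat" where
  "trs_block_mat A g \<Delta> = (let m = dim_vec g; G = mat_of_cols m [g] in
     four_block_mat (- A) ((1 / \<Delta>\<^sup>2) \<cdot>\<^sub>m (G * transpose_mat G)) (1\<^sub>m m) (- A))"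

definition krylov :: "real mat \<Rightarrow> real vec \<Rightarrow> nat \<Rightarrow> real vec set" where
  "krylov A g k = LinearCombinations.module.span class_ring (module_vec TYPE(real) (dim_vec g))
     ((\<lambda>i. (A ^\<^sub>m i) *\<^sub>v g) ` {..k})"

definition krylov_dim :: "real mat \<Rightarrow> real vec \<Rightarrow> nat \<Rightarrow> nat" where
  "krylov_dim A g k = vectorspace.dim (class_ring :: real ring)
     ((module_vec TYPE(real) (dim_vec g))\<lparr>carrier := krylov A g k\<rparr>)"

definition k_max :: "real mat \<Rightarrow> real vec \<Rightarrow> nat" where
  "k_max A g = Max {k. krylov_dim A g k = k + 1}"

definition krylov_product :: "real mat \<Rightarrow> real vec \<Rightarrow> nat \<Rightarrow> real vec set" where
  "krylov_product A g k = {u @\<^sub>v v | u v. u \<in> krylov A g k \<and> v \<in> krylov A g k}"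

text \<open>The symmetric Lanczos process. The state after step \<open>j\<close> is \<open>(q\<^bsub>j-1\<^esub>, q\<^bsub>j\<^esub>, \<beta>\<^bsub>j\<^esub>)\<close>, with
  \<open>q\<^bsub>-1\<^esub> = 0\<close> and \<open>\<beta>\<^sub>0 = norm2 g\<close>; the three-term recurrence is
  \<open>\<beta>\<^bsub>j+1\<^esub> q\<^bsub>j+1\<^esub> = A q\<^bsub>j\<^esub> - (q\<^bsub>j\<^esub> \<bullet> A q\<^bsub>j\<^esub>) q\<^bsub>j\<^esub> - \<beta>\<^bsub>j\<^esub> q\<^bsub>j-1\<^esub>\<close>.
  The vectors are meaningful only for \<open>j \<le> k_max A g\<close>, where the process has not broken down.\<close>

primrec lanczos_state :: "real mat \<Rightarrow> real vec \<Rightarrow> nat \<Rightarrow> real vec \<times> real vec \<times> real" where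
  "lanczos_state A g 0 = (0\<^sub>v (dim_vec g), (1 / norm2 g) \<cdot>\<^sub>v g, norm2 g)"
| "lanczos_state A g (Suc j) =
     (case lanczos_state A g j of (p, q, b) \<Rightarrow>
        let r = A *\<^sub>v q - (q \<bullet> (A *\<^sub>v q)) \<cdot>\<^sub>v q - b \<cdot>\<^sub>v p
        in (q, (1 / norm2 r) \<cdot>\<^sub>v r, norm2 r))"

definition lanczos_vec :: "real mat \<Rightarrow> real vec \<Rightarrow> nat \<Rightarrow> real vec" where
  "lanczos_vec A g j = fst (snd (lanczos_state A g j))"

definition lanczos_Q :: "real mat \<Rightarrow> real vec \<Rightarrow> nat \<Rightarrow> real mat" where
  "lanczos_Q A g k = mat_of_cols (dim_vec g) (map (lanczos_vec A g) [0..<k + 1])"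

definition lanczos_T :: "real mat \<Rightarrow> real vec \<Rightarrow> nat \<Rightarrow> real mat" where
  "lanczos_T A g k = transpose_mat (lanczos_Q A g k) * A * lanczos_Q A g k"

(* beta_0 * e_1 in dimension k + 1; vectors are indexed from 0 *)
definition lanczos_rhs :: "real vec \<Rightarrow> nat \<Rightarrow> real vec" where
  "lanczos_rhs g k = norm2 g \<cdot>\<^sub>v unit_vec (k + 1) 0"

end

theory Submission
  imports
    Defs
    "Jordan_Normal_Form.Spectral_Radius"
    "Jordan_Normal_Form.DL_Rank"
begin

text \<open>
  Write \<open>B = A + \<lambda>\<^sub>o\<^sub>p\<^sub>t I\<close>. The eigenvector is \<open>y = \<gamma> (s\<^sub>o\<^sub>p\<^sub>t, B\<^sup>-\<^sup>1 s\<^sub>o\<^sub>p\<^sub>t)\<close>, the first half of \<open>z\<close> is a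
  multiple of \<open>h\<^sub>k\<close>, and \<open>C\<^sub>k\<close> bounds the angle between \<open>y\<close> and the lifted \<open>z\<close> by the distance of
  \<open>y\<close> from \<open>S\<^sub>k \<times> S\<^sub>k\<close>. That distance is estimated with the normalised Chebyshev polynomial \<open>W\<close> for
  the first half and with \<open>W(x) (1 - W'(0) x)\<close>, which has value 1 and derivative 0 at 0, for the
  second half.

  For small \<open>t\<close> the residual of the second half exceeds the second summand of \<open>c\<^sub>k\<close>. There one uses
  instead that \<open>s\<^sub>k\<close> minimizes the \<open>B\<close>-norm distance to \<open>s\<^sub>o\<^sub>p\<^sub>t\<close> over the vectors of length \<open>\<Delta>\<close> in
  \<open>S\<^sub>k\<close>, together with Wielandt's inequality and the lower bound \<open>1/2\<close> for
  \<open>X = mat_norm2 M / sep \<mu>\<^sub>1 C\<^sub>k\<close>, which comes from \<open>\<bar>\<mu>\<^sub>1\<bar> \<le> mat_norm2 M\<close> and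
  \<open>mat_norm2 C\<^sub>k \<le> mat_norm2 M\<close>.
\<close>

text \<open>In the parameters \<open>\<alpha> n + lamopt = \<beta> * (1 - t)\<^sup>2\<close> and
  \<open>\<alpha> 1 + lamopt = \<beta> * (1 + t)\<^sup>2\<close> the second summand of c_k is
  \<open>D = (1 + t) / (\<beta> * (1 - t)) * (1 + (real k + 2) / \<bar>ln t\<bar>)\<close>, while
  the residual of the second half costs \<open>F = 2 * (1 / (\<beta> * (1 - t)\<^sup>2) + real (Suc
  k) / (\<beta> * (1 - t\<^sup>2)))\<close>. As t tends to 0, beta D tends to 1 and beta F to 2k +
  4; beta may be arbitrarily small, so the summand 2 of c_k cannot absorb the excess. The
  alternative bounds must be free of beta and fit under 2 (1 + X) t^(k+1): X >= 1/2 leaves room for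
  the factor 3, and 2 (1 + t) / (1 - t) fits once t <= 1/2 and X > 2. In the middle range the slack
  of sqrt (1 + X^2) against 1 + X suffices. The bound is first proved with X alone. The factor sqrt
  (1 - eps_k^2), being at most 1, then only enlarges the right side, but it must be shown positive
  because division by 0 yields 0.\<close>

section \<open>Euclidean geometry of real vectors\<close>

lemma scalar_prod_self_nonneg: "0 \<le> (v :: real vec) \<bullet> v"
  by (auto simp: scalar_prod_def intro: sum_nonneg)

lemma norm2_nonneg [simp]: "0 \<le> norm2 v"
  by (simp add: norm2_def scalar_prod_self_nonneg)

lemma norm2_power2: "(norm2 v)\<^sup>2 = v \<bullet> v"
  by (simp add: norm2_def scalar_prod_self_nonneg)

lemma scalar_prod_self_eq_0:
  fixes v :: "real vec"
  assumes "v \<in> carrier_vec n"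
  shows "v \<bullet> v = 0 \<longleftrightarrow> v = 0\<^sub>v n"
proof
  assume "v \<bullet> v = 0"
  then have "\<forall>i\<in>{0..<n}. v $ i * v $ i = 0"
    using assms by (subst (asm) scalar_prod_def, subst (asm) sum_nonneg_eq_0_iff) auto
  then show "v = 0\<^sub>v n" using assms by (intro eq_vecI) auto
qed (use assms in auto)

lemma norm2_eq_0: "v \<in> carrier_vec n \<Longrightarrow> norm2 v = 0 \<longleftrightarrow> v = 0\<^sub>v n"
  by (simp add: norm2_def scalar_prod_self_eq_0)

lemma norm2_pos: "v \<in> carrier_vec n \<Longrightarrow> v \<noteq> 0\<^sub>v n \<Longrightarrow> 0 < norm2 v"
  using norm2_eq_0[of v n] norm2_nonneg[of v] by linarith

lemma norm2_smult: "norm2 (c \<cdot>\<^sub>v v) = \<bar>c\<bar> * norm2 v"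
  by (simp add: norm2_def real_sqrt_mult)

lemma scalar_prod_comm_real: "u \<in> carrier_vec n \<Longrightarrow> v \<in> carrier_vec n \<Longrightarrow> u \<bullet> v = v \<bullet> (u :: real vec)"
  by (rule comm_scalar_prod)

lemma cauchy_schwarz_vec:
  fixes u v :: "real vec"
  assumes u: "u \<in> carrier_vec n" and v: "v \<in> carrier_vec n"
  shows "\<bar>u \<bullet> v\<bar> \<le> norm2 u * norm2 v"
proof (cases "v = 0\<^sub>v n")
  case True
  then show ?thesis using u by simp
next
  case False
  then have pos: "0 < v \<bullet> v"
    using scalar_prod_self_nonneg[of v] scalar_prod_self_eq_0[OF v] by linarith
  \<comment> \<open>\<open>w\<close> is \<open>v \<bullet> v\<close> times the component of
    \<open>u\<close> orthogonal to \<open>v\<close>; clearing the denominator keeps the expansion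
    polynomial.\<close>
  define w where "w = (v \<bullet> v) \<cdot>\<^sub>v u - (u \<bullet> v) \<cdot>\<^sub>v v"
  have "0 \<le> w \<bullet> w" by (rule scalar_prod_self_nonneg)
  also have "w \<bullet> w = (v \<bullet> v) * ((u \<bullet> u) * (v \<bullet> v) - (u \<bullet> v)\<^sup>2)"
    unfolding w_def using u v
    by (simp add: scalar_prod_minus_distrib[of _ n] minus_scalar_prod_distrib[of _ n]
        scalar_prod_comm_real[of v n u] power2_eq_square algebra_simps)
  finally have "(u \<bullet> v)\<^sup>2 \<le> (u \<bullet> u) * (v \<bullet> v)"
    using pos by (simp add: zero_le_mult_iff)
  then have "sqrt ((u \<bullet> v)\<^sup>2) \<le> sqrt ((u \<bullet> u) * (v \<bullet> v))" by (rule real_sqrt_le_mono)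
  then show ?thesis by (simp add: norm2_def real_sqrt_mult)
qed

lemma norm2_add_power2:
  assumes "u \<in> carrier_vec n" "v \<in> carrier_vec n"
  shows "(norm2 (u + v))\<^sup>2 = (norm2 u)\<^sup>2 + 2 * (u \<bullet> v) + (norm2 v)\<^sup>2"
  unfolding norm2_power2 using assms
  by (simp add: scalar_prod_add_distrib[of _ n] add_scalar_prod_distrib[of _ n]
      scalar_prod_comm_real[of v n u])

lemma norm2_diff_power2:
  assumes "u \<in> carrier_vec n" "v \<in> carrier_vec n"
  shows "(norm2 (u - v))\<^sup>2 = (norm2 u)\<^sup>2 - 2 * (u \<bullet> v) + (norm2 v)\<^sup>2"
  unfolding norm2_power2 using assms
  by (simp add: scalar_prod_minus_distrib[of _ n] minus_scalar_prod_distrib[of _ n]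
      scalar_prod_comm_real[of v n u])

lemma norm2_triangle:
  assumes "u \<in> carrier_vec n" "v \<in> carrier_vec n"
  shows "norm2 (u + v) \<le> norm2 u + norm2 v"
proof (rule power2_le_imp_le)
  show "(norm2 (u + v))\<^sup>2 \<le> (norm2 u + norm2 v)\<^sup>2"
    using cauchy_schwarz_vec[OF assms] norm2_add_power2[OF assms]
    by (simp add: power2_sum)
qed simp

lemma norm2_append:
  assumes "u \<in> carrier_vec n" "v \<in> carrier_vec m"
  shows "(norm2 (u @\<^sub>v v))\<^sup>2 = (norm2 u)\<^sup>2 + (norm2 v)\<^sup>2"
  unfolding norm2_power2 using assms by (simp add: scalar_prod_append[of _ n _ m])

lemma transpose_scalar_prod:
  fixes A :: "real mat"
  assumes "A \<in> carrier_mat m n" "x \<in> carrier_vec m" "y \<in> carrier_vec n"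
  shows "x \<bullet> (A *\<^sub>v y) = (transpose_mat A *\<^sub>v x) \<bullet> y"
  using transpose_vec_mult_scalar[OF assms(1,3,2)] by simp

lemma symmetric_scalar_prod:
  fixes A :: "real mat"
  assumes "A \<in> carrier_mat n n" "transpose_mat A = A" "x \<in> carrier_vec n" "y \<in> carrier_vec n"
  shows "x \<bullet> (A *\<^sub>v y) = (A *\<^sub>v x) \<bullet> y"
  using transpose_scalar_prod[OF assms(1,3,4)] assms(2) by simp

lemma isometry_scalar_prod:
  fixes Q :: "real mat"
  assumes Q: "Q \<in> carrier_mat n m" and o: "transpose_mat Q * Q = 1\<^sub>m m"
    and x: "x \<in> carrier_vec m" and y: "y \<in> carrier_vec m"
  shows "(Q *\<^sub>v x) \<bullet> (Q *\<^sub>v y) = x \<bullet> y"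
proof -
  have "(Q *\<^sub>v x) \<bullet> (Q *\<^sub>v y) = (transpose_mat Q *\<^sub>v (Q *\<^sub>v x)) \<bullet> y"
    using Q x y by (intro transpose_scalar_prod) auto
  also have "transpose_mat Q *\<^sub>v (Q *\<^sub>v x) = x"
    using Q x o by (subst assoc_mult_mat_vec[symmetric]) auto
  finally show ?thesis .
qed

lemma isometry_norm2:
  fixes Q :: "real mat"
  assumes "Q \<in> carrier_mat n m" "transpose_mat Q * Q = 1\<^sub>m m" "x \<in> carrier_vec m"
  shows "norm2 (Q *\<^sub>v x) = norm2 x"
  unfolding norm2_def using isometry_scalar_prod[OF assms(1-3,3)] by simp

section \<open>Real eigenvectors and reflections\<close>

text \<open>Over the complex numbers an eigenvector \<open>w\<close> exists. For its real and
  imaginary parts, symmetry of \<open>A\<close> gives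
  \<open>Im \<mu> * (x \<bullet> x + y \<bullet> y) = 0\<close>, so \<open>\<mu>\<close> is real,
  both parts satisfy the real eigenvalue equation, and one of them is nonzero.\<close>

lemma symmetric_real_eigenvector:
  fixes A :: "real mat"
  assumes A: "A \<in> carrier_mat n n" and sym: "transpose_mat A = A" and n: "0 < n"
  obtains \<theta> v where "v \<in> carrier_vec n" "v \<noteq> 0\<^sub>v n" "A *\<^sub>v v = \<theta> \<cdot>\<^sub>v v"
proof -
  let ?C = "map_mat complex_of_real A"
  have C: "?C \<in> carrier_mat n n" using A by simp
  obtain \<mu> where "eigenvalue ?C \<mu>"
    using spectrum_non_empty[OF C n] by (auto simp: spectrum_def)
  then obtain w where w: "w \<in> carrier_vec n" "w \<noteq> 0\<^sub>v n" "?C *\<^sub>v w = \<mu> \<cdot>\<^sub>v w"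
    using A by (auto simp: eigenvalue_def eigenvector_def)
  define x y where "x = map_vec Re w" and "y = map_vec Im w"
  have xy: "x \<in> carrier_vec n" "y \<in> carrier_vec n" using w by (auto simp: x_def y_def)
  have e: "(\<Sum>j<n. complex_of_real (A $$ (i, j)) * w $ j) = \<mu> * w $ i" if "i < n" for i
    using arg_cong[OF w(3), of "\<lambda>v. v $ i"] that A w(1)
    by (simp add: scalar_prod_def atLeast0LessThan)
  have Ax: "A *\<^sub>v x = Re \<mu> \<cdot>\<^sub>v x - Im \<mu> \<cdot>\<^sub>v y"
  proof (rule eq_vecI)
    fix i assume "i < dim_vec (Re \<mu> \<cdot>\<^sub>v x - Im \<mu> \<cdot>\<^sub>v y)"
    then have i: "i < n" using xy by simp
    have "(A *\<^sub>v x) $ i = (\<Sum>j<n. A $$ (i, j) * Re (w $ j))"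
      using i A w(1) by (simp add: scalar_prod_def atLeast0LessThan x_def)
    also have "\<dots> = Re (\<mu> * w $ i)" by (simp flip: e[OF i])
    finally show "(A *\<^sub>v x) $ i = (Re \<mu> \<cdot>\<^sub>v x - Im \<mu> \<cdot>\<^sub>v y) $ i"
      using i w(1) by (simp add: x_def y_def)
  qed (use A xy in auto)
  have Ay: "A *\<^sub>v y = Im \<mu> \<cdot>\<^sub>v x + Re \<mu> \<cdot>\<^sub>v y"
  proof (rule eq_vecI)
    fix i assume "i < dim_vec (Im \<mu> \<cdot>\<^sub>v x + Re \<mu> \<cdot>\<^sub>v y)"
    then have i: "i < n" using xy by simp
    have "(A *\<^sub>v y) $ i = (\<Sum>j<n. A $$ (i, j) * Im (w $ j))"
      using i A w(1) by (simp add: scalar_prod_def atLeast0LessThan y_def)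
    also have "\<dots> = Im (\<mu> * w $ i)" by (simp flip: e[OF i])
    finally show "(A *\<^sub>v y) $ i = (Im \<mu> \<cdot>\<^sub>v x + Re \<mu> \<cdot>\<^sub>v y) $ i"
      using i w(1) by (simp add: x_def y_def)
  qed (use A xy in auto)
  have nz: "x \<noteq> 0\<^sub>v n \<or> y \<noteq> 0\<^sub>v n"
  proof (rule ccontr)
    assume "\<not> ?thesis"
    then have "x $ i = 0 \<and> y $ i = 0" if "i < n" for i using that by simp
    then have "w = 0\<^sub>v n" using w(1)
      by (intro eq_vecI) (auto simp: x_def y_def complex_eq_iff)
    with w(2) show False by simp
  qed
  have "x \<bullet> (A *\<^sub>v y) = (A *\<^sub>v x) \<bullet> y"
    by (rule symmetric_scalar_prod[OF A sym xy])
  then have "Im \<mu> * (x \<bullet> x + y \<bullet> y) = 0" unfolding Ax Ay using xy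
    by (simp add: scalar_prod_add_distrib[of _ n] minus_scalar_prod_distrib[of _ n] algebra_simps)
  moreover have "x \<bullet> x + y \<bullet> y \<noteq> 0"
    using nz scalar_prod_self_nonneg[of x] scalar_prod_self_nonneg[of y]
      scalar_prod_self_eq_0[OF xy(1)] scalar_prod_self_eq_0[OF xy(2)] by linarith
  ultimately have "Im \<mu> = 0" by simp
  then have "A *\<^sub>v x = Re \<mu> \<cdot>\<^sub>v x" "A *\<^sub>v y = Re \<mu> \<cdot>\<^sub>v y"
    using Ax Ay xy by auto
  with nz xy that show thesis by blast
qed

text \<open>The Householder reflection in the direction \<open>u - e\<^sub>0\<close>.\<close>

lemma orthonormal_mat_first_col:
  fixes u :: "real vec"
  assumes u: "u \<in> carrier_vec n" and norm: "u \<bullet> u = 1" and n: "0 < n"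
  obtains H where "orthonormal_mat n H" "H *\<^sub>v unit_vec n 0 = u"
proof (cases "u = unit_vec n 0")
  case True
  then show thesis using that[of "1\<^sub>m n"] by (simp add: orthonormal_mat_def)
next
  case False
  define w where "w = u - unit_vec n 0"
  define \<beta> where "\<beta> = w \<bullet> w"
  have w: "w \<in> carrier_vec n" using u by (simp add: w_def)
  have "w \<noteq> 0\<^sub>v n"
  proof
    assume 0: "w = 0\<^sub>v n"
    have "u $ i = unit_vec n 0 $ i" if "i < n" for i
      using arg_cong[OF 0, of "\<lambda>v. v $ i"] that u by (simp add: w_def)
    then show False using False u by (auto intro!: eq_vecI)
  qed
  then have \<beta>: "\<beta> \<noteq> 0" using scalar_prod_self_eq_0[OF w] by (simp add: \<beta>_def)
  have w0: "w $ 0 = u $ 0 - 1" using u n by (simp add: w_def)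
  \<comment> \<open>Both \<open>u\<close> and the unit vector have length 1, so their squared
    distance is 2 - 2 u_0. This is what makes the reflection send the unit vector exactly to
    \<open>u\<close>.\<close>
  have \<beta>2: "\<beta> = - 2 * w $ 0" unfolding \<beta>_def w0 w_def using u n norm
    by (simp add: scalar_prod_minus_distrib[of _ n] minus_scalar_prod_distrib[of _ n])
  define H where "H = mat n n (\<lambda>(i, j). (if i = j then 1 else 0) - 2 * w $ i * w $ j / \<beta>)"
  have H: "H \<in> carrier_mat n n" by (simp add: H_def)
  have Ht: "transpose_mat H = H" by (rule eq_matI) (auto simp: H_def)
  have HH: "H * H = 1\<^sub>m n"
  proof (rule eq_matI)
    fix i j assume "i < dim_row (1\<^sub>m n :: real mat)" "j < dim_col (1\<^sub>m n :: real mat)"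
    then have ij: "i < n" "j < n" by auto
    have s: "(\<Sum>k<n. w $ k * w $ k) = \<beta>"
      using w by (simp add: \<beta>_def scalar_prod_def atLeast0LessThan)
    have "(H * H) $$ (i, j) = (\<Sum>k<n. ((if i = k then 1 else 0) - 2 * w $ i * w $ k / \<beta>) *
        ((if k = j then 1 else 0) - 2 * w $ k * w $ j / \<beta>))"
      using ij by (simp add: H_def scalar_prod_def atLeast0LessThan)
    also have "\<dots> = (\<Sum>k<n. (if i = k then (if k = j then 1 else 0) else 0)
        - (if i = k then 2 * w $ k * w $ j / \<beta> else 0)
        - (if k = j then 2 * w $ i * w $ k / \<beta> else 0)
        + (4 * w $ i * w $ j / \<beta>\<^sup>2) * (w $ k * w $ k))"
      by (intro sum.cong refl) (auto simp: algebra_simps power2_eq_square)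
    also have "\<dots> = (if i = j then 1 else 0) - 2 * w $ i * w $ j / \<beta> - 2 * w $ i * w $ j / \<beta>
        + (4 * w $ i * w $ j / \<beta>\<^sup>2) * \<beta>"
      using ij by (simp add: sum.distrib sum_subtractf sum_distrib_left[symmetric] sum_divide_distrib[symmetric] s)
    also have "\<dots> = (if i = j then 1 else 0)" using \<beta> by (simp add: power2_eq_square)
    finally show "(H * H) $$ (i, j) = 1\<^sub>m n $$ (i, j)" using ij by simp
  qed (use H in auto)
  have "H *\<^sub>v unit_vec n 0 = u"
  proof (rule eq_vecI)
    fix i assume "i < dim_vec u"
    then have i: "i < n" using u by simp
    have "(H *\<^sub>v unit_vec n 0) $ i = H $$ (i, 0)"
      using H i n by (simp add: scalar_prod_def if_distrib cong: if_cong)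
    also have "\<dots> = (if i = 0 then 1 else 0) - 2 * w $ i * w $ 0 / \<beta>"
      using i n by (simp add: H_def)
    also have "2 * w $ i * w $ 0 / \<beta> = - w $ i" using \<beta> unfolding \<beta>2 by (simp add: field_simps)
    finally show "(H *\<^sub>v unit_vec n 0) $ i = u $ i" using i u n by (simp add: w_def)
  qed (use H u in auto)
  moreover have "orthonormal_mat n H" using H HH Ht by (simp add: orthonormal_mat_def)
  ultimately show thesis using that by blast
qed

section \<open>Diagonalization of symmetric matrices\<close>

text \<open>Deflation: a reflection moves an eigenvector to the first unit vector. The first column
  of the conjugated matrix is then a multiple of that unit vector, by symmetry so is its first row,
  and the induction hypothesis handles the remaining block.\<close>

theorem symmetric_diagonalization:
  fixes A :: "real mat"
  assumes "A \<in> carrier_mat n n" "transpose_mat A = A"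
  shows "\<exists>U d. orthonormal_mat n U \<and> transpose_mat U * A * U = mat_diag n d"
  using assms
proof (induction n arbitrary: A)
  case 0
  \<comment> \<open>All 0 x 0 matrices coincide, so \<open>A\<close> itself serves as
    \<open>U\<close> and any function as \<open>d\<close>.\<close>
  have "transpose_mat A * A * A = mat_diag 0 undefined" "transpose_mat A * A = 1\<^sub>m 0"
    using 0 by (auto simp: mat_diag_def)
  then show ?case using 0 unfolding orthonormal_mat_def by blast
next
  case (Suc n)
  let ?N = "Suc n"
  note A = Suc.prems(1) and sym = Suc.prems(2)
  obtain \<theta> v where v: "v \<in> carrier_vec ?N" "v \<noteq> 0\<^sub>v ?N" "A *\<^sub>v v = \<theta> \<cdot>\<^sub>v v"
    using symmetric_real_eigenvector[OF A sym] by blast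
  define u where "u = (1 / norm2 v) \<cdot>\<^sub>v v"
  have u: "u \<in> carrier_vec ?N" using v by (simp add: u_def)
  have "norm2 u = 1" using norm2_pos[OF v(1,2)] by (simp add: u_def norm2_smult)
  then have u1: "u \<bullet> u = 1" using norm2_power2[of u] by simp
  have Au: "A *\<^sub>v u = \<theta> \<cdot>\<^sub>v u"
    using v A by (simp add: u_def mult_mat_vec smult_smult_assoc mult.commute)
  obtain H where H': "orthonormal_mat ?N H" and Hu: "H *\<^sub>v unit_vec ?N 0 = u"
    using orthonormal_mat_first_col[OF u u1] by blast
  from H' have H: "H \<in> carrier_mat ?N ?N" and HH: "transpose_mat H * H = 1\<^sub>m ?N"
    by (auto simp: orthonormal_mat_def)
  define S where "S = transpose_mat H * A * H"
  have S: "S \<in> carrier_mat ?N ?N" using H A by (simp add: S_def)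
  have St: "transpose_mat S = S" unfolding S_def using H A sym
    by (simp add: transpose_mult[of _ ?N ?N _ ?N] assoc_mult_mat[of _ ?N ?N _ ?N _ ?N])
  have "S *\<^sub>v unit_vec ?N 0 = transpose_mat H *\<^sub>v (A *\<^sub>v u)"
    unfolding S_def Hu[symmetric] using H A by (simp add: assoc_mult_mat_vec[of _ ?N ?N _ ?N])
  also have "\<dots> = \<theta> \<cdot>\<^sub>v (transpose_mat H *\<^sub>v u)" unfolding Au using H u
    by (simp add: mult_mat_vec[of _ ?N ?N])
  also have "transpose_mat H *\<^sub>v u = unit_vec ?N 0"
    unfolding Hu[symmetric] using H HH by (subst assoc_mult_mat_vec[symmetric]) auto
  finally have Se: "S *\<^sub>v unit_vec ?N 0 = \<theta> \<cdot>\<^sub>v unit_vec ?N 0" .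
  have Si0: "S $$ (i, 0) = (if i = 0 then \<theta> else 0)" if "i < ?N" for i
  proof -
    have "(S *\<^sub>v unit_vec ?N 0) $ i = S $$ (i, 0)"
      using S that by (simp add: scalar_prod_def if_distrib cong: if_cong)
    then show ?thesis using Se that by (auto split: if_splits)
  qed
  have S0i: "S $$ (0, i) = (if i = 0 then \<theta> else 0)" if "i < ?N" for i
    using Si0[OF that] St S that index_transpose_mat(1)[of 0 S i] by simp
  define S' where "S' = mat n n (\<lambda>(i, j). S $$ (Suc i, Suc j))"
  define L where "L = mat 1 1 (\<lambda>_. \<theta>)"
  have S': "S' \<in> carrier_mat n n" and L: "L \<in> carrier_mat 1 1" by (auto simp: S'_def L_def)
  have St': "transpose_mat S' = S'"
  proof (rule eq_matI)
    fix i j assume "i < dim_row S'" "j < dim_col S'"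
    then have "i < n" "j < n" using S' by auto
    then show "transpose_mat S' $$ (i, j) = S' $$ (i, j)"
      using St S index_transpose_mat(1)[of "Suc i" S "Suc j"] by (simp add: S'_def)
  qed (use S' in auto)
  have Sblock: "S = four_block_mat L (0\<^sub>m 1 n) (0\<^sub>m n 1) S'"
  proof (rule eq_matI)
    fix i j assume "i < dim_row (four_block_mat L (0\<^sub>m 1 n) (0\<^sub>m n 1) S')"
      "j < dim_col (four_block_mat L (0\<^sub>m 1 n) (0\<^sub>m n 1) S')"
    then have "i < ?N" "j < ?N" using L S' by auto
    then show "S $$ (i, j) = four_block_mat L (0\<^sub>m 1 n) (0\<^sub>m n 1) S' $$ (i, j)"
      using L S' Si0[of i] S0i[of j] by (cases i; cases j) (auto simp: S'_def L_def)
  qed (use S L S' in auto)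
  obtain U' d' where U'': "orthonormal_mat n U'" and D': "transpose_mat U' * S' * U' = mat_diag n d'"
    using Suc.IH[OF S' St'] by blast
  from U'' have U': "U' \<in> carrier_mat n n" and UU': "transpose_mat U' * U' = 1\<^sub>m n"
    by (auto simp: orthonormal_mat_def)
  define F where "F = four_block_mat (1\<^sub>m 1) (0\<^sub>m 1 n) (0\<^sub>m n 1) U'"
  have F: "F \<in> carrier_mat ?N ?N" using U' four_block_carrier_mat[of "1\<^sub>m 1" 1 1 U' n n] by (simp add: F_def)
  have Ft: "transpose_mat F = four_block_mat (1\<^sub>m 1) (0\<^sub>m 1 n) (0\<^sub>m n 1) (transpose_mat U')"
    unfolding F_def using U' by (subst transpose_four_block_mat) auto
  have "transpose_mat F * F = four_block_mat (1\<^sub>m 1) (0\<^sub>m 1 n) (0\<^sub>m n 1) (1\<^sub>m n)"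
    unfolding Ft unfolding F_def using U' UU'
    by (subst mult_four_block_mat[of _ 1 1 _ n _ n _ _ 1 _ n]) auto
  then have FF: "transpose_mat F * F = 1\<^sub>m ?N"
    using four_block_one_mat[of 1 n] by simp
  have "transpose_mat F * S = four_block_mat L (0\<^sub>m 1 n) (0\<^sub>m n 1) (transpose_mat U' * S')"
    unfolding Ft Sblock using U' L S'
    by (subst mult_four_block_mat[of _ 1 1 _ n _ n _ _ 1 _ n]) auto
  then have "transpose_mat F * S * F = four_block_mat L (0\<^sub>m 1 n) (0\<^sub>m n 1) (transpose_mat U' * S') * F"
    by simp
  also have "\<dots> = four_block_mat L (0\<^sub>m 1 n) (0\<^sub>m n 1) (mat_diag n d')"
    unfolding F_def using U' L S' D'
    by (subst mult_four_block_mat[of _ 1 1 _ n _ n _ _ 1 _ n]) auto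
  also have "\<dots> = mat_diag ?N (case_nat \<theta> d')"
    by (rule eq_matI) (auto simp: L_def mat_diag_def split: nat.split)
  finally have FSF: "transpose_mat F * S * F = mat_diag ?N (case_nat \<theta> d')" .
  have "transpose_mat (H * F) * (H * F) = transpose_mat F * (transpose_mat H * H) * F"
    using H F by (simp add: transpose_mult[of _ ?N ?N _ ?N] assoc_mult_mat[of _ ?N ?N _ ?N _ ?N])
  then have "orthonormal_mat ?N (H * F)"
    using H F HH FF by (simp add: orthonormal_mat_def)
  moreover have "transpose_mat (H * F) * A * (H * F) = transpose_mat F * S * F"
    unfolding S_def using H F A
    by (simp add: transpose_mult[of _ ?N ?N _ ?N] assoc_mult_mat[of _ ?N ?N _ ?N _ ?N])
  ultimately show ?case using FSF by metis
qed

section \<open>Functional calculus in an orthonormal eigenbasis\<close>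

locale diagonalized =
  fixes n :: nat and A U :: "real mat" and d :: "nat \<Rightarrow> real"
  assumes A: "A \<in> carrier_mat n n" and U: "U \<in> carrier_mat n n"
    and orth: "transpose_mat U * U = 1\<^sub>m n" and diag: "transpose_mat U * A * U = mat_diag n d"
begin

definition coord :: "real vec \<Rightarrow> nat \<Rightarrow> real" where
  "coord x i = (transpose_mat U *\<^sub>v x) $ i"

text \<open>This is f(A) x. Since \<open>f\<close> acts only through its values at the
  \<open>d i\<close>, identities and bounds for functions of a matrix reduce to those for real
  functions, and inverses and polynomials are treated alike.\<close>

definition fv :: "(real \<Rightarrow> real) \<Rightarrow> real vec \<Rightarrow> real vec" where
  "fv f x = U *\<^sub>v vec n (\<lambda>i. f (d i) * coord x i)"

lemma orth': "U * transpose_mat U = 1\<^sub>m n"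
  by (rule mat_mult_left_right_inverse[of _ n]) (use U orth in auto)

lemma U_transpose: "x \<in> carrier_vec n \<Longrightarrow> U *\<^sub>v (transpose_mat U *\<^sub>v x) = x"
  using U orth' by (subst assoc_mult_mat_vec[symmetric]) auto

lemma transpose_U: "x \<in> carrier_vec n \<Longrightarrow> transpose_mat U *\<^sub>v (U *\<^sub>v x) = x"
  using U orth by (subst assoc_mult_mat_vec[symmetric]) auto

lemma fv_carrier [simp]: "fv f x \<in> carrier_vec n"
  using U by (simp add: fv_def)

lemma coords_fv: "i < n \<Longrightarrow> coord (fv f x) i = f (d i) * coord x i"
  by (simp add: fv_def transpose_U coord_def del: index_mult_mat_vec)

lemma eq_by_coords:
  assumes "x \<in> carrier_vec n" "y \<in> carrier_vec n"
    and "\<And>i. i < n \<Longrightarrow> coord x i = coord y i"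
  shows "x = y"
proof -
  have "transpose_mat U *\<^sub>v x = transpose_mat U *\<^sub>v y"
    using assms(3) U unfolding coord_def by (intro eq_vecI) auto
  then show ?thesis using U_transpose[OF assms(1)] U_transpose[OF assms(2)] by metis
qed

lemma scalar_prod_coords:
  assumes x: "x \<in> carrier_vec n" and y: "y \<in> carrier_vec n"
  shows "x \<bullet> y = (\<Sum>i<n. coord x i * coord y i)"
proof -
  have "x \<bullet> y = (transpose_mat U *\<^sub>v x) \<bullet> (transpose_mat U *\<^sub>v y)"
    using transpose_scalar_prod[OF U x, of "transpose_mat U *\<^sub>v y"] U x y U_transpose[OF y] by simp
  then show ?thesis using U by (simp add: scalar_prod_def coord_def atLeast0LessThan)
qed

lemma A_mult:
  assumes x: "x \<in> carrier_vec n" shows "A *\<^sub>v x = fv (\<lambda>t. t) x"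
proof -
  have "transpose_mat U *\<^sub>v (A *\<^sub>v x) = transpose_mat U *\<^sub>v (A *\<^sub>v (U *\<^sub>v (transpose_mat U *\<^sub>v x)))"
    using U_transpose[OF x] by simp
  also have "\<dots> = (transpose_mat U * A * U) *\<^sub>v (transpose_mat U *\<^sub>v x)"
    using U A x by (simp add: assoc_mult_mat_vec[of _ n n _ n])
  also have "\<dots> = vec n (\<lambda>i. d i * coord x i)"
    unfolding diag using U x
    by (intro eq_vecI) (auto simp: mat_diag_def coord_def scalar_prod_def if_distrib[of "\<lambda>t. t * _"] cong: if_cong)
  finally have "U *\<^sub>v (transpose_mat U *\<^sub>v (A *\<^sub>v x)) = fv (\<lambda>t. t) x" by (simp add: fv_def)
  then show ?thesis using U_transpose[of "A *\<^sub>v x"] A x by simp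
qed

lemma fv_fv: "fv f (fv g x) = fv (\<lambda>t. f t * g t) x"
  by (rule eq_by_coords) (auto simp: coords_fv)

lemma coords_add: "x \<in> carrier_vec n \<Longrightarrow> y \<in> carrier_vec n \<Longrightarrow> i < n \<Longrightarrow>
   coord (x + y) i = coord x i + coord y i"
  unfolding coord_def using U by (subst mult_add_distrib_mat_vec[of _ n n]) auto

lemma coords_diff: "x \<in> carrier_vec n \<Longrightarrow> y \<in> carrier_vec n \<Longrightarrow> i < n \<Longrightarrow>
   coord (x - y) i = coord x i - coord y i"
  unfolding coord_def using U by (subst mult_minus_distrib_mat_vec[of _ n n]) auto

lemma coords_smult: "x \<in> carrier_vec n \<Longrightarrow> i < n \<Longrightarrow>
   coord (c \<cdot>\<^sub>v x) i = c * coord x i"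
  unfolding coord_def using U by (subst mult_mat_vec[of _ n n]) auto

lemma norm2_fv_le:
  assumes x: "x \<in> carrier_vec n" and f: "\<And>i. i < n \<Longrightarrow> \<bar>f (d i)\<bar> \<le> K" and K: "0 \<le> K"
  shows "norm2 (fv f x) \<le> K * norm2 x"
proof (rule power2_le_imp_le)
  let ?c = "\<lambda>i. coord x i"
  have "(norm2 (fv f x))\<^sup>2 = (\<Sum>i<n. (f (d i))\<^sup>2 * (?c i)\<^sup>2)"
    unfolding norm2_power2 by (simp add: scalar_prod_coords coords_fv power2_eq_square algebra_simps)
  also have "\<dots> \<le> (\<Sum>i<n. K\<^sup>2 * (?c i)\<^sup>2)"
    using f K by (intro sum_mono mult_right_mono) (auto intro: power2_le_iff_abs_le[THEN iffD2])
  also have "\<dots> = (K * norm2 x)\<^sup>2"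
    unfolding power_mult_distrib norm2_power2 using x
    by (simp add: scalar_prod_coords sum_distrib_left power2_eq_square)
  finally show "(norm2 (fv f x))\<^sup>2 \<le> (K * norm2 x)\<^sup>2" .
qed (use K in simp)

lemma scalar_prod_fv_ge:
  assumes x: "x \<in> carrier_vec n" and f: "\<And>i. i < n \<Longrightarrow> K \<le> f (d i)"
  shows "K * (norm2 x)\<^sup>2 \<le> x \<bullet> fv f x"
proof -
  have "K * (norm2 x)\<^sup>2 = (\<Sum>i<n. K * (coord x i)\<^sup>2)"
    unfolding norm2_power2 using x by (simp add: scalar_prod_coords sum_distrib_left power2_eq_square)
  also have "\<dots> \<le> (\<Sum>i<n. f (d i) * (coord x i)\<^sup>2)"
    using f by (intro sum_mono mult_right_mono) auto
  also have "\<dots> = x \<bullet> fv f x"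
    using x by (simp add: scalar_prod_coords coords_fv power2_eq_square algebra_simps)
  finally show ?thesis .
qed

lemma scalar_prod_fv_le:
  assumes x: "x \<in> carrier_vec n" and f: "\<And>i. i < n \<Longrightarrow> f (d i) \<le> K"
  shows "x \<bullet> fv f x \<le> K * (norm2 x)\<^sup>2"
proof -
  have "x \<bullet> fv f x = (\<Sum>i<n. f (d i) * (coord x i)\<^sup>2)"
    using x by (simp add: scalar_prod_coords coords_fv power2_eq_square algebra_simps)
  also have "\<dots> \<le> (\<Sum>i<n. K * (coord x i)\<^sup>2)"
    using f by (intro sum_mono mult_right_mono) auto
  also have "\<dots> = K * (norm2 x)\<^sup>2"
    unfolding norm2_power2 using x by (simp add: scalar_prod_coords sum_distrib_left power2_eq_square)
  finally show ?thesis .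
qed

lemma eigenvalue_d:
  assumes "i < n" shows "eigenvalue A (d i)"
proof -
  let ?v = "U *\<^sub>v unit_vec n i"
  have v: "?v \<in> carrier_vec n" using U by simp
  have "transpose_mat U *\<^sub>v ?v = unit_vec n i" by (rule transpose_U) simp
  then have coord_unit: "coord ?v j = (if j = i then 1 else 0)" if "j < n" for j
    using that assms unfolding coord_def by (simp del: index_mult_mat_vec)
  then have "A *\<^sub>v ?v = d i \<cdot>\<^sub>v ?v" unfolding A_mult[OF v] using v assms
    by (intro eq_by_coords) (auto simp: coords_fv coords_smult coord_unit)
  moreover have "?v \<noteq> 0\<^sub>v n"
  proof
    assume 0: "?v = 0\<^sub>v n"
    have "coord ?v i = 0" unfolding 0 coord_def using U assms by simp
    with coord_unit[OF assms] show False by simp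
  qed
  ultimately show ?thesis using v A by (auto simp: eigenvalue_def eigenvector_def)
qed

end

lemma symmetric_diagonalized:
  fixes A :: "real mat"
  assumes "A \<in> carrier_mat n n" "transpose_mat A = A"
  obtains U d where "diagonalized n A U d"
  using symmetric_diagonalization[OF assms] assms(1)
  by (auto simp: diagonalized_def orthonormal_mat_def)

text \<open>The Rayleigh quotient of C^T C is at least its smallest eigenvalue. Finiteness of the
  spectrum, read off the characteristic polynomial, is what gives \<open>Min\<close> its
  meaning.\<close>

lemma sigma_min_le:
  assumes C: "C \<in> carrier_mat N N" and pos: "0 < sigma_min C" and v: "v \<in> carrier_vec N"
  shows "sigma_min C * norm2 v \<le> norm2 (C *\<^sub>v v)"
proof (rule power2_le_imp_le)
  let ?S = "transpose_mat C * C"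
  have S: "?S \<in> carrier_mat N N" and "transpose_mat ?S = ?S"
    using C by (auto simp: transpose_mult[of _ N N])
  then obtain U d where "diagonalized N ?S U d" by (rule symmetric_diagonalized)
  then interpret diagonalized N ?S U d .
  have "char_poly ?S \<noteq> 0" using degree_monic_char_poly[OF S] by auto
  moreover have eigs: "Collect (eigenvalue ?S) = {x. poly (char_poly ?S) x = 0}"
    using eigenvalue_root_char_poly[OF S] by blast
  ultimately have fin: "finite (singular_values C)"
    using poly_roots_finite[of "char_poly ?S"] eigs by (simp add: singular_values_def)
  have "(sigma_min C)\<^sup>2 \<le> d i" if "i < N" for i
  proof -
    have "sqrt (d i) \<in> singular_values C"
      unfolding singular_values_def using eigenvalue_d[OF that] by auto
    then have *: "sigma_min C \<le> sqrt (d i)" unfolding sigma_min_def using fin by (rule Min_le[rotated])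
    \<comment> \<open>The real \<open>sqrt\<close> is negative on negative numbers, so a positive
      lower bound for the root already forces \<open>d i\<close> to be positive.\<close>
    with pos have "0 < d i" by (smt (verit) real_sqrt_gt_0_iff)
    then show ?thesis using * pos real_le_rsqrt[of "sigma_min C" "d i"]
      by (metis less_eq_real_def power_mono real_sqrt_pow2)
  qed
  then have "(sigma_min C)\<^sup>2 * (norm2 v)\<^sup>2 \<le> v \<bullet> (?S *\<^sub>v v)"
    unfolding A_mult[OF v] by (intro scalar_prod_fv_ge[OF v]) auto
  also have "\<dots> = (norm2 (C *\<^sub>v v))\<^sup>2"
    unfolding norm2_power2 using C v transpose_scalar_prod[of "transpose_mat C" N N v "C *\<^sub>v v"]
    by (simp add: assoc_mult_mat_vec[of _ N N _ N])
  finally show "(sigma_min C * norm2 v)\<^sup>2 \<le> (norm2 (C *\<^sub>v v))\<^sup>2" by (simp add: power_mult_distrib)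
qed simp

section \<open>Krylov spaces and the Lanczos process\<close>

text \<open>An inductive form of the linear span, so that membership arguments become rule
  inductions. Zero arises only as \<open>0 \<cdot>\<^sub>v x\<close>; hence \<open>lspan {}\<close>
  is empty and the comparison with the library span asks for a nonempty set.\<close>

inductive_set lspan :: "real vec set \<Rightarrow> real vec set" for S where
  base: "x \<in> S \<Longrightarrow> x \<in> lspan S"
| add: "x \<in> lspan S \<Longrightarrow> y \<in> lspan S \<Longrightarrow> x + y \<in> lspan S"
| smult: "x \<in> lspan S \<Longrightarrow> c \<cdot>\<^sub>v x \<in> lspan S"

lemma lspan_carrier: "x \<in> lspan S \<Longrightarrow> S \<subseteq> carrier_vec n \<Longrightarrow> x \<in> carrier_vec n"
  by (induction rule: lspan.induct) auto

lemma lspan_subset: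
  assumes "S \<subseteq> lspan T" shows "lspan S \<subseteq> lspan T"
proof
  fix x assume "x \<in> lspan S"
  then show "x \<in> lspan T" by induction (use assms in \<open>auto intro: lspan.intros\<close>)
qed

lemma lspan_mono: "S \<subseteq> T \<Longrightarrow> lspan S \<subseteq> lspan T"
  by (rule lspan_subset) (auto intro: lspan.base)

lemma mult_mat_lspan:
  assumes A: "A \<in> carrier_mat m n" and S: "S \<subseteq> carrier_vec n"
    and AS: "\<And>x. x \<in> S \<Longrightarrow> A *\<^sub>v x \<in> lspan T" and x: "x \<in> lspan S"
  shows "A *\<^sub>v x \<in> lspan T"
  using x
proof induction
  case (add x y)
  then show ?case using lspan_carrier[OF _ S]
    by (simp add: mult_add_distrib_mat_vec[OF A] lspan.add)
next
  case (smult x c)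
  then show ?case using lspan_carrier[OF _ S] by (simp add: mult_mat_vec[OF A] lspan.smult)
qed (rule AS)

lemma smult_zero_real: "v \<in> carrier_vec n \<Longrightarrow> (0 :: real) \<cdot>\<^sub>v v = 0\<^sub>v n"
  by auto

lemma lspan_diff:
  assumes "x \<in> lspan S" "y \<in> lspan S" "S \<subseteq> carrier_vec n"
  shows "x - y \<in> lspan S"
proof -
  have "x - y = x + (-1) \<cdot>\<^sub>v y" using lspan_carrier[OF assms(1,3)] lspan_carrier[OF assms(2,3)] by auto
  then show ?thesis using assms by (simp add: lspan.intros)
qed

context vec_space
begin

lemma dim_span_le_card:
  assumes S: "finite S" "S \<subseteq> carrier_vec n"
  shows "vectorspace.dim class_ring (span_vs S) \<le> card S"
proof -
  have "lin_indpt {}" by (simp add: lin_dep_def)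
  then obtain U where U: "finite U" "maximal U (\<lambda>T. T \<subseteq> S \<and> lin_indpt T)"
    using maximal_exists_superset[OF S(1), of "\<lambda>T. T \<subseteq> S \<and> lin_indpt T" "{}"] by auto
  then have "vectorspace.dim class_ring (span_vs S) = card U" using dim_span S by auto
  also have "card U \<le> card S" using U S by (auto simp: maximal_def intro: card_mono)
  finally show ?thesis .
qed

lemma dim_span_le:
  assumes S: "finite S" "S \<subseteq> carrier_vec n"
  shows "vectorspace.dim class_ring (span_vs S) \<le> n"
proof -
  have "subspace class_ring (span S) V" using S by (simp add: span_is_subspace)
  then show ?thesis using subspace_dim fin_dim_span S dim_is_n fin_dim by auto
qed

lemma dim_span_singleton:
  assumes g: "g \<in> carrier_vec n" "g \<noteq> 0\<^sub>v n"
  shows "vectorspace.dim class_ring (span_vs {g}) = 1"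
proof -
  have "lin_indpt {g}"
  proof (rule finite_lin_indpt2)
    fix a assume "lincomb a {g} = 0\<^sub>v n"
    then have "a g \<cdot>\<^sub>v g = 0\<^sub>v n" using g by (simp add: lincomb_def)
    then have "a g = 0 \<or> (1 / a g) \<cdot>\<^sub>v (a g \<cdot>\<^sub>v g) = 0\<^sub>v n" by auto
    then show "\<forall>v\<in>{g}. a v = 0" using g by (auto simp: smult_smult_assoc)
  qed (use g in auto)
  then have "maximal {g} (\<lambda>T. T \<subseteq> {g} \<and> lin_indpt T)" by (auto simp: maximal_def)
  then show ?thesis using dim_span[of "{g}" "{g}"] g by auto
qed

end

lemma span_eq_lspan:
  assumes S: "S \<subseteq> carrier_vec n" "S \<noteq> {}"
  shows "LinearCombinations.module.span class_ring (module_vec TYPE(real) n) S = lspan S"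
proof -
  interpret vec_space "TYPE(real)" n .
  have sub: "lspan S \<subseteq> carrier_vec n" using lspan_carrier[OF _ S(1)] by auto
  obtain x where "x \<in> S" using S by auto
  then have "0 \<cdot>\<^sub>v x \<in> lspan S" by (intro lspan.smult lspan.base)
  moreover have "0 \<cdot>\<^sub>v x = 0\<^sub>v n" using \<open>x \<in> S\<close> S by auto
  ultimately have "0\<^sub>v n \<in> lspan S" by simp
  then have "submodule class_ring (lspan S) V"
    using sub by (auto simp: submodule_def module_vec_simps intro: lspan.intros module_axioms)
  then have "span S \<subseteq> lspan S" by (intro span_is_subset) (auto intro: lspan.base)
  moreover have "x \<in> span S" if "x \<in> lspan S" for x
    using that
  proof induction
    case (base x)
    then show ?case using in_own_span[OF S(1)] by blast
  next
    case (add x y)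
    then show ?case using span_add1[OF S(1)] by simp
  next
    case (smult x c)
    then show ?case using smult_in_span[OF S(1)] by simp
  qed
  ultimately show ?thesis by auto
qed

lemma krylov_eq_lspan:
  assumes "A \<in> carrier_mat n n" "g \<in> carrier_vec n"
  shows "krylov A g k = lspan ((\<lambda>i. (A ^\<^sub>m i) *\<^sub>v g) ` {..k})"
  unfolding krylov_def using assms
  by (subst span_eq_lspan[symmetric, of _ n]) (auto intro!: mult_mat_vec_carrier[of _ n n])


section \<open>The Lanczos recurrence, its breakdown and the projected matrix\<close>

locale lanczos =
  fixes n :: nat and A :: "real mat" and g :: "real vec"
  assumes A: "A \<in> carrier_mat n n" and A_sym: "transpose_mat A = A"
    and g: "g \<in> carrier_vec n" and g_nz: "g \<noteq> 0\<^sub>v n"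
begin

abbreviation q :: "nat \<Rightarrow> real vec" where "q \<equiv> lanczos_vec A g"

text \<open>The predecessor of \<open>q j\<close>, zero for \<open>j = 0\<close>; there the
  coefficient \<open>b 0 = norm2 g\<close> multiplies a zero vector and has no effect on the
  recurrence.\<close>

definition p :: "nat \<Rightarrow> real vec" where "p j = fst (lanczos_state A g j)"

definition b :: "nat \<Rightarrow> real" where "b j = snd (snd (lanczos_state A g j))"

definition a :: "nat \<Rightarrow> real" where "a j = q j \<bullet> (A *\<^sub>v q j)"

definition r :: "nat \<Rightarrow> real vec" where
  "r j = A *\<^sub>v q j - a j \<cdot>\<^sub>v q j - b j \<cdot>\<^sub>v p j"

lemma state_eq: "lanczos_state A g j = (p j, q j, b j)"
  by (simp add: p_def b_def lanczos_vec_def)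

lemma p_0: "p 0 = 0\<^sub>v n" and q_0: "q 0 = (1 / norm2 g) \<cdot>\<^sub>v g"
  using g by (simp_all add: p_def lanczos_vec_def)

lemma p_Suc: "p (Suc j) = q j" and b_Suc: "b (Suc j) = norm2 (r j)"
  and q_Suc: "q (Suc j) = (1 / norm2 (r j)) \<cdot>\<^sub>v r j"
proof -
  have "(p (Suc j), q (Suc j), b (Suc j)) = (q j, (1 / norm2 (r j)) \<cdot>\<^sub>v r j, norm2 (r j))"
    unfolding state_eq[symmetric] lanczos_state.simps
    by (simp add: state_eq Let_def r_def a_def)
  then show "p (Suc j) = q j" "b (Suc j) = norm2 (r j)"
    "q (Suc j) = (1 / norm2 (r j)) \<cdot>\<^sub>v r j" by simp_all
qed

lemma carriers: "q j \<in> carrier_vec n \<and> p j \<in> carrier_vec n"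
proof (induction j)
  case 0
  then show ?case using g by (simp add: q_0 p_0)
next
  case (Suc j)
  then show ?case using A by (simp add: q_Suc p_Suc r_def)
qed

lemma q_carrier [simp]: "q j \<in> carrier_vec n" and p_carrier [simp]: "p j \<in> carrier_vec n"
  using carriers by auto

lemma q_dim [simp]: "dim_vec (q j) = n" and p_dim [simp]: "dim_vec (p j) = n"
  using carriers[of j] by auto

lemma r_carrier [simp]: "r j \<in> carrier_vec n"
  using A by (simp add: r_def)

lemma r_dim [simp]: "dim_vec (r j) = n"
  using r_carrier[of j] by simp

lemma norm_g_pos: "0 < norm2 g"
  using norm2_pos[OF g g_nz] .

text \<open>Also true at breakdown, where \<open>b (Suc j) = 0\<close> and \<open>r j = 0\<close>.\<close>

lemma three_term: "A *\<^sub>v q j = b (Suc j) \<cdot>\<^sub>v q (Suc j) + a j \<cdot>\<^sub>v q j + b j \<cdot>\<^sub>v p j"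
proof -
  have "b (Suc j) \<cdot>\<^sub>v q (Suc j) = r j"
  proof (cases "norm2 (r j) = 0")
    case True
    then have "r j = 0\<^sub>v n" by (simp add: norm2_eq_0[OF r_carrier])
    then show ?thesis by (auto simp: b_Suc q_Suc)
  next
    case False
    then show ?thesis by (simp add: b_Suc q_Suc smult_smult_assoc)
  qed
  moreover have "A *\<^sub>v q j = r j + a j \<cdot>\<^sub>v q j + b j \<cdot>\<^sub>v p j"
    using A carriers[of j] by (intro eq_vecI) (auto simp: r_def)
  ultimately show ?thesis by simp
qed

text \<open>By symmetry \<open>q i \<bullet> r k\<close> can be expanded with the recurrence for
  \<open>A *\<^sub>v q i\<close>. For \<open>i = k\<close> the term with \<open>a k\<close> cancels,
  for \<open>k = Suc i\<close> the term with \<open>b k\<close> cancels, and for smaller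
  \<open>i\<close> every term vanishes by induction.\<close>

lemma orthonormal_q:
  assumes "\<And>j. j < k \<Longrightarrow> norm2 (r j) \<noteq> 0" "i \<le> k" "j \<le> k"
  shows "q i \<bullet> q j = (if i = j then 1 else 0)"
  using assms
proof (induction k arbitrary: i j)
  case 0
  have "(norm2 (q 0))\<^sup>2 = 1" using norm_g_pos by (simp add: q_0 norm2_smult)
  with 0 show ?case by (simp add: norm2_power2)
next
  case (Suc k)
  have IH: "q i \<bullet> q j = (if i = j then 1 else 0)" if "i \<le> k" "j \<le> k" for i j
    using Suc.IH[OF _ that] Suc.prems(1) by simp
  have qp: "q j \<bullet> p i = (if i = Suc j then 1 else 0)" if "i \<le> k" "j \<le> k" for i j
    using that IH[of j "i - 1"] by (cases i) (auto simp: p_0 p_Suc)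
  have "q i \<bullet> r k = 0" if i: "i \<le> k" for i
  proof -
    have e: "q i \<bullet> r k = (A *\<^sub>v q i) \<bullet> q k - a k * (q i \<bullet> q k) - b k * (q i \<bullet> p k)"
      unfolding r_def using A symmetric_scalar_prod[OF A A_sym, of "q i" "q k"]
      by (simp add: scalar_prod_minus_distrib[of _ n])
    show ?thesis
    proof (cases "i = k")
      case True
      then show ?thesis unfolding e using IH[of k k] qp[of k k] A
        by (simp add: a_def scalar_prod_comm_real[of "A *\<^sub>v q k" n "q k"])
    next
      case False
      have "(A *\<^sub>v q i) \<bullet> q k = b (Suc i) * (q (Suc i) \<bullet> q k) + a i * (q i \<bullet> q k) + b i * (p i \<bullet> q k)"
        unfolding three_term[of i] by (simp add: add_scalar_prod_distrib[of _ n])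
      then show ?thesis unfolding e using False i IH[of i k] IH[of "Suc i" k] qp[of k i] qp[of i k]
        by (auto simp: scalar_prod_comm_real[of "p i" n "q k"])
    qed
  qed
  then have new: "q i \<bullet> q (Suc k) = 0" if "i \<le> k" for i using that by (simp add: q_Suc)
  have "norm2 (r k) \<noteq> 0" using Suc.prems(1) by simp
  then have "(norm2 (q (Suc k)))\<^sup>2 = 1" by (simp add: q_Suc norm2_smult)
  then have one: "q (Suc k) \<bullet> q (Suc k) = 1" by (simp add: norm2_power2)
  consider "i \<le> k" "j \<le> k" | "i \<le> k" "j = Suc k" | "i = Suc k" "j \<le> k" | "i = Suc k" "j = Suc k"
    using Suc.prems by linarith
  then show ?case
  proof cases
    case 3
    then show ?thesis using new[of j] scalar_prod_comm_real[of "q i" n "q j"] by simp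
  qed (use IH new one in auto)
qed

lemma p_lspan: "j \<le> k \<Longrightarrow> p j \<in> lspan (q ` {..k})"
proof (cases j)
  case 0
  have "0 \<cdot>\<^sub>v q 0 \<in> lspan (q ` {..k})" by (intro lspan.smult lspan.base) auto
  then show ?thesis using 0 smult_zero_real[OF q_carrier] by (simp add: p_0)
qed (auto simp: p_Suc intro!: lspan.base)

lemma q_subset: "q ` S \<subseteq> carrier_vec n" by auto

lemma A_q_lspan: "j < k \<Longrightarrow> A *\<^sub>v q j \<in> lspan (q ` {..k})"
  unfolding three_term[of j] by (intro lspan.add lspan.smult p_lspan lspan.base) auto

lemma A_lspan:
  assumes "x \<in> lspan (q ` {..j})" "j < k" shows "A *\<^sub>v x \<in> lspan (q ` {..k})"
  by (rule mult_mat_lspan[OF A q_subset _ assms(1)]) (use A_q_lspan assms(2) in auto)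

lemma g_lspan: "g \<in> lspan (q ` {..k})"
proof -
  have "norm2 g \<cdot>\<^sub>v q 0 \<in> lspan (q ` {..k})" by (intro lspan.smult lspan.base) auto
  then show ?thesis using norm_g_pos by (simp add: q_0 smult_smult_assoc)
qed

lemma pow_carrier [simp]: "(A ^\<^sub>m i) *\<^sub>v g \<in> carrier_vec n"
  using A g by (intro mult_mat_vec_carrier[of _ n n]) auto

lemma pow_Suc: "(A ^\<^sub>m Suc i) *\<^sub>v g = A *\<^sub>v ((A ^\<^sub>m i) *\<^sub>v g)"
proof -
  have "A ^\<^sub>m i * A = A * A ^\<^sub>m i"
  proof (induction i)
    case (Suc i)
    then show ?case using A by (simp add: assoc_mult_mat[of _ n n _ n _ n])
  qed (use A in simp)
  then show ?thesis using A g by (simp add: assoc_mult_mat_vec[of _ n n _ n])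
qed

lemma krylov_lspan: "krylov A g k = lspan ((\<lambda>i. (A ^\<^sub>m i) *\<^sub>v g) ` {..k})"
  by (rule krylov_eq_lspan[OF A g])

lemma krylov_mono: "i \<le> k \<Longrightarrow> krylov A g i \<subseteq> krylov A g k"
  unfolding krylov_lspan by (intro lspan_mono) auto

lemma pow_krylov: "i \<le> k \<Longrightarrow> (A ^\<^sub>m i) *\<^sub>v g \<in> krylov A g k"
  unfolding krylov_lspan by (rule lspan.base) auto

lemma A_krylov:
  assumes x: "x \<in> krylov A g k" shows "A *\<^sub>v x \<in> krylov A g (Suc k)"
proof -
  have "A *\<^sub>v y \<in> krylov A g (Suc k)" if "y \<in> (\<lambda>i. (A ^\<^sub>m i) *\<^sub>v g) ` {..k}" for y
    using that pow_krylov[of "Suc _" "Suc k"] unfolding pow_Suc by auto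
  then show ?thesis
    using x unfolding krylov_lspan by - (rule mult_mat_lspan[OF A, rotated 2], auto)
qed

lemma g_krylov: "g \<in> krylov A g k"
proof -
  have "(A ^\<^sub>m 0) *\<^sub>v g \<in> krylov A g k" by (rule pow_krylov) simp
  then show ?thesis using A g by simp
qed

lemma zero_krylov: "0\<^sub>v n \<in> krylov A g k"
proof -
  have "0 \<cdot>\<^sub>v g \<in> krylov A g k" using g_krylov unfolding krylov_lspan by (rule lspan.smult)
  then show ?thesis using smult_zero_real[OF g] by simp
qed

lemma q_krylov: "q k \<in> krylov A g k \<and> p k \<in> krylov A g k"
proof (induction k)
  case 0
  show ?case using g_krylov[of 0] zero_krylov[of 0] unfolding krylov_lspan q_0 p_0
    by (auto intro: lspan.smult)
next
  case (Suc k)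
  have *: "q k \<in> krylov A g (Suc k)" "p k \<in> krylov A g (Suc k)" "A *\<^sub>v q k \<in> krylov A g (Suc k)"
    using Suc krylov_mono[of k "Suc k"] A_krylov by auto
  then have "r k \<in> krylov A g (Suc k)"
    unfolding r_def krylov_lspan by (intro lspan_diff[of _ _ _ n] lspan.smult) auto
  then show ?case using * unfolding q_Suc p_Suc krylov_lspan by (auto intro: lspan.smult)
qed

lemma q_lspan_krylov: "lspan (q ` {..j}) \<subseteq> krylov A g j"
proof -
  have "q ` {..j} \<subseteq> krylov A g j" using q_krylov krylov_mono by blast
  then show ?thesis unfolding krylov_lspan by (rule lspan_subset)
qed

text \<open>With a zero residual, \<open>A *\<^sub>v q j\<close> stays in the span of the vectors
  found so far. That span contains \<open>g\<close> and is invariant under \<open>A\<close>, hence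
  contains every power applied to \<open>g\<close>.\<close>

lemma krylov_breakdown:
  assumes "norm2 (r j) = 0" "j \<le> k"
  shows "krylov A g k = krylov A g j"
proof
  have "r j = 0\<^sub>v n" using assms by (simp add: norm2_eq_0[OF r_carrier])
  then have "q (Suc j) = 0\<^sub>v n" by (auto simp: q_Suc)
  then have "A *\<^sub>v q j = a j \<cdot>\<^sub>v q j + b j \<cdot>\<^sub>v p j"
    unfolding three_term[of j] by (intro eq_vecI) auto
  then have "A *\<^sub>v q j \<in> lspan (q ` {..j})"
    by (simp add: lspan.add lspan.smult p_lspan lspan.base)
  note Aq = this
  have inv: "A *\<^sub>v x \<in> lspan (q ` {..j})" if "x \<in> lspan (q ` {..j})" for x
    by (rule mult_mat_lspan[OF A q_subset _ that]) (use A_q_lspan Aq in \<open>auto simp: le_less\<close>)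
  have "(A ^\<^sub>m i) *\<^sub>v g \<in> lspan (q ` {..j})" for i
  proof (induction i)
    case 0
    then show ?case using g_lspan A g by simp
  next
    case (Suc i)
    then show ?case unfolding pow_Suc by (rule inv)
  qed
  then have "(\<lambda>i. (A ^\<^sub>m i) *\<^sub>v g) ` {..k} \<subseteq> krylov A g j" using q_lspan_krylov by auto
  then show "krylov A g k \<subseteq> krylov A g j" unfolding krylov_lspan by (rule lspan_subset)
qed (use krylov_mono assms in auto)

text \<open>The bound by \<open>n\<close> makes the set in the definition of \<open>k_max\<close>
  finite and the value at 0 makes it nonempty, so that its \<open>Max\<close> is attained. The bound
  by \<open>Suc k\<close> is what contradicts an early breakdown.\<close>

lemma krylov_dim_bounds: "krylov_dim A g k \<le> Suc k" "krylov_dim A g k \<le> n" "krylov_dim A g 0 = 1"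
proof -
  interpret vec_space "TYPE(real)" n .
  let ?S = "\<lambda>k. (\<lambda>i. (A ^\<^sub>m i) *\<^sub>v g) ` {..k}"
  have S: "?S k \<subseteq> carrier_vec n" for k by auto
  have e: "krylov_dim A g k = vectorspace.dim class_ring (span_vs (?S k))" for k
    using g by (simp add: krylov_dim_def krylov_def)
  have "card (?S k) \<le> Suc k" using card_image_le[of "{..k}"] by simp
  then show "krylov_dim A g k \<le> Suc k" unfolding e using dim_span_le_card[OF _ S, of k] by simp
  show "krylov_dim A g k \<le> n" unfolding e using dim_span_le[OF _ S] by simp
  have "?S 0 = {g}" using A g by simp
  then show "krylov_dim A g 0 = 1" unfolding e using dim_span_singleton[OF g g_nz] by simp
qed

text \<open>A breakdown at \<open>j\<close> would freeze the Krylov spaces from \<open>j\<close> on,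
  so the dimension at \<open>k_max A g\<close> would be at most \<open>j + 1\<close>, less than the
  required value.\<close>

lemma no_breakdown:
  assumes "j < k_max A g" shows "norm2 (r j) \<noteq> 0"
proof
  assume 0: "norm2 (r j) = 0"
  let ?N = "{k. krylov_dim A g k = k + 1}"
  have "?N \<subseteq> {..n}" using krylov_dim_bounds(2) by (auto simp: le_Suc_eq) (metis Suc_leD)
  then have "k_max A g \<in> ?N"
    unfolding k_max_def using krylov_dim_bounds(3) by (intro Max_in) (auto intro: finite_subset)
  moreover have "krylov_dim A g (k_max A g) = krylov_dim A g j"
    using krylov_breakdown[OF 0, of "k_max A g"] assms by (simp add: krylov_dim_def)
  ultimately show False using krylov_dim_bounds(1)[of j] assms by simp
qed

lemma Q_carrier [simp]: "lanczos_Q A g k \<in> carrier_mat n (Suc k)"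
  unfolding lanczos_Q_def using g by (intro carrier_matI) auto

lemma Q_dim [simp]: "dim_row (lanczos_Q A g k) = n" "dim_col (lanczos_Q A g k) = Suc k"
  using carrier_matD[OF Q_carrier] by simp_all

lemma Q_mult_carrier [simp]: "v \<in> carrier_vec (Suc k) \<Longrightarrow> lanczos_Q A g k *\<^sub>v v \<in> carrier_vec n"
  by (rule mult_mat_vec_carrier[OF Q_carrier])

lemma Q_col: "i \<le> k \<Longrightarrow> col (lanczos_Q A g k) i = q i"
  unfolding lanczos_Q_def using g by (subst col_mat_of_cols) (auto simp: nth_append)

lemma Q_orthonormal:
  assumes "k \<le> k_max A g"
  shows "transpose_mat (lanczos_Q A g k) * lanczos_Q A g k = 1\<^sub>m (Suc k)"
proof (rule eq_matI)
  fix i j assume "i < dim_row (1\<^sub>m (Suc k) :: real mat)" "j < dim_col (1\<^sub>m (Suc k) :: real mat)"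
  then have ij: "i \<le> k" "j \<le> k" by auto
  have "(transpose_mat (lanczos_Q A g k) * lanczos_Q A g k) $$ (i, j) = q i \<bullet> q j"
    using ij Q_carrier[of k] by (simp add: Q_col)
  also have "\<dots> = (if i = j then 1 else 0)"
    using no_breakdown assms ij by (intro orthonormal_q[of k]) auto
  finally show "(transpose_mat (lanczos_Q A g k) * lanczos_Q A g k) $$ (i, j) = 1\<^sub>m (Suc k) $$ (i, j)"
    using ij by simp
qed (use Q_carrier[of k] in auto)

lemma Q_transpose_index: "i \<le> k \<Longrightarrow> (transpose_mat (lanczos_Q A g k) *\<^sub>v x) $ i = q i \<bullet> x"
  using Q_carrier[of k] by (simp add: Q_col)

lemma Q_unit_vec: "i \<le> k \<Longrightarrow> lanczos_Q A g k *\<^sub>v unit_vec (Suc k) i = q i"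
proof (rule eq_vecI)
  fix t assume "i \<le> k" "t < dim_vec (q i)"
  then show "(lanczos_Q A g k *\<^sub>v unit_vec (Suc k) i) $ t = q i $ t"
    by (simp flip: Q_col)
qed auto

lemma lspan_Q:
  assumes "x \<in> lspan (q ` {..k})"
  shows "\<exists>c \<in> carrier_vec (Suc k). x = lanczos_Q A g k *\<^sub>v c"
  using assms
proof induction
  case (base x)
  then show ?case using Q_unit_vec[symmetric] unit_vec_carrier by blast
next
  case (add x y)
  then obtain c d where "c \<in> carrier_vec (Suc k)" "d \<in> carrier_vec (Suc k)"
    "x = lanczos_Q A g k *\<^sub>v c" "y = lanczos_Q A g k *\<^sub>v d" by auto
  then show ?case by (intro bexI[of _ "c + d"]) (auto simp: mult_add_distrib_mat_vec[OF Q_carrier])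
next
  case (smult x \<alpha>)
  then obtain c where "c \<in> carrier_vec (Suc k)" "x = lanczos_Q A g k *\<^sub>v c" by auto
  then show ?case by (intro bexI[of _ "\<alpha> \<cdot>\<^sub>v c"]) (auto simp: mult_mat_vec[OF Q_carrier])
qed

lemma Q_transpose_g:
  assumes "k \<le> k_max A g"
  shows "transpose_mat (lanczos_Q A g k) *\<^sub>v g = lanczos_rhs g k"
proof -
  let ?Q = "lanczos_Q A g k"
  have "g = norm2 g \<cdot>\<^sub>v q 0" using norm_g_pos by (simp add: q_0 smult_smult_assoc)
  also have "q 0 = ?Q *\<^sub>v unit_vec (Suc k) 0" by (simp add: Q_unit_vec)
  finally have "transpose_mat ?Q *\<^sub>v g = transpose_mat ?Q *\<^sub>v (norm2 g \<cdot>\<^sub>v (?Q *\<^sub>v unit_vec (Suc k) 0))"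
    by simp
  also have "\<dots> = norm2 g \<cdot>\<^sub>v (transpose_mat ?Q *\<^sub>v (?Q *\<^sub>v unit_vec (Suc k) 0))"
    by (rule mult_mat_vec[of _ "Suc k" n]) (use Q_carrier[of k] in auto)
  also have "transpose_mat ?Q *\<^sub>v (?Q *\<^sub>v unit_vec (Suc k) 0) = unit_vec (Suc k) 0"
    using Q_carrier[of k] Q_orthonormal[OF assms]
    by (subst assoc_mult_mat_vec[symmetric, of _ "Suc k" n _ "Suc k"]) auto
  finally show ?thesis by (simp add: lanczos_rhs_def)
qed

lemma T_carrier [simp]: "lanczos_T A g k \<in> carrier_mat (Suc k) (Suc k)"
  unfolding lanczos_T_def using A Q_carrier[of k] by (intro mult_carrier_mat[of _ _ n]) auto

lemma T_mult:
  assumes x: "x \<in> carrier_vec (Suc k)"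
  shows "lanczos_T A g k *\<^sub>v x = transpose_mat (lanczos_Q A g k) *\<^sub>v (A *\<^sub>v (lanczos_Q A g k *\<^sub>v x))"
proof -
  let ?Q = "lanczos_Q A g k"
  have Qt: "transpose_mat ?Q \<in> carrier_mat (Suc k) n" by simp
  have "lanczos_T A g k *\<^sub>v x = (transpose_mat ?Q * A) *\<^sub>v (?Q *\<^sub>v x)"
    unfolding lanczos_T_def using Qt A x by (intro assoc_mult_mat_vec[OF _ Q_carrier]) auto
  also have "\<dots> = transpose_mat ?Q *\<^sub>v (A *\<^sub>v (?Q *\<^sub>v x))"
    using x by (intro assoc_mult_mat_vec[OF Qt A]) simp
  finally show ?thesis .
qed

lemma T_sym: "transpose_mat (lanczos_T A g k) = lanczos_T A g k"
proof -
  let ?Q = "lanczos_Q A g k"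
  have Qt: "transpose_mat ?Q \<in> carrier_mat (Suc k) n" by simp
  have "transpose_mat (lanczos_T A g k) = transpose_mat ?Q * transpose_mat (transpose_mat ?Q * A)"
    unfolding lanczos_T_def using Qt A by (intro transpose_mult[OF _ Q_carrier]) auto
  also have "transpose_mat (transpose_mat ?Q * A) = A * ?Q"
    using transpose_mult[OF Qt A] A_sym by simp
  also have "transpose_mat ?Q * (A * ?Q) = lanczos_T A g k"
    unfolding lanczos_T_def using assoc_mult_mat[OF Qt A Q_carrier] by simp
  finally show ?thesis .
qed

text \<open>The tridiagonal matrix is unreduced, so its rows determine an eigenvector from the first entry.\<close>

lemma T_eigenvector_first:
  assumes k: "k \<le> k_max A g" and v: "v \<in> carrier_vec (Suc k)"
    and Tv: "lanczos_T A g k *\<^sub>v v = \<theta> \<cdot>\<^sub>v v" and v0: "v $ 0 = 0"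
  shows "v = 0\<^sub>v (Suc k)"
proof -
  let ?Q = "lanczos_Q A g k"
  \<comment> \<open>Lifting \<open>v\<close> turns row \<open>i\<close> of the eigenvalue equation
    into an inner product with \<open>A *\<^sub>v q i\<close>, to which the recurrence applies
    directly; the entries of the tridiagonal matrix are never computed.\<close>
  define u where "u = ?Q *\<^sub>v v"
  have u: "u \<in> carrier_vec n" unfolding u_def using Q_carrier v by (rule mult_mat_vec_carrier)
  have "transpose_mat ?Q *\<^sub>v u = v" unfolding u_def
    using Q_carrier[of k] Q_orthonormal[OF k] v
    by (subst assoc_mult_mat_vec[symmetric, of _ "Suc k" n _ "Suc k"]) auto
  then have qu: "q i \<bullet> u = v $ i" if "i \<le> k" for i using Q_transpose_index[OF that, of u] by simp
  have qAu: "(A *\<^sub>v q i) \<bullet> u = \<theta> * v $ i" if "i \<le> k" for i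
  proof -
    have "(A *\<^sub>v q i) \<bullet> u = q i \<bullet> (A *\<^sub>v u)" using symmetric_scalar_prod[OF A A_sym _ u] by simp
    also have "\<dots> = (lanczos_T A g k *\<^sub>v v) $ i"
      unfolding T_mult[OF v] u_def using Q_transpose_index[OF that] by simp
    finally show ?thesis using that v unfolding Tv by simp
  qed
  have zeros: "\<forall>i\<le>j. v $ i = 0" if "j \<le> k" for j
    using that
  proof (induction j)
    case (Suc j)
    then have IH: "\<forall>i\<le>j. v $ i = 0" and j: "j < k" by auto
    have "p j \<bullet> u = 0" using IH qu[of "j - 1"] j u by (cases j) (auto simp: p_0 p_Suc)
    then have "b (Suc j) * v $ Suc j = 0"
      using qAu[of j] IH j u qu[of j] qu[of "Suc j"] unfolding three_term[of j]
      by (simp add: add_scalar_prod_distrib[of _ n])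
    moreover have "b (Suc j) \<noteq> 0" using no_breakdown[of j] j k by (simp add: b_Suc)
    ultimately show ?case using IH by (auto simp: le_Suc_eq)
  qed (use v0 in simp)
  show ?thesis using v zeros[OF order_refl] by (intro eq_vecI) auto
qed

end

section \<open>Chebyshev approximation and scalar estimates\<close>

fun chebyshev :: "nat \<Rightarrow> real poly" where
  "chebyshev 0 = 1"
| "chebyshev (Suc 0) = [:0, 1:]"
| "chebyshev (Suc (Suc n)) = [:0, 2:] * chebyshev (Suc n) - chebyshev n"

lemma degree_chebyshev: "degree (chebyshev n) \<le> n"
proof (induction n rule: chebyshev.induct)
  case (3 n)
  have "degree ([:0, 2:] * chebyshev (Suc n)) \<le> 1 + Suc n"
    by (rule order_trans[OF degree_mult_le add_mono]) (use 3 in auto)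
  then show ?case using 3 by (simp add: degree_diff_le)
qed auto

lemma poly_chebyshev_cos: "poly (chebyshev n) (cos \<theta>) = cos (real n * \<theta>)"
proof (induction n rule: chebyshev.induct)
  case (3 n)
  let ?a = "real (Suc n) * \<theta>"
  have "cos (?a + \<theta>) = 2 * cos \<theta> * cos ?a - cos (?a - \<theta>)"
    by (simp add: cos_add cos_diff)
  moreover have "?a + \<theta> = real (Suc (Suc n)) * \<theta>" "?a - \<theta> = real n * \<theta>"
    by (simp_all add: algebra_simps)
  ultimately have "cos (real (Suc (Suc n)) * \<theta>) = 2 * cos \<theta> * cos ?a - cos (real n * \<theta>)"
    by metis
  then show ?case using 3 by simp
qed auto

lemma abs_poly_chebyshev_le:
  assumes "\<bar>u\<bar> \<le> 1" shows "\<bar>poly (chebyshev n) u\<bar> \<le> 1"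
proof -
  have "u = cos (arccos u)" using assms by (simp add: abs_le_iff)
  then show ?thesis by (metis poly_chebyshev_cos abs_cos_le_one)
qed

text \<open>For t = exp (-x) this is T_n (cosh x) = cosh (n x). It evaluates the polynomial outside
  [-1, 1], where the origin of the spectral axis will be mapped.\<close>

lemma poly_chebyshev_joukowski:
  assumes "s * t = 1"
  shows "poly (chebyshev n) ((t + s) / 2) = (t ^ n + s ^ n) / 2"
proof (induction n rule: chebyshev.induct)
  case (3 n)
  have e: "s * (t * z) = z" for z using assms by (simp flip: mult.assoc)
  show ?case using 3 by (simp add: algebra_simps e add_divide_distrib)
qed (use assms in auto)

text \<open>The counterpart of T_n' (cosh x) sinh x = n sinh (n x). It gives the derivative of the
  normalised polynomial at the origin.\<close>

lemma poly_pderiv_chebyshev_joukowski: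
  assumes "s * t = 1"
  shows "(s - t) * poly (pderiv (chebyshev n)) ((t + s) / 2) = real n * (s ^ n - t ^ n)"
proof (induction n rule: chebyshev.induct)
  case (3 n)
  have e: "s * (t * z) = z" for z using assms by (simp flip: mult.assoc)
  let ?x = "(t + s) / 2"
  have *: "poly (pderiv (chebyshev (Suc (Suc n)))) ?x = 2 * poly (chebyshev (Suc n)) ?x
      + (t + s) * poly (pderiv (chebyshev (Suc n))) ?x - poly (pderiv (chebyshev n)) ?x"
    by (simp add: pderiv_mult pderiv_diff pderiv_pCons pderiv_smult algebra_simps)
  have "(s - t) * poly (pderiv (chebyshev (Suc (Suc n)))) ?x =
      (s - t) * (2 * poly (chebyshev (Suc n)) ?x)
      + (t + s) * ((s - t) * poly (pderiv (chebyshev (Suc n))) ?x)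
      - (s - t) * poly (pderiv (chebyshev n)) ?x"
    unfolding * by (simp add: algebra_simps)
  also have "\<dots> = (s - t) * (t ^ Suc n + s ^ Suc n) + (t + s) * (real (Suc n) * (s ^ Suc n - t ^ Suc n))
      - real n * (s ^ n - t ^ n)"
    using 3 poly_chebyshev_joukowski[OF assms, of "Suc n"] by simp
  also have "\<dots> = real (Suc (Suc n)) * (s ^ Suc (Suc n) - t ^ Suc (Suc n))"
  proof -
    have 1: "(s - t) * (t ^ Suc n + s ^ Suc n) = s ^ Suc (Suc n) - t ^ Suc (Suc n) + t ^ n - s ^ n"
      by (simp add: algebra_simps e)
    have 2: "(t + s) * (s ^ Suc n - t ^ Suc n) = s ^ Suc (Suc n) - t ^ Suc (Suc n) + s ^ n - t ^ n"
      by (simp add: algebra_simps e)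
    have "(t + s) * (real (Suc n) * (s ^ Suc n - t ^ Suc n))
        = real (Suc n) * ((t + s) * (s ^ Suc n - t ^ Suc n))" by (simp add: mult.left_commute)
    then show ?thesis unfolding 1 2 by (simp add: algebra_simps)
  qed
  finally show ?case .
qed (auto simp: pderiv_pCons)

text \<open>The first residual is the Chebyshev polynomial \<open>W\<close> of the interval, normalised at 0; multiplying
  it by \<open>1 - W'(0) x\<close> kills its derivative at 0, which gives \<open>x\<close> times the second residual.\<close>

lemma chebyshev_inverse_approximation:
  fixes \<beta> t :: real
  assumes \<beta>: "0 < \<beta>" and t: "0 < t" "t < 1"
  obtains p1 p2 :: "real poly" where "degree p1 \<le> k" "degree p2 \<le> k"
    "\<And>x. \<beta> * (1 - t)\<^sup>2 \<le> x \<Longrightarrow> x \<le> \<beta> * (1 + t)\<^sup>2 \<Longrightarrow>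
       \<bar>1 - x * poly p1 x\<bar> \<le> 2 * t ^ Suc k / (1 + (t ^ Suc k)\<^sup>2)"
    "\<And>x. \<beta> * (1 - t)\<^sup>2 \<le> x \<Longrightarrow> x \<le> \<beta> * (1 + t)\<^sup>2 \<Longrightarrow>
       \<bar>1 / x - x * poly p2 x\<bar>
         \<le> 2 * t ^ Suc k * (1 / (\<beta> * (1 - t)\<^sup>2) + real (Suc k) / (\<beta> * (1 - t\<^sup>2)))"
proof -
  define m where "m = Suc k"
  define \<tau> where "\<tau> = t ^ m"
  define s where "s = 1 / t"
  have st: "s * t = 1" using t by (simp add: s_def)
  have \<tau>: "0 < \<tau>" using t by (simp add: \<tau>_def)
  have sm: "s ^ m = 1 / \<tau>" using t by (simp add: s_def \<tau>_def power_divide)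
  define x0 where "x0 = (t + s) / 2"
  \<comment> \<open>The affine map takes the spectral interval onto [-1, 1] with reversed
    orientation, and takes 0 to \<open>x0\<close>.\<close>
  define L where "L = [:x0, - 1 / (2 * \<beta> * t):]"
  have T0: "poly (chebyshev m) x0 = (1 + \<tau>\<^sup>2) / (2 * \<tau>)"
    unfolding x0_def poly_chebyshev_joukowski[OF st] sm using \<tau>
    by (simp add: \<tau>_def[symmetric] field_simps power2_eq_square)
  have \<tau>2: "0 < 1 + \<tau>\<^sup>2" by (simp add: add_pos_nonneg)
  \<comment> \<open>The reciprocal of the Chebyshev value at \<open>x0\<close>: it normalises
    \<open>W\<close> at 0 and is therefore the bound for \<open>W\<close> on the interval.\<close>
  define \<eta> where "\<eta> = 2 * \<tau> / (1 + \<tau>\<^sup>2)"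
  have \<eta>0: "0 < \<eta>" using \<tau> \<tau>2 by (simp add: \<eta>_def)
  have \<eta>T: "\<eta> * poly (chebyshev m) x0 = 1" using \<tau> \<tau>2 by (simp add: \<eta>_def T0)
  define W where "W = Polynomial.smult \<eta> (pcompose (chebyshev m) L)"
  have W0: "poly W 0 = 1" using \<eta>T by (simp add: W_def poly_pcompose L_def)
  have "degree L \<le> 1" by (simp add: L_def)
  have "degree W \<le> degree (chebyshev m) * degree L"
    unfolding W_def by (rule order_trans[OF degree_smult_le degree_pcompose_le])
  also have "\<dots> \<le> m * 1" using degree_chebyshev \<open>degree L \<le> 1\<close> by (rule mult_le_mono)
  finally have degW: "degree W \<le> m" by simp
  have W_le: "\<bar>poly W x\<bar> \<le> \<eta>" if x: "\<beta> * (1 - t)\<^sup>2 \<le> x" "x \<le> \<beta> * (1 + t)\<^sup>2" for x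
  proof -
    have e: "poly L x = (\<beta> * (1 + t\<^sup>2) - x) / (2 * \<beta> * t)"
      using \<beta> t by (simp add: L_def x0_def s_def field_simps power2_eq_square)
    have "\<beta> * (1 + t\<^sup>2) - x \<le> 2 * \<beta> * t" "- (\<beta> * (1 + t\<^sup>2) - x) \<le> 2 * \<beta> * t"
      using x by (simp_all add: algebra_simps power2_eq_square)
    then have "\<bar>poly L x\<bar> \<le> 1" unfolding e abs_divide using \<beta> t by (simp add: abs_le_iff)
    then have "\<bar>poly (chebyshev m) (poly L x)\<bar> \<le> 1" by (rule abs_poly_chebyshev_le)
    then show ?thesis using \<eta>0 by (simp add: W_def poly_pcompose abs_mult mult_left_le)
  qed
  \<comment> \<open>\<open>W\<close> has value 1 at 0, so 1 - W is divisible by x; this also lowers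
    the degree from \<open>Suc k\<close> to \<open>k\<close>.\<close>
  obtain p1 where p1: "1 - W = pCons 0 p1"
  proof (cases "1 - W")
    case (pCons c p)
    then have "c = 0" using W0 by (metis add.right_neutral diff_self mult_zero_left poly_1 poly_diff poly_pCons)
    then show thesis using that pCons by simp
  qed
  obtain c p3 where p3: "p1 = pCons c p3" by (cases p1) auto
  have "degree (1 - W) \<le> m" using degW by (intro degree_diff_le) auto
  then have d1: "degree p1 \<le> k" unfolding p1 m_def by (auto split: if_splits)
  then have "degree p3 \<le> k" unfolding p3 by (auto split: if_splits)
  \<comment> \<open>From W = 1 - x p1 and p1 = c + x p3 one gets W (1 + c x) = 1 - x^2 (p3 + c p1).
    The constant \<open>c\<close> is - W'(0), so the linear term cancels.\<close>
  define p2 where "p2 = p3 + Polynomial.smult c p1"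
  have d2: "degree p2 \<le> k" unfolding p2_def using d1 \<open>degree p3 \<le> k\<close>
    by (intro degree_add_le) (auto intro: order_trans[OF degree_smult_le])
  have Wp1: "poly W x = 1 - x * poly p1 x" for x
    using arg_cong[OF p1, of "\<lambda>p. poly p x"] by simp
  have Wc: "poly W x * (1 + c * x) = 1 - x\<^sup>2 * poly p2 x" for x
    unfolding Wp1 p2_def by (simp add: p3 algebra_simps power2_eq_square)
  have "pderiv W = - (p1 + pCons 0 (pderiv p1))"
    using arg_cong[OF p1, of pderiv] by (simp add: pderiv_diff pderiv_pCons minus_equation_iff[of "pderiv W"] eq_commute)
  then have "c = - poly (pderiv W) 0" by (simp add: p3)
  also have "\<dots> = \<eta> * poly (pderiv (chebyshev m)) x0 / (2 * \<beta> * t)"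
    by (simp add: W_def pderiv_smult pderiv_pcompose poly_pcompose L_def pderiv_pCons)
  finally have c: "c = \<eta> * poly (pderiv (chebyshev m)) x0 / (2 * \<beta> * t)" .
  have s_t: "s - t = (1 - t\<^sup>2) / t" using t by (simp add: s_def field_simps power2_eq_square)
  have t2: "0 < 1 - t\<^sup>2" using t by (simp add: power_less_one_iff)
  have "poly (pderiv (chebyshev m)) x0 = real m * (1 / \<tau> - \<tau>) * t / (1 - t\<^sup>2)"
    using poly_pderiv_chebyshev_joukowski[OF st, of m, folded x0_def] t t2 unfolding s_t sm
    by (simp add: \<tau>_def[symmetric] field_simps)
  \<comment> \<open>The second factor lies in [0, 1]; dropping it leaves the term with
    \<open>real (Suc k)\<close> in the second residual bound.\<close>
  then have cr: "c = (real m / (\<beta> * (1 - t\<^sup>2))) * ((1 - \<tau>\<^sup>2) / (1 + \<tau>\<^sup>2))"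
    unfolding c \<eta>_def using \<tau> t t2 \<beta> \<tau>2 by (simp add: divide_simps power2_eq_square)
      (simp add: algebra_simps)
  have "\<tau> < 1" using power_Suc_less_one[of t k] t by (simp add: \<tau>_def m_def)
  then have "0 \<le> (1 - \<tau>\<^sup>2) / (1 + \<tau>\<^sup>2)" "(1 - \<tau>\<^sup>2) / (1 + \<tau>\<^sup>2) \<le> 1"
    using \<tau> \<tau>2 by (auto simp: power_le_one)
  moreover have "0 \<le> real m / (\<beta> * (1 - t\<^sup>2))" using \<beta> t2 by simp
  ultimately have "0 \<le> c \<and> c \<le> real m / (\<beta> * (1 - t\<^sup>2))"
    unfolding cr by (intro conjI mult_nonneg_nonneg mult_left_le)
  then have c_bounds: "0 \<le> c" "c \<le> real m / (\<beta> * (1 - t\<^sup>2))" by auto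
  show thesis
  proof (rule that[OF d1 d2])
    fix x assume x: "\<beta> * (1 - t)\<^sup>2 \<le> x" "x \<le> \<beta> * (1 + t)\<^sup>2"
    show "\<bar>1 - x * poly p1 x\<bar> \<le> 2 * t ^ Suc k / (1 + (t ^ Suc k)\<^sup>2)"
      using W_le[OF x] unfolding Wp1 \<eta>_def \<tau>_def m_def .
    have a: "0 < \<beta> * (1 - t)\<^sup>2" using \<beta> t by simp
    with x have x0: "0 < x" by linarith
    have "1 / x - x * poly p2 x = (1 - x\<^sup>2 * poly p2 x) / x"
      using x0 by (simp add: field_simps power2_eq_square)
    also have "\<dots> = poly W x * (1 / x + c)"
      unfolding Wc[symmetric] using x0 by (simp add: field_simps)
    finally have "\<bar>1 / x - x * poly p2 x\<bar> = \<bar>poly W x\<bar> * (1 / x + c)"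
      using x0 c_bounds by (simp add: abs_mult)
    also have "\<dots> \<le> 2 * \<tau> * (1 / (\<beta> * (1 - t)\<^sup>2) + real m / (\<beta> * (1 - t\<^sup>2)))"
    proof (intro mult_mono add_mono)
      have "\<eta> \<le> 2 * \<tau>" unfolding \<eta>_def using \<tau> \<tau>2 by (simp add: divide_le_eq)
      then show "\<bar>poly W x\<bar> \<le> 2 * \<tau>" using W_le[OF x] by linarith
      show "1 / x \<le> 1 / (\<beta> * (1 - t)\<^sup>2)" using x a by (intro divide_left_mono) auto
    qed (use \<tau> x0 c_bounds in auto)
    finally show "\<bar>1 / x - x * poly p2 x\<bar>
         \<le> 2 * t ^ Suc k * (1 / (\<beta> * (1 - t)\<^sup>2) + real (Suc k) / (\<beta> * (1 - t\<^sup>2)))"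
      by (simp add: \<tau>_def m_def)
  qed
qed


section \<open>Scalar comparison of the bounds with the constant c_k\<close>

text \<open>With t = exp (-x) this reads x <= sinh x. It replaces the logarithm in c_k by a rational
  function of \<open>t\<close>.\<close>

lemma neg_ln_le:
  fixes t :: real
  assumes "0 < t" "t < 1" shows "- ln t \<le> (1 - t\<^sup>2) / (2 * t)"
proof -
  define f where "f = (\<lambda>x :: real. (1 / x - x) / 2 + ln x)"
  have "f 1 \<le> f t"
  proof (rule DERIV_nonpos_imp_nonincreasing[of t 1 f])
    fix x assume "t \<le> x" "x \<le> 1"
    then have x: "0 < x" using assms by simp
    have "(f has_real_derivative - ((1 - x)\<^sup>2 / (2 * x\<^sup>2))) (at x)"
      unfolding f_def using x
      by (auto intro!: derivative_eq_intros simp: field_simps power2_eq_square)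
    then show "\<exists>y. (f has_real_derivative y) (at x) \<and> y \<le> 0" by (intro exI conjI) auto
  qed (use assms in simp)
  then show ?thesis using assms by (simp add: f_def field_simps power2_eq_square)
qed

text \<open>The quantities: \<open>\<tau> = t ^ m\<close> with \<open>m = k + 1\<close>, \<open>u = sin\<^sup>2 (\<phi> / 2)\<close> for the angle \<open>\<phi>\<close> in
  question, \<open>2 * t / (1 + t\<^sup>2)\<close> is the Wielandt ratio and \<open>((1 + t) / (1 - t))\<^sup>2\<close> the condition number.\<close>

lemma small_t_bound:
  fixes t \<tau> u :: real
  assumes t: "0 < t" "t < 3 / 8" and \<tau>: "0 < \<tau>" "\<tau> \<le> t\<^sup>2"
    and u: "0 \<le> u" "u \<le> ((1 + t) / (1 - t))\<^sup>2 * \<tau>\<^sup>2"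
    and wielandt: "4 * u * (1 - u - (2 * t / (1 + t\<^sup>2))\<^sup>2) \<le> 4 * \<tau>\<^sup>2"
  shows "4 * u * (1 - u) \<le> 9 * \<tau>\<^sup>2"
proof -
  \<comment> \<open>11/5 is the value at t = 3/8. With \<open>\<tau>\<close> at most 9/64 it forces
    \<open>u\<close> below 1/10.\<close>
  have "(1 + t) / (1 - t) \<le> 11 / 5" using t by (simp add: field_simps)
  moreover have "\<tau> \<le> (3 / 8)\<^sup>2" using \<tau>(2) power_mono[of t "3 / 8" 2] t by linarith
  ultimately have "(1 + t) / (1 - t) * \<tau> \<le> 11 / 5 * (3 / 8)\<^sup>2"
    using t \<tau> by (intro mult_mono) auto
  then have "((1 + t) / (1 - t) * \<tau>)\<^sup>2 \<le> (11 / 5 * (3 / 8)\<^sup>2)\<^sup>2"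
    using t \<tau> by (intro power_mono) auto
  also have "\<dots> \<le> (1 / 10 :: real)" by (simp add: power2_eq_square)
  finally have u1: "u \<le> 1 / 10" using u(2) unfolding power_mult_distrib by linarith
  \<comment> \<open>A factored form of the claim that 2t / (1 + t^2) is at most its value 48/73 at t
    = 3/8.\<close>
  have "0 \<le> (3 - 8 * t) * (8 - 3 * t)" using t by (intro mult_nonneg_nonneg) auto
  then have "2 * t * 73 \<le> 48 * (1 + t\<^sup>2)" by (simp add: power2_eq_square algebra_simps)
  then have "2 * t / (1 + t\<^sup>2) \<le> 48 / 73"
    using t by (subst divide_le_eq) (auto simp: add_pos_nonneg)
  then have "(2 * t / (1 + t\<^sup>2))\<^sup>2 \<le> (48 / 73)\<^sup>2" using t by (intro power_mono) auto
  also have "\<dots> \<le> (9 / 10 - 4 / 9 :: real)" by (simp add: power2_eq_square)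
  \<comment> \<open>The threshold 4/9 is the one needed: dividing the bound 4
    \<open>\<tau>\<^sup>2\<close> by it gives exactly 9 \<open>\<tau>\<^sup>2\<close>.\<close>
  finally have "4 / 9 \<le> 1 - u - (2 * t / (1 + t\<^sup>2))\<^sup>2" using u1 by linarith
  then have "4 * u * (4 / 9) \<le> 4 * u * (1 - u - (2 * t / (1 + t\<^sup>2))\<^sup>2)"
    using u by (intro mult_left_mono) auto
  then have "4 * u \<le> 9 * \<tau>\<^sup>2" using wielandt by linarith
  moreover have "4 * u * (1 - u) \<le> 4 * u * 1" using u by (intro mult_left_mono) auto
  ultimately show ?thesis by linarith
qed

text \<open>Three ways to bound the angle, each covering part of the range of \<open>t\<close>:
  the residual bound for \<open>t \<ge> 1 / 2\<close>, and for \<open>t \<ge> 3 / 8\<close> if \<open>X \<le> 2\<close>;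
  the optimality of the Lanczos iterate for \<open>t \<le> 1 / 2\<close> and \<open>X > 2\<close>;
  and the sharper consequence of optimality for \<open>t < 3 / 8\<close>.\<close>

lemma combine_bounds:
  fixes t \<beta> \<tau> X S :: real and k :: nat
  defines "D \<equiv> (1 + t) / (\<beta> * (1 - t)) * (1 + (real k + 2) / \<bar>ln t\<bar>)"
    and "F \<equiv> 2 * (1 / (\<beta> * (1 - t)\<^sup>2) + real (Suc k) / (\<beta> * (1 - t\<^sup>2)))"
  assumes \<beta>: "0 < \<beta>" and t: "0 < t" "t < 1" and \<tau>: "0 < \<tau>" and X: "1 / 2 \<le> X"
    and residual: "S \<le> (2 + F) * \<tau> * sqrt (1 + X\<^sup>2)"
    and optimal: "S \<le> 2 * ((1 + t) / (1 - t)) * \<tau>"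
    and small: "t < 3 / 8 \<Longrightarrow> S \<le> 3 * \<tau>"
  shows "S \<le> (2 + D) * (1 + X) * \<tau>"
proof -
  define m where "m = real (Suc k)"
  have m: "1 \<le> m" by (simp add: m_def)
  have L: "2 * t / (1 - t\<^sup>2) \<le> 1 / \<bar>ln t\<bar>"
  proof -
    have "ln t < 0" using t by simp
    then have "0 < \<bar>ln t\<bar>" "\<bar>ln t\<bar> \<le> (1 - t\<^sup>2) / (2 * t)" using neg_ln_le[OF t] by auto
    then have "1 / ((1 - t\<^sup>2) / (2 * t)) \<le> 1 / \<bar>ln t\<bar>" by (rule frac_le[of 1 1, rotated 2]) auto
    then show ?thesis by simp
  qed
  have "0 \<le> (real k + 2) / \<bar>ln t\<bar>" by simp
  then have D0: "0 \<le> D" unfolding D_def using \<beta> t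
    by (intro mult_nonneg_nonneg divide_nonneg_pos add_nonneg_nonneg) auto
  have F0: "0 \<le> F" unfolding F_def using \<beta> t by (auto simp: power_le_one)
  \<comment> \<open>Multiplication by the lower end of the spectral interval removes
    \<open>\<beta>\<close> from the comparison of \<open>F\<close> with \<open>D\<close>.\<close>
  define \<delta> where "\<delta> = \<beta> * (1 - t)\<^sup>2"
  have \<delta>: "0 < \<delta>" using \<beta> t by (simp add: \<delta>_def)
  have t2: "1 - t\<^sup>2 = (1 - t) * (1 + t)" by (simp add: power2_eq_square algebra_simps)
  define \<rho> where "\<rho> = (1 - t) / (1 + t)"
  have F\<delta>: "F * \<delta> = 2 + 2 * m * \<rho>"
  proof -
    have "F * \<delta> = 2 * (\<delta> / (\<beta> * (1 - t)\<^sup>2)) + 2 * m * (\<delta> / (\<beta> * (1 - t\<^sup>2)))"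
      by (simp add: F_def m_def algebra_simps)
    moreover have "\<delta> / (\<beta> * (1 - t)\<^sup>2) = 1" using \<beta> t by (simp add: \<delta>_def)
    moreover have "\<delta> / (\<beta> * (1 - t\<^sup>2)) = \<rho>"
      unfolding t2 \<delta>_def \<rho>_def using \<beta> t by (simp add: power2_eq_square)
    ultimately show ?thesis by simp
  qed
  \<comment> \<open>The constant part is 2 - (1 - t)^2, to be compared with the 2 in
    \<open>F\<delta>\<close>; the parts linear in \<open>m\<close> are compared separately.\<close>
  have D\<delta>: "1 + 2 * t - t\<^sup>2 + 2 * t * m \<le> D * \<delta>"
  proof -
    have "D * \<delta> = (1 - t\<^sup>2) * (1 + (m + 1) * (1 / \<bar>ln t\<bar>))"
      unfolding t2 D_def \<delta>_def m_def using \<beta> t by (simp add: power2_eq_square)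
    also have "\<dots> \<ge> (1 - t\<^sup>2) * (1 + (m + 1) * (2 * t / (1 - t\<^sup>2)))"
      using L m t by (intro mult_left_mono add_left_mono) (auto simp: power_le_one)
    also have "(1 - t\<^sup>2) * (1 + (m + 1) * (2 * t / (1 - t\<^sup>2))) = 1 + 2 * t - t\<^sup>2 + 2 * t * m"
    proof -
      have *: "e * (1 + (m + 1) * (2 * t / e)) = e + (m + 1) * (2 * t)" if "e \<noteq> 0" for e
        using that by (simp add: field_simps)
      have "1 - t\<^sup>2 \<noteq> 0" using t by (simp add: t2)
      then show ?thesis unfolding *[OF \<open>1 - t\<^sup>2 \<noteq> 0\<close>] by (simp add: algebra_simps)
    qed
    finally show ?thesis .
  qed
  have sqrt_le: "sqrt (1 + X\<^sup>2) \<le> 1 + X"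
    using X by (intro real_le_lsqrt) (auto simp: power2_eq_square algebra_simps)
  consider "1 / 2 \<le> t" | "3 / 8 \<le> t" "t \<le> 1 / 2" "X \<le> 2" | "t \<le> 1 / 2" "2 < X" | "t < 3 / 8"
    by linarith
  then show ?thesis
  proof cases
    case 1
    have "\<rho> \<le> 1 / 3" using 1 by (simp add: \<rho>_def field_simps)
    \<comment> \<open>The spare 1/3, multiplied by \<open>m \<ge> 1\<close>, pays for the deficit (1
      - t)^2, which is at most 1/4 here.\<close>
    then have "2 * \<rho> + 1 / 3 \<le> 2 * t" using 1 by linarith
    then have "m * (2 * \<rho> + 1 / 3) \<le> m * (2 * t)"
      using m by (intro mult_left_mono) linarith+
    moreover have "(1 - t)\<^sup>2 \<le> (1 / 2)\<^sup>2" using 1 t by (intro power_mono) auto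
    ultimately have "F * \<delta> \<le> D * \<delta>"
      using F\<delta> D\<delta> m by (simp add: power2_eq_square algebra_simps)
    then have "F \<le> D" using \<delta> by simp
    then have "(2 + F) * \<tau> * sqrt (1 + X\<^sup>2) \<le> (2 + D) * \<tau> * (1 + X)"
      using sqrt_le \<tau> F0 by (intro mult_mono) auto
    then show ?thesis using residual by (simp add: ac_simps)
  next
    case 2
    \<comment> \<open>5/11 is the value at t = 3/8. Only three quarters of \<open>F\<close> fit
      below \<open>D\<close> in this range; the remaining factor is recovered from the square
      root.\<close>
    have "\<rho> \<le> 5 / 11" using 2 by (simp add: \<rho>_def field_simps)
    then have "3 / 2 * \<rho> \<le> 2 * t" using 2 by linarith
    then have "m * (3 / 2 * \<rho>) \<le> m * (2 * t)"
      using m by (intro mult_left_mono) linarith+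
    moreover have "(1 - t)\<^sup>2 \<le> (5 / 8)\<^sup>2" using 2 by (intro power_mono) auto
    ultimately have "(3 / 4 * F) * \<delta> \<le> D * \<delta>"
      using F\<delta> D\<delta> by (simp add: power2_eq_square algebra_simps)
    then have FD: "3 / 4 * F \<le> D" using \<delta> by simp
    \<comment> \<open>The ratio of both sides without the constant is largest at X = 1/2 and X = 2,
      where it equals sqrt 5 / 3, just below 3/4. This explains the split at X = 2.\<close>
    have "sqrt (1 + X\<^sup>2) \<le> 3 / 4 * (1 + X)"
    proof (rule real_le_lsqrt)
      have "0 \<le> (2 * X - 1) * (2 - X)" using X 2 by (intro mult_nonneg_nonneg) auto
      then show "1 + X\<^sup>2 \<le> (3 / 4 * (1 + X))\<^sup>2"
        using X by (simp add: power2_eq_square algebra_simps)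
    qed (use X in auto)
    then have "(2 + F) * \<tau> * sqrt (1 + X\<^sup>2) \<le> (2 + F) * \<tau> * (3 / 4 * (1 + X))"
      using \<tau> F0 by (intro mult_left_mono) auto
    also have "\<dots> = (3 / 2 + 3 / 4 * F) * \<tau> * (1 + X)"
      by (simp add: algebra_simps add_divide_distrib)
    also have "\<dots> \<le> (2 + D) * \<tau> * (1 + X)"
      using FD \<tau> X by (intro mult_right_mono) auto
    finally show ?thesis using residual by (simp add: ac_simps)
  next
    case 3
    have "(1 + t) / (1 - t) \<le> 3" using 3 by (simp add: field_simps)
    then have "(1 + t) / (1 - t) \<le> 1 + X" using 3 by linarith
    then have "2 * ((1 + t) / (1 - t)) * \<tau> \<le> (2 + D) * (1 + X) * \<tau>"
      using D0 \<tau> X t by (intro mult_mono) auto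
    then show ?thesis using optimal by simp
  next
    case 4
    have "2 * (3 / 2) * \<tau> \<le> (2 + D) * (1 + X) * \<tau>"
      using D0 \<tau> X by (intro mult_mono) auto
    then show ?thesis using small[OF 4] by simp
  qed
qed

section \<open>Projections and the eigenproblem of the subproblem\<close>

text \<open>The Frobenius bound, by Cauchy-Schwarz in each row. It serves to show that the set whose
  \<open>Sup\<close> defines \<open>mat_norm2\<close> is bounded above.\<close>

lemma norm2_mult_bounded:
  fixes M :: "real mat"
  assumes M: "M \<in> carrier_mat m n" and x: "x \<in> carrier_vec n"
  shows "norm2 (M *\<^sub>v x) \<le> sqrt (\<Sum>i<m. (norm2 (row M i))\<^sup>2) * norm2 x"
proof (rule power2_le_imp_le)
  have "(norm2 (M *\<^sub>v x))\<^sup>2 = (\<Sum>i<m. (row M i \<bullet> x)\<^sup>2)"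
    unfolding norm2_power2 using M by (simp add: scalar_prod_def[of "M *\<^sub>v x"] atLeast0LessThan power2_eq_square)
  also have "\<dots> \<le> (\<Sum>i<m. (norm2 (row M i))\<^sup>2 * (norm2 x)\<^sup>2)"
  proof (rule sum_mono)
    fix i assume "i \<in> {..<m}"
    then have "row M i \<in> carrier_vec n" using M by auto
    then have "\<bar>row M i \<bullet> x\<bar> \<le> norm2 (row M i) * norm2 x" by (rule cauchy_schwarz_vec[OF _ x])
    then have "\<bar>row M i \<bullet> x\<bar>\<^sup>2 \<le> (norm2 (row M i) * norm2 x)\<^sup>2" by (rule power_mono) simp
    then show "(row M i \<bullet> x)\<^sup>2 \<le> (norm2 (row M i))\<^sup>2 * (norm2 x)\<^sup>2"
      by (simp add: power_mult_distrib)
  qed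
  also have "\<dots> = (sqrt (\<Sum>i<m. (norm2 (row M i))\<^sup>2) * norm2 x)\<^sup>2"
    by (simp add: power_mult_distrib sum_nonneg sum_distrib_right)
  finally show "(norm2 (M *\<^sub>v x))\<^sup>2 \<le> (sqrt (\<Sum>i<m. (norm2 (row M i))\<^sup>2) * norm2 x)\<^sup>2" .
qed (simp add: sum_nonneg)

lemma norm2_mult_le:
  fixes M :: "real mat"
  assumes M: "M \<in> carrier_mat m n" and x: "x \<in> carrier_vec n"
  shows "norm2 (M *\<^sub>v x) \<le> mat_norm2 M * norm2 x"
proof (cases "x = 0\<^sub>v n")
  case True
  then have "M *\<^sub>v x = 0\<^sub>v m" using M by auto
  then show ?thesis using True by (simp add: norm2_def)
next
  case False
  then have pos: "0 < norm2 x" by (rule norm2_pos[OF x])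
  let ?S = "{norm2 (M *\<^sub>v x) | x. x \<in> carrier_vec (dim_col M) \<and> norm2 x = 1}"
  define w where "w = (1 / norm2 x) \<cdot>\<^sub>v x"
  have w: "w \<in> carrier_vec n" "norm2 w = 1" using x pos by (auto simp: w_def norm2_smult)
  have "bdd_above ?S"
  proof (rule bdd_aboveI)
    fix r assume "r \<in> ?S"
    then obtain x where "r = norm2 (M *\<^sub>v x)" "x \<in> carrier_vec n" "norm2 x = 1" using M by auto
    then show "r \<le> sqrt (\<Sum>i<m. (norm2 (row M i))\<^sup>2)" using norm2_mult_bounded[OF M, of x] by simp
  qed
  moreover have "norm2 (M *\<^sub>v w) \<in> ?S" using w M by auto
  ultimately have "norm2 (M *\<^sub>v w) \<le> mat_norm2 M" unfolding mat_norm2_def by (intro cSup_upper)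
  moreover have "norm2 (M *\<^sub>v w) = norm2 (M *\<^sub>v x) / norm2 x"
    using M x pos by (simp add: w_def mult_mat_vec norm2_smult)
  ultimately show ?thesis using pos by (simp add: field_simps)
qed

lemma shift_mat_carrier [simp]: "A \<in> carrier_mat n n \<Longrightarrow> shift_mat A c \<in> carrier_mat n n"
  by (auto simp: shift_mat_def)

lemma shift_mat_mult:
  assumes A: "A \<in> carrier_mat n n" and x: "x \<in> carrier_vec n"
  shows "shift_mat A c *\<^sub>v x = A *\<^sub>v x + c \<cdot>\<^sub>v x"
proof -
  have "(c \<cdot>\<^sub>m 1\<^sub>m n) *\<^sub>v x = c \<cdot>\<^sub>v x" using x by (intro eq_vecI) auto
  then show ?thesis unfolding shift_mat_def using A x
    by (subst add_mult_distrib_mat_vec[of _ n n]) auto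
qed

lemma shift_mat_sym: "A \<in> carrier_mat n n \<Longrightarrow> transpose_mat A = A \<Longrightarrow>
   transpose_mat (shift_mat A c) = shift_mat A c"
  unfolding shift_mat_def by (subst transpose_add[of _ n n]) (auto intro!: eq_matI)

lemma isometry_residual_orthogonal:
  fixes Q :: "real mat"
  assumes Q: "Q \<in> carrier_mat n m" and o: "transpose_mat Q * Q = 1\<^sub>m m"
    and x: "x \<in> carrier_vec n" and c: "c \<in> carrier_vec m"
  shows "(Q *\<^sub>v c) \<bullet> (x - Q *\<^sub>v (transpose_mat Q *\<^sub>v x)) = 0"
proof -
  have t: "transpose_mat Q *\<^sub>v x \<in> carrier_vec m" using Q x by auto
  have "(Q *\<^sub>v c) \<bullet> x = (transpose_mat Q *\<^sub>v x) \<bullet> c"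
    using transpose_scalar_prod[OF Q x c] scalar_prod_comm_real[of "Q *\<^sub>v c" n x] Q x c by simp
  also have "\<dots> = (Q *\<^sub>v c) \<bullet> (Q *\<^sub>v (transpose_mat Q *\<^sub>v x))"
    unfolding isometry_scalar_prod[OF Q o c t] by (rule scalar_prod_comm_real[OF t c])
  finally show ?thesis using Q x c t by (subst scalar_prod_minus_distrib[of _ n]) auto
qed

text \<open>x - Q c is the sum of the projection residual and Q (Q^T x - c), which are orthogonal.
  This gives the best approximation property and, with c = 0, the decomposition of the norm of
  \<open>x\<close>.\<close>

lemma isometry_projection_best:
  fixes Q :: "real mat"
  assumes Q: "Q \<in> carrier_mat n m" and o: "transpose_mat Q * Q = 1\<^sub>m m"
    and x: "x \<in> carrier_vec n" and c: "c \<in> carrier_vec m"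
  shows "(norm2 (x - Q *\<^sub>v c))\<^sup>2
    = (norm2 (x - Q *\<^sub>v (transpose_mat Q *\<^sub>v x)))\<^sup>2 + (norm2 (transpose_mat Q *\<^sub>v x - c))\<^sup>2"
proof -
  let ?e = "x - Q *\<^sub>v (transpose_mat Q *\<^sub>v x)" and ?w = "transpose_mat Q *\<^sub>v x - c"
  have t: "transpose_mat Q *\<^sub>v x \<in> carrier_vec m" using Q x by auto
  have w: "?w \<in> carrier_vec m" using t c by auto
  have Qw: "Q *\<^sub>v ?w = Q *\<^sub>v (transpose_mat Q *\<^sub>v x) - Q *\<^sub>v c"
    using Q t c by (subst mult_minus_distrib_mat_vec[of _ n m]) auto
  have eq: "x - Q *\<^sub>v c = Q *\<^sub>v ?w + ?e" unfolding Qw using Q x by (intro eq_vecI) auto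
  have "(norm2 (x - Q *\<^sub>v c))\<^sup>2 = (norm2 (Q *\<^sub>v ?w))\<^sup>2 + 2 * ((Q *\<^sub>v ?w) \<bullet> ?e) + (norm2 ?e)\<^sup>2"
    unfolding eq using Q x w by (intro norm2_add_power2[of _ n]) auto
  then show ?thesis using isometry_residual_orthogonal[OF Q o x w] isometry_norm2[OF Q o w] by simp
qed

lemma rank_one_mult:
  fixes g :: "real vec"
  assumes g: "g \<in> carrier_vec n" and y: "y \<in> carrier_vec n"
  shows "(c \<cdot>\<^sub>m (mat_of_cols n [g] * transpose_mat (mat_of_cols n [g]))) *\<^sub>v y = (c * (g \<bullet> y)) \<cdot>\<^sub>v g"
proof (rule eq_vecI)
  fix i assume "i < dim_vec ((c * (g \<bullet> y)) \<cdot>\<^sub>v g)"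
  then have i: "i < n" using g by simp
  have "((c \<cdot>\<^sub>m (mat_of_cols n [g] * transpose_mat (mat_of_cols n [g]))) *\<^sub>v y) $ i
      = (\<Sum>j<n. c * (g $ i * g $ j) * y $ j)"
    using i g y by (simp add: scalar_prod_def atLeast0LessThan mat_of_cols_def)
  also have "\<dots> = c * (\<Sum>j<n. g $ j * y $ j) * g $ i"
    unfolding sum_distrib_left sum_distrib_right by (intro sum.cong) auto
  also have "(\<Sum>j<n. g $ j * y $ j) = g \<bullet> y" using y by (simp add: scalar_prod_def atLeast0LessThan)
  finally show "((c \<cdot>\<^sub>m (mat_of_cols n [g] * transpose_mat (mat_of_cols n [g]))) *\<^sub>v y) $ i
      = ((c * (g \<bullet> y)) \<cdot>\<^sub>v g) $ i" using i g by simp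
qed (use g in auto)

lemma trs_block_mat_carrier:
  assumes "A \<in> carrier_mat n n" "g \<in> carrier_vec n"
  shows "trs_block_mat A g \<Delta> \<in> carrier_mat (n + n) (n + n)"
  unfolding trs_block_mat_def Let_def using assms by (intro four_block_carrier_mat) auto

lemma trs_block_mat_mult:
  fixes A :: "real mat"
  assumes A: "A \<in> carrier_mat n n" and g: "g \<in> carrier_vec n"
    and x: "x \<in> carrier_vec n" and y: "y \<in> carrier_vec n"
  shows "trs_block_mat A g \<Delta> *\<^sub>v (x @\<^sub>v y) = ((g \<bullet> y / \<Delta>\<^sup>2) \<cdot>\<^sub>v g - A *\<^sub>v x) @\<^sub>v (x - A *\<^sub>v y)"
proof -
  have neg: "(- A) *\<^sub>v v = - (A *\<^sub>v v)" if "v \<in> carrier_vec n" for v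
    using A that by (intro eq_vecI) (auto simp: scalar_prod_def sum_negf)
  have dg: "dim_vec g = n" using g by simp
  have G: "(1 / \<Delta>\<^sup>2) \<cdot>\<^sub>m (mat_of_cols n [g] * transpose_mat (mat_of_cols n [g])) \<in> carrier_mat n n"
    by (intro smult_carrier_mat mult_carrier_mat[of _ n 1]) auto
  have "trs_block_mat A g \<Delta> *\<^sub>v (x @\<^sub>v y) = ((- A) *\<^sub>v x + ((1 / \<Delta>\<^sup>2 * (g \<bullet> y)) \<cdot>\<^sub>v g)) @\<^sub>v (1\<^sub>m n *\<^sub>v x + (- A) *\<^sub>v y)"
    unfolding trs_block_mat_def Let_def dg rank_one_mult[OF g y, symmetric]
    using A G x y by (intro four_block_mat_mult_vec[of _ n n _ n _ n]) auto
  also have "(- A) *\<^sub>v x + ((1 / \<Delta>\<^sup>2 * (g \<bullet> y)) \<cdot>\<^sub>v g) = (g \<bullet> y / \<Delta>\<^sup>2) \<cdot>\<^sub>v g - A *\<^sub>v x"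
    unfolding neg[OF x] using A g x by (intro eq_vecI) auto
  also have "1\<^sub>m n *\<^sub>v x + (- A) *\<^sub>v y = x - A *\<^sub>v y"
    unfolding neg[OF y] using A x y by (intro eq_vecI) auto
  finally show ?thesis .
qed

text \<open>Links explicit real eigenvectors to \<open>rightmost_eigenvalue\<close>, which ranges
  over the complex spectrum.\<close>

lemma eigenvalue_complex_of_real:
  fixes M :: "real mat"
  assumes M: "M \<in> carrier_mat n n" and v: "v \<in> carrier_vec n" "v \<noteq> 0\<^sub>v n" and Mv: "M *\<^sub>v v = \<theta> \<cdot>\<^sub>v v"
  shows "eigenvalue (map_mat complex_of_real M) (complex_of_real \<theta>)"
proof -
  let ?v = "map_vec complex_of_real v"
  have "map_mat complex_of_real M *\<^sub>v ?v = map_vec complex_of_real (M *\<^sub>v v)"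
    by (rule of_real_hom.mult_mat_vec_hom[OF M v(1), symmetric])
  also have "\<dots> = complex_of_real \<theta> \<cdot>\<^sub>v ?v" unfolding Mv using v by (intro eq_vecI) auto
  finally have "map_mat complex_of_real M *\<^sub>v ?v = complex_of_real \<theta> \<cdot>\<^sub>v ?v" .
  moreover have "?v \<noteq> 0\<^sub>v n"
  proof
    assume 0: "?v = 0\<^sub>v n"
    have "v $ i = 0" if "i < n" for i using arg_cong[OF 0, of "\<lambda>w. w $ i"] that v by simp
    then show False using v by (auto intro!: eq_vecI)
  qed
  ultimately show ?thesis unfolding eigenvalue_def eigenvector_def
    using M v by (intro exI[of _ ?v]) auto
qed

text \<open>For an eigenvalue \<open>\<mu> \<ge> \<lambda>\<close> the vector \<open>- y\<^sub>1\<close>, scaled to satisfy \<open>(A + \<mu> I) x = - g\<close>, has norm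
  \<open>\<Delta>\<close>; since \<open>s\<close> has the same norm, \<open>\<mu> = \<lambda>\<close>.\<close>

lemma rightmost_eigenvector:
  fixes A :: "real mat"
  assumes A: "A \<in> carrier_mat n n" and sym: "transpose_mat A = A" and g: "g \<in> carrier_vec n"
    and \<Delta>: "0 < \<Delta>" and pd: "pos_def (shift_mat A lam)"
    and s: "s \<in> carrier_vec n" "shift_mat A lam *\<^sub>v s = - g" "norm2 s = \<Delta>"
    and right: "rightmost_eigenvalue (trs_block_mat A g \<Delta>) (complex_of_real \<mu>)"
    and y_eig: "eigenvector (trs_block_mat A g \<Delta>) y \<mu>"
  obtains \<gamma> y1 y2 where "y1 \<in> carrier_vec n" "y2 \<in> carrier_vec n" "y = y1 @\<^sub>v y2" "\<mu> = lam"
    "\<gamma> \<noteq> 0" "y1 = \<gamma> \<cdot>\<^sub>v s" "shift_mat A lam *\<^sub>v y2 = y1"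
proof -
  let ?M = "trs_block_mat A g \<Delta>" and ?B = "shift_mat A lam"
  have M: "?M \<in> carrier_mat (n + n) (n + n)" by (rule trs_block_mat_carrier[OF A g])
  have B: "?B \<in> carrier_mat n n" using A by simp
  have Bsym: "transpose_mat ?B = ?B" by (rule shift_mat_sym[OF A sym])
  have pos: "0 < x \<bullet> (?B *\<^sub>v x)" if "x \<in> carrier_vec n" "x \<noteq> 0\<^sub>v n" for x
    using pd that B by (auto simp: pos_def_def)
  have As: "A *\<^sub>v s = - g - lam \<cdot>\<^sub>v s"
  proof (rule eq_vecI)
    fix i assume "i < dim_vec (- g - lam \<cdot>\<^sub>v s)"
    then have i: "i < n" using s by simp
    have "(A *\<^sub>v s + lam \<cdot>\<^sub>v s) $ i = (- g) $ i" using s(2) shift_mat_mult[OF A s(1), of lam] by simp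
    then show "(A *\<^sub>v s) $ i = (- g - lam \<cdot>\<^sub>v s) $ i" using i A g s(1) by (simp add: algebra_simps)
  qed (use A s in auto)
  obtain U d where "diagonalized n ?B U d" using symmetric_diagonalized[OF B Bsym] .
  then interpret D: diagonalized n ?B U d .
  have d_pos: "0 < d i" if i: "i < n" for i
  proof -
    obtain v where v: "v \<in> carrier_vec n" "v \<noteq> 0\<^sub>v n" "?B *\<^sub>v v = d i \<cdot>\<^sub>v v"
      using D.eigenvalue_d[OF i] B by (auto simp: eigenvalue_def eigenvector_def)
    then have "0 < d i * (v \<bullet> v)" using pos[OF v(1,2)] by simp
    then show ?thesis using scalar_prod_self_nonneg[of v] by (simp add: zero_less_mult_iff)
  qed
  \<comment> \<open>\<open>v\<close> is the solution of B v = s. The vector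
    \<open>s @\<^sub>v v\<close> turns out to be an eigenvector of the block matrix for
    \<open>lam\<close>, so the rightmost eigenvalue is at least \<open>lam\<close>.\<close>
  define v where "v = D.fv inverse s"
  have v: "v \<in> carrier_vec n" by (simp add: v_def)
  have Bv: "?B *\<^sub>v v = s"
  proof -
    have "?B *\<^sub>v v = D.fv (\<lambda>t. t * inverse t) s"
      unfolding v_def by (simp add: D.A_mult D.fv_fv)
    also have "\<dots> = s"
    proof (rule D.eq_by_coords)
      fix i assume i: "i < n"
      then show "D.coord (D.fv (\<lambda>t. t * inverse t) s) i = D.coord s i"
        using d_pos[OF i] by (simp add: D.coords_fv)
    qed (use s(1) in auto)
    finally show ?thesis .
  qed
  have "lam \<le> \<mu>"
  proof -
    have "g \<bullet> v = - (\<Delta>\<^sup>2)"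
    proof -
      have "s \<bullet> s = (?B *\<^sub>v s) \<bullet> v" using symmetric_scalar_prod[OF B Bsym s(1) v] Bv by simp
      then have "\<Delta>\<^sup>2 = - (g \<bullet> v)" using g v s norm2_power2[of s] by simp
      then show ?thesis by simp
    qed
    moreover have "A *\<^sub>v v = s - lam \<cdot>\<^sub>v v"
    proof (rule eq_vecI)
      fix i assume "i < dim_vec (s - lam \<cdot>\<^sub>v v)"
      then have i: "i < n" using v by simp
      have "(A *\<^sub>v v + lam \<cdot>\<^sub>v v) $ i = s $ i" using Bv shift_mat_mult[OF A v, of lam] by simp
      then show "(A *\<^sub>v v) $ i = (s - lam \<cdot>\<^sub>v v) $ i" using i A v s(1) by simp
    qed (use A v in auto)
    ultimately have "?M *\<^sub>v (s @\<^sub>v v) = (- 1 \<cdot>\<^sub>v g - (- g - lam \<cdot>\<^sub>v s)) @\<^sub>v (s - (s - lam \<cdot>\<^sub>v v))"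
      unfolding trs_block_mat_mult[OF A g s(1) v] As using \<Delta> by simp
    also have "- 1 \<cdot>\<^sub>v g - (- g - lam \<cdot>\<^sub>v s) = lam \<cdot>\<^sub>v s" using g s(1) by (intro eq_vecI) auto
    also have "s - (s - lam \<cdot>\<^sub>v v) = lam \<cdot>\<^sub>v v" using v s(1) by (intro eq_vecI) auto
    also have "(lam \<cdot>\<^sub>v s) @\<^sub>v (lam \<cdot>\<^sub>v v) = lam \<cdot>\<^sub>v (s @\<^sub>v v)" using s(1) v by (intro eq_vecI) auto
    finally have "?M *\<^sub>v (s @\<^sub>v v) = lam \<cdot>\<^sub>v (s @\<^sub>v v)" .
    moreover have "s @\<^sub>v v \<noteq> 0\<^sub>v (n + n)"
    proof
      assume "s @\<^sub>v v = 0\<^sub>v (n + n)"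
      then have "(norm2 s)\<^sup>2 + (norm2 v)\<^sup>2 = 0" unfolding norm2_append[OF s(1) v, symmetric]
        by (simp add: norm2_def)
      then show False using s(3) \<Delta> by (simp add: add_nonneg_eq_0_iff)
    qed
    ultimately have "eigenvalue (map_mat complex_of_real ?M) (complex_of_real lam)"
      using s(1) v by (intro eigenvalue_complex_of_real[OF M, of "s @\<^sub>v v"]) auto
    then show ?thesis using right by (auto simp: rightmost_eigenvalue_def)
  qed
  have y: "y \<in> carrier_vec (n + n)" "y \<noteq> 0\<^sub>v (n + n)" "?M *\<^sub>v y = \<mu> \<cdot>\<^sub>v y"
    using y_eig M by (auto simp: eigenvector_def)
  define y1 y2 where "y1 = vec_first y n" and "y2 = vec_last y n"
  have y12: "y1 \<in> carrier_vec n" "y2 \<in> carrier_vec n" and y_eq: "y = y1 @\<^sub>v y2"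
    using y(1) by (auto simp: y1_def y2_def)
  \<comment> \<open>With this scalar the two block rows read (A + mu I) y1 = gamma g and (A + mu I)
    y2 = y1. Since A + mu I is injective for \<open>lam \<le> \<mu>\<close>, a zero
    \<open>\<gamma>\<close> would force y = 0.\<close>
  define \<gamma> where "\<gamma> = g \<bullet> y2 / \<Delta>\<^sup>2"
  have "\<mu> \<cdot>\<^sub>v (y1 @\<^sub>v y2) = (\<mu> \<cdot>\<^sub>v y1) @\<^sub>v (\<mu> \<cdot>\<^sub>v y2)" using y12 by (intro eq_vecI) auto
  then have "(\<gamma> \<cdot>\<^sub>v g - A *\<^sub>v y1) @\<^sub>v (y1 - A *\<^sub>v y2) = (\<mu> \<cdot>\<^sub>v y1) @\<^sub>v (\<mu> \<cdot>\<^sub>v y2)"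
    using y(3) unfolding y_eq trs_block_mat_mult[OF A g y12] \<gamma>_def by simp
  moreover have "\<gamma> \<cdot>\<^sub>v g - A *\<^sub>v y1 \<in> carrier_vec n" "\<mu> \<cdot>\<^sub>v y1 \<in> carrier_vec n" using A g y12 by auto
  ultimately have e: "\<gamma> \<cdot>\<^sub>v g - A *\<^sub>v y1 = \<mu> \<cdot>\<^sub>v y1" "y1 - A *\<^sub>v y2 = \<mu> \<cdot>\<^sub>v y2"
    using append_vec_eq by blast+
  let ?B' = "shift_mat A \<mu>"
  have B': "?B' \<in> carrier_mat n n" using A by simp
  have B'sym: "transpose_mat ?B' = ?B'" by (rule shift_mat_sym[OF A sym])
  have B'_eq: "?B' *\<^sub>v x = ?B *\<^sub>v x + (\<mu> - lam) \<cdot>\<^sub>v x" if "x \<in> carrier_vec n" for x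
    unfolding shift_mat_mult[OF A that] using A that by (intro eq_vecI) (auto simp: algebra_simps)
  have pos': "x = 0\<^sub>v n" if x: "x \<in> carrier_vec n" and 0: "?B' *\<^sub>v x = 0\<^sub>v n" for x
  proof (rule ccontr)
    assume "x \<noteq> 0\<^sub>v n"
    then have "0 < x \<bullet> (?B *\<^sub>v x) + (\<mu> - lam) * (x \<bullet> x)"
      using pos[OF x] \<open>lam \<le> \<mu>\<close> scalar_prod_self_nonneg[of x] by (simp add: add_pos_nonneg)
    also have "\<dots> = x \<bullet> (?B' *\<^sub>v x)"
      unfolding B'_eq[OF x] using B x by (simp add: scalar_prod_add_distrib[of _ n])
    finally show False using x 0 by simp
  qed
  have B'y1: "?B' *\<^sub>v y1 = \<gamma> \<cdot>\<^sub>v g"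
    unfolding shift_mat_mult[OF A y12(1)] e(1)[symmetric] using A g y12 by (intro eq_vecI) auto
  have B'y2: "?B' *\<^sub>v y2 = y1"
    unfolding shift_mat_mult[OF A y12(2)] e(2)[symmetric] using A g y12 by (intro eq_vecI) auto
  have \<gamma>: "\<gamma> \<noteq> 0"
  proof
    assume "\<gamma> = 0"
    then have "?B' *\<^sub>v y1 = 0\<^sub>v n" using B'y1 smult_zero_real[OF g] by simp
    then have "y1 = 0\<^sub>v n" by (rule pos'[OF y12(1)])
    moreover from this have "y2 = 0\<^sub>v n" using pos'[OF y12(2)] B'y2 by simp
    ultimately have "y = 0\<^sub>v (n + n)" unfolding y_eq by (intro eq_vecI) auto
    with y(2) show False by simp
  qed
  \<comment> \<open>Moving A + mu I from \<open>y2\<close> to \<open>y1\<close> turns the squared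
    length of \<open>y1\<close> into gamma (g . y2), and the definition of \<open>\<gamma>\<close>
    brings in the radius.\<close>
  have y1_norm: "y1 \<bullet> y1 = \<gamma>\<^sup>2 * \<Delta>\<^sup>2"
  proof -
    have "y1 \<bullet> y1 = (?B' *\<^sub>v y1) \<bullet> y2"
      using symmetric_scalar_prod[OF B' B'sym y12] B'y2 by simp
    also have "\<dots> = \<gamma> * (g \<bullet> y2)" unfolding B'y1 using g y12 by simp
    also have "g \<bullet> y2 = \<gamma> * \<Delta>\<^sup>2" using \<Delta> by (simp add: \<gamma>_def)
    finally show ?thesis by (simp add: power2_eq_square)
  qed
  define x where "x = (- 1 / \<gamma>) \<cdot>\<^sub>v y1"
  have x: "x \<in> carrier_vec n" using y12 by (simp add: x_def)
  have "?B' *\<^sub>v x = (- 1 / \<gamma>) \<cdot>\<^sub>v (\<gamma> \<cdot>\<^sub>v g)"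
    unfolding x_def B'y1[symmetric] using B' y12 by (simp add: mult_mat_vec)
  then have B'x: "?B' *\<^sub>v x = - g" using \<gamma> g by (auto simp: smult_smult_assoc)
  have xx: "x \<bullet> x = \<Delta>\<^sup>2"
    using y12 y1_norm \<gamma> by (simp add: x_def power2_eq_square field_simps)
  \<comment> \<open>Testing this equation with s - x gives (mu - lam) (s . x - x . x). Both vectors
    have length \<open>\<Delta>\<close>, so Cauchy-Schwarz makes it nonpositive, and definiteness
    forces s = x.\<close>
  have Bd: "?B *\<^sub>v (s - x) = (\<mu> - lam) \<cdot>\<^sub>v x"
  proof (rule eq_vecI)
    fix i assume "i < dim_vec ((\<mu> - lam) \<cdot>\<^sub>v x)"
    then have i: "i < n" using x by simp
    have "(?B *\<^sub>v (s - x)) $ i = (?B *\<^sub>v s) $ i - (?B *\<^sub>v x) $ i"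
      using i B s(1) x by (subst mult_minus_distrib_mat_vec[of _ n n]) auto
    moreover have "(?B' *\<^sub>v x) $ i = (?B *\<^sub>v x) $ i + (\<mu> - lam) * x $ i"
      unfolding B'_eq[OF x] using i B x by simp
    ultimately show "(?B *\<^sub>v (s - x)) $ i = ((\<mu> - lam) \<cdot>\<^sub>v x) $ i"
      unfolding B'x s(2) using i x g by simp
  qed (use B x in auto)
  have "s \<bullet> x \<le> \<Delta>\<^sup>2"
  proof -
    have "s \<bullet> x \<le> norm2 s * norm2 x" using cauchy_schwarz_vec[OF s(1) x] by linarith
    also have "norm2 x = \<Delta>" using xx \<Delta> by (simp add: norm2_def)
    finally show ?thesis using s(3) by (simp add: power2_eq_square)
  qed
  then have "(\<mu> - lam) * (s \<bullet> x - x \<bullet> x) \<le> 0"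
    using \<open>lam \<le> \<mu>\<close> xx by (simp add: mult_nonneg_nonpos)
  moreover have "(s - x) \<bullet> (?B *\<^sub>v (s - x)) = (\<mu> - lam) * (s \<bullet> x - x \<bullet> x)"
    unfolding Bd using s(1) x by (simp add: minus_scalar_prod_distrib[of _ n])
  ultimately have "s - x = 0\<^sub>v n" using pos[of "s - x"] s(1) x by force
  then have "(s - x) $ i = 0" if "i < n" for i using that by simp
  then have sx: "s $ i = x $ i" if "i < n" for i using that s(1) x by fastforce
  have s_eq: "s = x" using s(1) x sx by (intro eq_vecI) auto
  have "(\<mu> - lam) \<cdot>\<^sub>v x = 0\<^sub>v n"
    unfolding Bd[symmetric] \<open>s - x = 0\<^sub>v n\<close> using B by auto
  then have "((\<mu> - lam) \<cdot>\<^sub>v x) \<bullet> x = 0" using x by simp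
  then have "(\<mu> - lam) * (x \<bullet> x) = 0" by simp
  then have \<mu>: "\<mu> = lam" using xx \<Delta> by simp
  show thesis
  proof (rule that[OF y12 y_eq \<mu>])
    \<comment> \<open>The sign comes from \<open>x\<close>, which solves the equation with right
      side - g although \<open>y1\<close> belongs to gamma g.\<close>
    show "- \<gamma> \<noteq> 0" using \<gamma> by simp
    show "y1 = - \<gamma> \<cdot>\<^sub>v s" unfolding s_eq x_def using \<gamma> by (simp add: smult_smult_assoc)
    show "?B *\<^sub>v y2 = y1" using B'y2 \<mu> by simp
  qed
qed

section \<open>Perturbation of eigenvectors and minimization on a sphere\<close>

lemma mult_transpose_mult_index:
  fixes W :: "real mat"
  assumes "W \<in> carrier_mat n m" "t < n"
  shows "(W *\<^sub>v (transpose_mat W *\<^sub>v x)) $ t = (\<Sum>j<m. col W j $ t * (col W j \<bullet> x))"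
  using assms by (simp add: scalar_prod_def[of "row W t"] atLeast0LessThan)

lemma orthonormal_complement:
  fixes Z :: "real mat" and z :: "real vec"
  assumes Z: "Z \<in> carrier_mat (Suc N) N" and z: "z \<in> carrier_vec (Suc N)"
    and orth: "orthonormal_mat (Suc N) (mat_of_cols (Suc N) (z # cols Z))"
  shows "transpose_mat Z *\<^sub>v z = 0\<^sub>v N" and "transpose_mat Z * Z = 1\<^sub>m N"
    and "x \<in> carrier_vec (Suc N) \<Longrightarrow> x = (z \<bullet> x) \<cdot>\<^sub>v z + Z *\<^sub>v (transpose_mat Z *\<^sub>v x)"
proof -
  let ?W = "mat_of_cols (Suc N) (z # cols Z)"
  have W: "?W \<in> carrier_mat (Suc N) (Suc N)" and WW: "transpose_mat ?W * ?W = 1\<^sub>m (Suc N)"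
    using orth by (auto simp: orthonormal_mat_def)
  have c0: "col ?W 0 = z" using z by (subst col_mat_of_cols) auto
  have cS: "col ?W (Suc i) = col Z i" if "i < N" for i
    using that Z by (subst col_mat_of_cols) auto
  have W_col: "col ?W i \<bullet> col ?W j = (if i = j then 1 else 0)" if "i < Suc N" "j < Suc N" for i j
    using arg_cong[OF WW, of "\<lambda>A. A $$ (i, j)"] that W Z by simp
  show "transpose_mat Z *\<^sub>v z = 0\<^sub>v N"
  proof (rule eq_vecI)
    fix i assume "i < dim_vec (0\<^sub>v N :: real vec)"
    then show "(transpose_mat Z *\<^sub>v z) $ i = (0\<^sub>v N :: real vec) $ i"
      using W_col[of "Suc i" 0] Z c0 cS[of i] by simp
  qed (use Z in auto)
  show "transpose_mat Z * Z = 1\<^sub>m N"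
  proof (rule eq_matI)
    fix i j assume "i < dim_row (1\<^sub>m N :: real mat)" "j < dim_col (1\<^sub>m N :: real mat)"
    then show "(transpose_mat Z * Z) $$ (i, j) = (1\<^sub>m N :: real mat) $$ (i, j)"
      using W_col[of "Suc i" "Suc j"] Z cS[of i] cS[of j] by simp
  qed (use Z in auto)
  show "x = (z \<bullet> x) \<cdot>\<^sub>v z + Z *\<^sub>v (transpose_mat Z *\<^sub>v x)" if x: "x \<in> carrier_vec (Suc N)"
  proof (rule eq_vecI)
    fix t assume "t < dim_vec ((z \<bullet> x) \<cdot>\<^sub>v z + Z *\<^sub>v (transpose_mat Z *\<^sub>v x))"
    then have t: "t < Suc N" using Z by simp
    have "?W * transpose_mat ?W = 1\<^sub>m (Suc N)"
      by (rule mat_mult_left_right_inverse[of _ "Suc N"]) (use W WW in auto)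
    then have "?W *\<^sub>v (transpose_mat ?W *\<^sub>v x) = x"
      using W x by (subst assoc_mult_mat_vec[symmetric, of _ "Suc N" "Suc N" _ "Suc N"]) auto
    then have "x $ t = (?W *\<^sub>v (transpose_mat ?W *\<^sub>v x)) $ t" by simp
    also have "\<dots> = (\<Sum>j<Suc N. col ?W j $ t * (col ?W j \<bullet> x))"
      by (rule mult_transpose_mult_index[OF W t])
    also have "\<dots> = z $ t * (z \<bullet> x) + (\<Sum>j<N. col Z j $ t * (col Z j \<bullet> x))"
      unfolding sum.lessThan_Suc_shift c0 by (simp add: cS)
    also have "(\<Sum>j<N. col Z j $ t * (col Z j \<bullet> x)) = (Z *\<^sub>v (transpose_mat Z *\<^sub>v x)) $ t"
      by (rule mult_transpose_mult_index[OF Z t, symmetric])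
    finally show "x $ t = ((z \<bullet> x) \<cdot>\<^sub>v z + Z *\<^sub>v (transpose_mat Z *\<^sub>v x)) $ t"
      using t z Z by (simp add: mult.commute del: index_mult_mat_vec)
  qed (use Z x in auto)
qed

lemma isometry_transpose_norm2_le:
  fixes Q :: "real mat"
  assumes Q: "Q \<in> carrier_mat n m" and o: "transpose_mat Q * Q = 1\<^sub>m m" and x: "x \<in> carrier_vec n"
  shows "norm2 (transpose_mat Q *\<^sub>v x) \<le> norm2 x"
proof (rule power2_le_imp_le)
  have "Q *\<^sub>v 0\<^sub>v m = 0\<^sub>v n" using Q by auto
  then have "(norm2 x)\<^sup>2 = (norm2 (x - Q *\<^sub>v (transpose_mat Q *\<^sub>v x)))\<^sup>2 + (norm2 (transpose_mat Q *\<^sub>v x))\<^sup>2"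
    using isometry_projection_best[OF Q o x, of "0\<^sub>v m"] Q x by simp
  then show "(norm2 (transpose_mat Q *\<^sub>v x))\<^sup>2 \<le> (norm2 x)\<^sup>2" by simp
qed simp

text \<open>Put u = Q^T y, e = y - Q u and v = Z^T u. Applying Z^T Q^T to M e gives - (C - mu I) v,
  because Z^T z = 0 removes the part of u along z; hence sep |v| <= |M| |e|. With c = z . u the
  error y - Q (c z) is the orthogonal sum of e and Q Z v, which is why the squares of the two
  contributions add.\<close>

lemma eigenvector_perturbation:
  fixes M Mk Q Z C :: "real mat"
  assumes M: "M \<in> carrier_mat n n" and Mk: "Mk \<in> carrier_mat (Suc N) (Suc N)" and N: "0 < N"
    and Q: "Q \<in> carrier_mat n (Suc N)" and Qo: "transpose_mat Q * Q = 1\<^sub>m (Suc N)"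
    and Mk_eq: "\<And>x. x \<in> carrier_vec (Suc N) \<Longrightarrow> Mk *\<^sub>v x = transpose_mat Q *\<^sub>v (M *\<^sub>v (Q *\<^sub>v x))"
    and y: "y \<in> carrier_vec n" "M *\<^sub>v y = \<mu> \<cdot>\<^sub>v y" "norm2 y = 1"
    and z: "z \<in> carrier_vec (Suc N)" "Mk *\<^sub>v z = \<nu> \<cdot>\<^sub>v z"
    and Z: "Z \<in> carrier_mat (Suc N) N"
    and orth: "orthonormal_mat (Suc N) (mat_of_cols (Suc N) (z # cols Z))"
    and C: "C = transpose_mat Z * Mk * Z" and sep: "0 < sep \<mu> C"
  shows "sep \<mu> C \<le> 2 * mat_norm2 M"
    and "\<exists>c. (norm2 (y - Q *\<^sub>v (c \<cdot>\<^sub>v z)))\<^sup>2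
      \<le> (norm2 (y - Q *\<^sub>v (transpose_mat Q *\<^sub>v y)))\<^sup>2 * (1 + (mat_norm2 M / sep \<mu> C)\<^sup>2)"
proof -
  note ZZ = orthonormal_complement[OF Z z(1) orth]
  have Zt: "transpose_mat Z \<in> carrier_mat N (Suc N)" and Qt: "transpose_mat Q \<in> carrier_mat (Suc N) n"
    using Z Q by auto
  have C_carrier: "C \<in> carrier_mat N N" unfolding C using Zt Mk Z by auto
  have C_mult: "C *\<^sub>v v = transpose_mat Z *\<^sub>v (Mk *\<^sub>v (Z *\<^sub>v v))" if "v \<in> carrier_vec N" for v
  proof -
    have "C *\<^sub>v v = (transpose_mat Z * Mk) *\<^sub>v (Z *\<^sub>v v)"
      unfolding C using Zt Mk Z that by (intro assoc_mult_mat_vec[of _ N "Suc N" _ N]) auto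
    also have "\<dots> = transpose_mat Z *\<^sub>v (Mk *\<^sub>v (Z *\<^sub>v v))"
      using Zt Mk Z that by (intro assoc_mult_mat_vec[of _ N "Suc N" _ "Suc N"]) auto
    finally show ?thesis .
  qed
  have sep_le: "sep \<mu> C * norm2 v \<le> norm2 (C *\<^sub>v v + (- \<mu>) \<cdot>\<^sub>v v)" if "v \<in> carrier_vec N" for v
    using sigma_min_le[of "shift_mat C (- \<mu>)" N v] sep C_carrier that
    by (simp add: sep_def shift_mat_mult)
  have Mk_norm: "norm2 (Mk *\<^sub>v x) \<le> mat_norm2 M * norm2 x" if x: "x \<in> carrier_vec (Suc N)" for x
  proof -
    have Qx: "Q *\<^sub>v x \<in> carrier_vec n" using Q x by simp
    have "norm2 (Mk *\<^sub>v x) \<le> norm2 (M *\<^sub>v (Q *\<^sub>v x))"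
      unfolding Mk_eq[OF x] using M Qx by (intro isometry_transpose_norm2_le[OF Q Qo]) auto
    also have "\<dots> \<le> mat_norm2 M * norm2 (Q *\<^sub>v x)" by (rule norm2_mult_le[OF M Qx])
    finally show ?thesis unfolding isometry_norm2[OF Q Qo x] .
  qed
  have \<mu>: "\<bar>\<mu>\<bar> \<le> mat_norm2 M" using norm2_mult_le[OF M y(1)] y by (simp add: norm2_smult)
  show "sep \<mu> C \<le> 2 * mat_norm2 M"
  proof -
    \<comment> \<open>Any unit vector would do; one exists because \<open>0 < N\<close>.\<close>
    let ?v = "unit_vec N 0 :: real vec"
    have v: "?v \<in> carrier_vec N" and v1: "norm2 ?v = 1" using N by (auto simp: norm2_def)
    have "norm2 (C *\<^sub>v ?v) \<le> norm2 (Mk *\<^sub>v (Z *\<^sub>v ?v))"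
      unfolding C_mult[OF v] using Mk Z v by (intro isometry_transpose_norm2_le[OF Z ZZ(2)]) auto
    also have "\<dots> \<le> mat_norm2 M * norm2 (Z *\<^sub>v ?v)" using Z v by (intro Mk_norm) auto
    finally have "norm2 (C *\<^sub>v ?v) \<le> mat_norm2 M"
      unfolding isometry_norm2[OF Z ZZ(2) v] v1 by simp
    moreover have "norm2 (C *\<^sub>v ?v + (- \<mu>) \<cdot>\<^sub>v ?v) \<le> norm2 (C *\<^sub>v ?v) + norm2 ((- \<mu>) \<cdot>\<^sub>v ?v)"
      using C_carrier v by (intro norm2_triangle[of _ N]) auto
    ultimately show ?thesis using sep_le[OF v] v1 \<mu> by (simp add: norm2_smult)
  qed
  define u where "u = transpose_mat Q *\<^sub>v y"
  define v where "v = transpose_mat Z *\<^sub>v u"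
  define e where "e = y - Q *\<^sub>v u"
  define c where "c = z \<bullet> u"
  have u: "u \<in> carrier_vec (Suc N)" and v: "v \<in> carrier_vec N" and e: "e \<in> carrier_vec n"
    using Qt Zt Q y(1) by (auto simp: u_def v_def e_def)
  have Zv: "Z *\<^sub>v v \<in> carrier_vec (Suc N)" using Z v by simp
  have u_eq: "u = c \<cdot>\<^sub>v z + Z *\<^sub>v v" unfolding c_def v_def by (rule ZZ(3)[OF u])
  have Mku: "Mk *\<^sub>v u = (c * \<nu>) \<cdot>\<^sub>v z + Mk *\<^sub>v (Z *\<^sub>v v)"
    using Mk z Zv mult_add_distrib_mat_vec[OF Mk, of "c \<cdot>\<^sub>v z" "Z *\<^sub>v v"]
    unfolding u_eq[symmetric] by (simp add: mult_mat_vec[OF Mk] smult_smult_assoc)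
  have "transpose_mat Z *\<^sub>v (Mk *\<^sub>v u) = transpose_mat Z *\<^sub>v ((c * \<nu>) \<cdot>\<^sub>v z) + C *\<^sub>v v"
    unfolding Mku C_mult[OF v] using Zt Mk z Zv by (intro mult_add_distrib_mat_vec[of _ N "Suc N"]) auto
  also have "transpose_mat Z *\<^sub>v ((c * \<nu>) \<cdot>\<^sub>v z) = 0\<^sub>v N"
    unfolding mult_mat_vec[OF Zt z(1)] ZZ(1) by auto
  finally have ZMu: "transpose_mat Z *\<^sub>v (Mk *\<^sub>v u) = C *\<^sub>v v" using C_carrier v by simp
  have Me: "M *\<^sub>v e \<in> carrier_vec n" using M e by simp
  have QMe: "transpose_mat Q *\<^sub>v (M *\<^sub>v e) = \<mu> \<cdot>\<^sub>v u - Mk *\<^sub>v u"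
  proof -
    have "M *\<^sub>v e = \<mu> \<cdot>\<^sub>v y - M *\<^sub>v (Q *\<^sub>v u)"
      unfolding e_def y(2)[symmetric] using M y(1) Q u by (intro mult_minus_distrib_mat_vec[of _ n n]) auto
    then have "transpose_mat Q *\<^sub>v (M *\<^sub>v e) = transpose_mat Q *\<^sub>v (\<mu> \<cdot>\<^sub>v y) - transpose_mat Q *\<^sub>v (M *\<^sub>v (Q *\<^sub>v u))"
      using Qt M Q u y(1) by (simp add: mult_minus_distrib_mat_vec[OF Qt])
    then show ?thesis unfolding Mk_eq[OF u] using mult_mat_vec[OF Qt y(1)] by (simp add: u_def)
  qed
  have "transpose_mat Z *\<^sub>v (transpose_mat Q *\<^sub>v (M *\<^sub>v e)) = \<mu> \<cdot>\<^sub>v v - C *\<^sub>v v"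
    unfolding QMe ZMu[symmetric] using Zt Mk u
    by (simp add: mult_minus_distrib_mat_vec[OF Zt] mult_mat_vec[OF Zt] v_def)
  also have "\<dots> = (- 1) \<cdot>\<^sub>v (C *\<^sub>v v + (- \<mu>) \<cdot>\<^sub>v v)" using C_carrier v by (intro eq_vecI) (auto simp: algebra_simps)
  finally have "norm2 (C *\<^sub>v v + (- \<mu>) \<cdot>\<^sub>v v) = norm2 (transpose_mat Z *\<^sub>v (transpose_mat Q *\<^sub>v (M *\<^sub>v e)))"
    by (simp add: norm2_smult)
  also have "\<dots> \<le> norm2 (transpose_mat Q *\<^sub>v (M *\<^sub>v e))"
    using Qt Me by (intro isometry_transpose_norm2_le[OF Z ZZ(2)]) auto
  also have "\<dots> \<le> norm2 (M *\<^sub>v e)" by (rule isometry_transpose_norm2_le[OF Q Qo Me])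
  also have "\<dots> \<le> mat_norm2 M * norm2 e" by (rule norm2_mult_le[OF M e])
  finally have "sep \<mu> C * norm2 v \<le> mat_norm2 M * norm2 e" using sep_le[OF v] by linarith
  then have "norm2 v \<le> mat_norm2 M / sep \<mu> C * norm2 e" using sep by (simp add: field_simps)
  then have v_le: "(norm2 v)\<^sup>2 \<le> (mat_norm2 M / sep \<mu> C)\<^sup>2 * (norm2 e)\<^sup>2"
    unfolding power_mult_distrib[symmetric] by (rule power_mono) simp
  have "u - c \<cdot>\<^sub>v z = Z *\<^sub>v v"
  proof (rule eq_vecI)
    fix i assume "i < dim_vec (Z *\<^sub>v v)"
    then have "i < Suc N" using Z by simp
    then have "u $ i = (c \<cdot>\<^sub>v z) $ i + (Z *\<^sub>v v) $ i"
      using arg_cong[OF u_eq, of "\<lambda>w. w $ i"] z(1) Z by (metis index_add_vec(1) carrier_vecD Zv)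
    then show "(u - c \<cdot>\<^sub>v z) $ i = (Z *\<^sub>v v) $ i"
      using \<open>i < Suc N\<close> z(1) u by (simp del: index_mult_mat_vec)
  qed (use z Z in auto)
  then have "(norm2 (y - Q *\<^sub>v (c \<cdot>\<^sub>v z)))\<^sup>2 = (norm2 e)\<^sup>2 + (norm2 v)\<^sup>2"
    using isometry_projection_best[OF Q Qo y(1), of "c \<cdot>\<^sub>v z"] z(1) isometry_norm2[OF Z ZZ(2) v]
    by (simp add: u_def[symmetric] e_def[symmetric])
  also have "\<dots> \<le> (norm2 e)\<^sup>2 * (1 + (mat_norm2 M / sep \<mu> C)\<^sup>2)"
    using v_le by (simp add: algebra_simps)
  finally show "\<exists>c. (norm2 (y - Q *\<^sub>v (c \<cdot>\<^sub>v z)))\<^sup>2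
      \<le> (norm2 (y - Q *\<^sub>v (transpose_mat Q *\<^sub>v y)))\<^sup>2 * (1 + (mat_norm2 M / sep \<mu> C)\<^sup>2)"
    unfolding e_def u_def by blast
qed

text \<open>In the proof, \<open>w\<close> is the part of the projection of \<open>s'\<close> that is orthogonal to \<open>s\<close>; by
  stationarity it is \<open>B\<close>-orthogonal to \<open>s - s'\<close>, so Wielandt's inequality bounds its length.\<close>

lemma sphere_minimizer_angle:
  fixes B Q :: "real mat" and h s' :: "real vec" and a b \<Delta> \<tau> :: real
  defines "s \<equiv> Q *\<^sub>v h"
  defines "u \<equiv> (1 - (s \<bullet> s') / \<Delta>\<^sup>2) / 2"
  assumes B: "B \<in> carrier_mat n n" and a: "0 < a" "a \<le> b" and \<Delta>: "0 < \<Delta>"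
    and lower: "\<And>x. x \<in> carrier_vec n \<Longrightarrow> a * (norm2 x)\<^sup>2 \<le> x \<bullet> (B *\<^sub>v x)"
    and upper: "\<And>x. x \<in> carrier_vec n \<Longrightarrow> x \<bullet> (B *\<^sub>v x) \<le> b * (norm2 x)\<^sup>2"
    and centre: "\<And>x. x \<in> carrier_vec n \<Longrightarrow>
      norm2 (B *\<^sub>v x - ((a + b) / 2) \<cdot>\<^sub>v x) \<le> (b - a) / 2 * norm2 x"
    and Q: "Q \<in> carrier_mat n m" and Qo: "transpose_mat Q * Q = 1\<^sub>m m"
    and h: "h \<in> carrier_vec m" "norm2 h = \<Delta>" and s': "s' \<in> carrier_vec n" "norm2 s' = \<Delta>"
    and minimal: "\<And>x. x \<in> carrier_vec m \<Longrightarrow> norm2 x = \<Delta> \<Longrightarrow>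
      (s - s') \<bullet> (B *\<^sub>v (s - s')) \<le> (Q *\<^sub>v x - s') \<bullet> (B *\<^sub>v (Q *\<^sub>v x - s'))"
    and stationary: "\<And>w. w \<in> carrier_vec m \<Longrightarrow> w \<bullet> h = 0 \<Longrightarrow> (Q *\<^sub>v w) \<bullet> (B *\<^sub>v (s - s')) = 0"
    and \<tau>: "0 < \<tau>" "\<tau> < 1"
    and proj: "norm2 (s' - Q *\<^sub>v (transpose_mat Q *\<^sub>v s')) \<le> 2 * \<tau> / (1 + \<tau>\<^sup>2) * \<Delta>"
  shows "sin (vec_angle s s') = sqrt (4 * u * (1 - u))" and "0 \<le> u" and "u \<le> 1"
    and "u \<le> b / a * \<tau>\<^sup>2"
    and "4 * u * (1 - u - ((b - a) / (b + a))\<^sup>2) \<le> 4 * \<tau>\<^sup>2"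
    and "m = 1 \<Longrightarrow> 4 * u * (1 - u) \<le> 4 * \<tau>\<^sup>2"
proof -
  define \<rho> where "\<rho> = (s \<bullet> s') / \<Delta>\<^sup>2"
  have s: "s \<in> carrier_vec n" "norm2 s = \<Delta>"
    using Q h isometry_norm2[OF Q Qo h(1)] by (auto simp: s_def)
  have "\<bar>s \<bullet> s'\<bar> \<le> \<Delta>\<^sup>2" using cauchy_schwarz_vec[OF s(1) s'(1)] s s' by (simp add: power2_eq_square)
  then have \<rho>: "- 1 \<le> \<rho>" "\<rho> \<le> 1" using \<Delta> by (auto simp: \<rho>_def abs_le_iff field_simps)
  have u: "u = (1 - \<rho>) / 2" by (simp add: u_def \<rho>_def)
  have ss': "s \<bullet> s' = \<rho> * \<Delta>\<^sup>2" using \<Delta> by (simp add: \<rho>_def)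
  show "0 \<le> u" "u \<le> 1" using \<rho> by (auto simp: u)
  have uu: "4 * u * (1 - u) = 1 - \<rho>\<^sup>2" by (simp add: u power2_eq_square field_simps)
  show "sin (vec_angle s s') = sqrt (4 * u * (1 - u))"
  proof -
    have "vec_angle s s' = arccos \<rho>" unfolding vec_angle_def \<rho>_def s s' by (simp add: power2_eq_square)
    then show ?thesis unfolding uu using \<rho> by (simp add: sin_arccos)
  qed
  define d where "d = s - s'"
  have d: "d \<in> carrier_vec n" using s s' by (simp add: d_def)
  have dd: "(norm2 d)\<^sup>2 = 4 * \<Delta>\<^sup>2 * u"
    unfolding d_def norm2_diff_power2[OF s(1) s'(1)] s s' ss' u by (simp add: field_simps)
  define p where "p = transpose_mat Q *\<^sub>v s'"
  define e where "e = s' - Q *\<^sub>v p"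
  have p: "p \<in> carrier_vec m" using Q s' by (simp add: p_def)
  have e: "e \<in> carrier_vec n" using Q s' p by (simp add: e_def)
  have Qp: "(Q *\<^sub>v x) \<bullet> s' = x \<bullet> p" if x: "x \<in> carrier_vec m" for x
  proof -
    have "(Q *\<^sub>v x) \<bullet> s' = s' \<bullet> (Q *\<^sub>v x)" using Q x s' by (intro scalar_prod_comm_real) auto
    also have "\<dots> = p \<bullet> x" unfolding p_def by (rule transpose_scalar_prod[OF Q s'(1) x])
    finally show ?thesis using scalar_prod_comm_real[OF p x] by simp
  qed
  have "Q *\<^sub>v 0\<^sub>v m = 0\<^sub>v n" using Q by auto
  then have pyth: "\<Delta>\<^sup>2 = (norm2 e)\<^sup>2 + (norm2 p)\<^sup>2"
    using isometry_projection_best[OF Q Qo s'(1), of "0\<^sub>v m"] s' p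
    by (simp add: p_def[symmetric] e_def[symmetric])
  have \<tau>2: "0 < 1 + \<tau>\<^sup>2" by (simp add: add_pos_nonneg)
  define \<eta> where "\<eta> = 2 * \<tau> / (1 + \<tau>\<^sup>2)"
  have \<eta>: "0 \<le> \<eta>" "\<eta> \<le> 2 * \<tau>" using \<tau> \<tau>2 by (auto simp: \<eta>_def divide_le_eq)
  have e_le: "(norm2 e)\<^sup>2 \<le> \<eta>\<^sup>2 * \<Delta>\<^sup>2"
    unfolding power_mult_distrib[symmetric] e_def p_def \<eta>_def by (intro power_mono proj) simp
  have \<eta>2: "\<eta>\<^sup>2 \<le> 4 * \<tau>\<^sup>2" using power_mono[OF \<eta>(2,1), of 2] by (simp add: power_mult_distrib)
  \<comment> \<open>\<open>\<eta>\<close> and \<open>\<zeta>\<close> are sine and cosine of the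
    angle with half-angle tangent \<open>\<tau>\<close>. Keeping the denominator 1 + tau^2 of the
    Chebyshev bound thus gives a lower bound for the projection that makes 1 - zeta of order
    tau^2.\<close>
  define \<zeta> where "\<zeta> = (1 - \<tau>\<^sup>2) / (1 + \<tau>\<^sup>2)"
  have \<zeta>: "0 < \<zeta>" using \<tau> \<tau>2 by (simp add: \<zeta>_def power_less_one_iff)
  have "\<zeta>\<^sup>2 = 1 - \<eta>\<^sup>2"
    using \<tau>2 by (simp add: \<zeta>_def \<eta>_def divide_simps power2_eq_square) (simp add: algebra_simps)
  then have "(\<zeta> * \<Delta>)\<^sup>2 = \<Delta>\<^sup>2 - \<eta>\<^sup>2 * \<Delta>\<^sup>2" by (simp add: power_mult_distrib left_diff_distrib)
  then have "(\<zeta> * \<Delta>)\<^sup>2 \<le> (norm2 p)\<^sup>2" using pyth e_le by linarith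
  then have p_ge: "\<zeta> * \<Delta> \<le> norm2 p" by (rule power2_le_imp_le) simp
  then have p_pos: "0 < norm2 p" using mult_pos_pos[OF \<zeta> \<Delta>] by linarith
  show "u \<le> b / a * \<tau>\<^sup>2"
  proof -
    \<comment> \<open>The competitor in the minimization: the projection of \<open>s'\<close>,
      scaled back to length \<open>\<Delta>\<close>.\<close>
    define x where "x = (\<Delta> / norm2 p) \<cdot>\<^sub>v p"
    have x: "x \<in> carrier_vec m" "norm2 x = \<Delta>" using p p_pos \<Delta> by (auto simp: x_def norm2_smult)
    have Qx: "Q *\<^sub>v x \<in> carrier_vec n" using Q x by simp
    have "x \<bullet> p = \<Delta> * norm2 p"
      using p p_pos by (simp add: x_def norm2_power2[symmetric] power2_eq_square)
    then have "(norm2 (Q *\<^sub>v x - s'))\<^sup>2 = 2 * \<Delta>\<^sup>2 - 2 * (\<Delta> * norm2 p)"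
      unfolding norm2_diff_power2[OF Qx s'(1)] Qp[OF x(1)] isometry_norm2[OF Q Qo x(1)] x(2) s'(2) by simp
    also have "\<dots> \<le> 2 * \<Delta>\<^sup>2 - 2 * (\<Delta> * (\<zeta> * \<Delta>))"
      using p_ge \<Delta> by (intro diff_left_mono mult_left_mono) auto
    also have "\<dots> = 2 * \<Delta>\<^sup>2 * (1 - \<zeta>)" by (simp add: power2_eq_square algebra_simps)
    also have "\<dots> \<le> 2 * \<Delta>\<^sup>2 * (2 * \<tau>\<^sup>2)"
    proof (rule mult_left_mono)
      have "1 - \<zeta> = 2 * \<tau>\<^sup>2 / (1 + \<tau>\<^sup>2)" using \<tau>2 by (simp add: \<zeta>_def field_simps)
      also have "\<dots> \<le> 2 * \<tau>\<^sup>2" using \<tau>2 by (simp add: divide_le_eq algebra_simps)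
      finally show "1 - \<zeta> \<le> 2 * \<tau>\<^sup>2" .
    qed simp
    finally have x_le: "(norm2 (Q *\<^sub>v x - s'))\<^sup>2 \<le> 2 * \<Delta>\<^sup>2 * (2 * \<tau>\<^sup>2)" .
    have "a * (norm2 d)\<^sup>2 \<le> d \<bullet> (B *\<^sub>v d)" by (rule lower[OF d])
    also have "\<dots> \<le> (Q *\<^sub>v x - s') \<bullet> (B *\<^sub>v (Q *\<^sub>v x - s'))" unfolding d_def by (rule minimal[OF x])
    also have "\<dots> \<le> b * (norm2 (Q *\<^sub>v x - s'))\<^sup>2" using Qx s' by (intro upper) auto
    also have "\<dots> \<le> b * (2 * \<Delta>\<^sup>2 * (2 * \<tau>\<^sup>2))" using x_le a by (intro mult_left_mono) auto
    finally have "(4 * \<Delta>\<^sup>2) * (a * u) \<le> (4 * \<Delta>\<^sup>2) * (b * \<tau>\<^sup>2)" unfolding dd by (simp add: algebra_simps)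
    then have "a * u \<le> b * \<tau>\<^sup>2" using \<Delta> by (subst (asm) mult_le_cancel_left_pos) auto
    then show ?thesis using a by (simp add: field_simps)
  qed
  define w where "w = p - \<rho> \<cdot>\<^sub>v h"
  have w: "w \<in> carrier_vec m" using p h by (simp add: w_def)
  have hp: "p \<bullet> h = \<rho> * \<Delta>\<^sup>2" using Qp[OF h(1)] ss' scalar_prod_comm_real[OF p h(1)] by (simp add: s_def)
  have hh: "h \<bullet> h = \<Delta>\<^sup>2" using norm2_power2[of h] h by simp
  have wh: "w \<bullet> h = 0" unfolding w_def using p h hp hh by (simp add: minus_scalar_prod_distrib[of _ m])
  have wp: "w \<bullet> p = (norm2 w)\<^sup>2"
  proof -
    have "w \<bullet> w = w \<bullet> p - \<rho> * (w \<bullet> h)"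
      using p h w unfolding w_def by (subst scalar_prod_minus_distrib[of _ m]) (auto simp: scalar_prod_smult_distrib[of _ m])
    then show ?thesis by (simp add: wh norm2_power2)
  qed
  have pw: "(norm2 p)\<^sup>2 = (norm2 w)\<^sup>2 + \<rho>\<^sup>2 * \<Delta>\<^sup>2"
  proof -
    have "w \<bullet> p = p \<bullet> p - \<rho> * (h \<bullet> p)" unfolding w_def using p h by (simp add: minus_scalar_prod_distrib[of _ m])
    then have "(norm2 w)\<^sup>2 = (norm2 p)\<^sup>2 - \<rho> * (\<rho> * \<Delta>\<^sup>2)"
      using wp hp scalar_prod_comm_real[OF p h(1)] norm2_power2[of p] by simp
    then show ?thesis by (simp add: power2_eq_square)
  qed
  \<comment> \<open>\<open>s'\<close> is the orthogonal sum of \<open>e\<close>, Q w and rho s. The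
    squared sine thus splits into the distance from the subspace and the deviation \<open>w\<close>
    inside it.\<close>
  have total: "\<Delta>\<^sup>2 * (4 * u * (1 - u)) = (norm2 e)\<^sup>2 + (norm2 w)\<^sup>2"
    unfolding uu using pyth pw by (simp add: algebra_simps)
  show "4 * u * (1 - u - ((b - a) / (b + a))\<^sup>2) \<le> 4 * \<tau>\<^sup>2"
  proof -
    have Qw: "Q *\<^sub>v w \<in> carrier_vec n" using Q w by simp
    have "(Q *\<^sub>v w) \<bullet> d = w \<bullet> h - w \<bullet> p"
      unfolding d_def using Qw s s' Qp[OF w] isometry_scalar_prod[OF Q Qo w h(1)]
      by (simp add: scalar_prod_minus_distrib[of _ n] s_def)
    then have Qwd: "(Q *\<^sub>v w) \<bullet> d = - (norm2 w)\<^sup>2" by (simp add: wh wp)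
    \<comment> \<open>Q w is orthogonal to B d, so subtracting the multiple of \<open>d\<close> by
      the spectral centre leaves only that centre times the squared length of \<open>w\<close>. The
      centred operator has norm at most (b - a) / 2, and the quotient is the Wielandt ratio.\<close>
    have "(Q *\<^sub>v w) \<bullet> (B *\<^sub>v d - ((a + b) / 2) \<cdot>\<^sub>v d) = (a + b) / 2 * (norm2 w)\<^sup>2"
      using Qw B d stationary[OF w wh] Qwd
      by (simp add: scalar_prod_minus_distrib[of _ n] d_def[symmetric])
    then have "(a + b) / 2 * (norm2 w)\<^sup>2 \<le> norm2 (Q *\<^sub>v w) * norm2 (B *\<^sub>v d - ((a + b) / 2) \<cdot>\<^sub>v d)"
      using cauchy_schwarz_vec[OF Qw, of "B *\<^sub>v d - ((a + b) / 2) \<cdot>\<^sub>v d"] B d by simp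
    also have "\<dots> \<le> norm2 w * ((b - a) / 2 * norm2 d)"
      unfolding isometry_norm2[OF Q Qo w] by (intro mult_left_mono centre d) simp
    finally have "norm2 w * ((a + b) * norm2 w) \<le> norm2 w * ((b - a) * norm2 d)"
      by (simp add: power2_eq_square algebra_simps add_divide_distrib diff_divide_distrib)
    then have "(a + b) * norm2 w \<le> (b - a) * norm2 d"
      using a norm2_nonneg[of w] by (cases "norm2 w = 0") (auto simp: mult_le_cancel_left_pos less_le)
    then have "norm2 w \<le> (b - a) / (b + a) * norm2 d" using a by (simp add: field_simps)
    then have "(norm2 w)\<^sup>2 \<le> ((b - a) / (b + a))\<^sup>2 * (norm2 d)\<^sup>2"
      unfolding power_mult_distrib[symmetric] by (rule power_mono) simp
    then have "\<Delta>\<^sup>2 * (4 * u * (1 - u)) \<le> \<eta>\<^sup>2 * \<Delta>\<^sup>2 + ((b - a) / (b + a))\<^sup>2 * (4 * \<Delta>\<^sup>2 * u)"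
      using total e_le dd by simp
    then have "\<Delta>\<^sup>2 * (4 * u * (1 - u - ((b - a) / (b + a))\<^sup>2)) \<le> \<Delta>\<^sup>2 * \<eta>\<^sup>2"
      by (simp add: algebra_simps)
    then show ?thesis using \<Delta> \<eta>2 by (simp add: mult_le_cancel_left)
  qed
  show "4 * u * (1 - u) \<le> 4 * \<tau>\<^sup>2" if m: "m = 1"
  proof -
    \<comment> \<open>In dimension 1 only zero is orthogonal to \<open>h\<close>, so
      \<open>w\<close> vanishes and the residual \<open>e\<close> is all that remains.\<close>
    have "w $ 0 * h $ 0 = 0" "h $ 0 * h $ 0 = \<Delta>\<^sup>2"
      using wh hh h(1) m by (auto simp: scalar_prod_def)
    then have "w $ 0 = 0" using \<Delta> by auto
    then have "norm2 w = 0" using w m by (simp add: norm2_def scalar_prod_def)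
    then have "\<Delta>\<^sup>2 * (4 * u * (1 - u)) \<le> \<Delta>\<^sup>2 * \<eta>\<^sup>2" using total e_le by (simp add: mult.commute)
    then show ?thesis using \<Delta> \<eta>2 by (simp add: mult_le_cancel_left)
  qed
qed

section \<open>Block diagonal isometries, semidefinite kernels, projectors and the shifted
  spectrum\<close>

lemma block_diag_mult:
  fixes Q :: "real mat"
  assumes Q: "Q \<in> carrier_mat n m" and x: "x \<in> carrier_vec m" and y: "y \<in> carrier_vec m"
  shows "four_block_mat Q (0\<^sub>m n m) (0\<^sub>m n m) Q *\<^sub>v (x @\<^sub>v y) = (Q *\<^sub>v x) @\<^sub>v (Q *\<^sub>v y)"
proof -
  have "four_block_mat Q (0\<^sub>m n m) (0\<^sub>m n m) Q *\<^sub>v (x @\<^sub>v y)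
      = (Q *\<^sub>v x + 0\<^sub>m n m *\<^sub>v y) @\<^sub>v (0\<^sub>m n m *\<^sub>v x + Q *\<^sub>v y)"
    using assms by (intro four_block_mat_mult_vec[of _ n m _ m _ n]) auto
  also have "Q *\<^sub>v x + 0\<^sub>m n m *\<^sub>v y = Q *\<^sub>v x" using assms by (intro eq_vecI) auto
  also have "0\<^sub>m n m *\<^sub>v x + Q *\<^sub>v y = Q *\<^sub>v y" using assms by (intro eq_vecI) auto
  finally show ?thesis .
qed

lemma block_diag_transpose:
  fixes Q :: "real mat"
  assumes "Q \<in> carrier_mat n m"
  shows "transpose_mat (four_block_mat Q (0\<^sub>m n m) (0\<^sub>m n m) Q)
    = four_block_mat (transpose_mat Q) (0\<^sub>m m n) (0\<^sub>m m n) (transpose_mat Q)"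
  using assms by (subst transpose_four_block_mat[of _ n m _ m _ n]) auto

lemma block_diag_isometry:
  fixes Q :: "real mat"
  assumes Q: "Q \<in> carrier_mat n m" and o: "transpose_mat Q * Q = 1\<^sub>m m"
  shows "transpose_mat (four_block_mat Q (0\<^sub>m n m) (0\<^sub>m n m) Q) * four_block_mat Q (0\<^sub>m n m) (0\<^sub>m n m) Q
    = 1\<^sub>m (m + m)"
proof -
  have Qt: "transpose_mat Q \<in> carrier_mat m n" using Q by simp
  have "four_block_mat (transpose_mat Q) (0\<^sub>m m n) (0\<^sub>m m n) (transpose_mat Q) * four_block_mat Q (0\<^sub>m n m) (0\<^sub>m n m) Q
      = four_block_mat (transpose_mat Q * Q + 0\<^sub>m m n * 0\<^sub>m n m) (transpose_mat Q * 0\<^sub>m n m + 0\<^sub>m m n * Q)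
          (0\<^sub>m m n * Q + transpose_mat Q * 0\<^sub>m n m) (0\<^sub>m m n * 0\<^sub>m n m + transpose_mat Q * Q)"
    using Q Qt by (intro mult_four_block_mat[of _ m n _ n _ m _ _ m _ m]) auto
  also have "\<dots> = four_block_mat (1\<^sub>m m) (0\<^sub>m m m) (0\<^sub>m m m) (1\<^sub>m m)"
    using Q Qt o by simp
  finally show ?thesis unfolding block_diag_transpose[OF Q] by simp
qed

text \<open>In an eigenbasis the quadratic form is a sum of nonnegative terms, so each
  \<open>d i\<close> or the matching coordinate is zero. It turns a failure of definiteness into a
  null vector.\<close>

lemma pos_semidef_kernel:
  fixes S :: "real mat"
  assumes S: "S \<in> carrier_mat n n" and psd: "pos_semidef S"
    and x: "x \<in> carrier_vec n" and 0: "x \<bullet> (S *\<^sub>v x) = 0"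
  shows "S *\<^sub>v x = 0\<^sub>v n"
proof -
  have sym: "transpose_mat S = S" and ge: "\<And>x. x \<in> carrier_vec n \<Longrightarrow> 0 \<le> x \<bullet> (S *\<^sub>v x)"
    using psd S by (auto simp: pos_semidef_def)
  obtain U d where "diagonalized n S U d" using symmetric_diagonalized[OF S sym] .
  then interpret D: diagonalized n S U d .
  have d: "0 \<le> d i" if i: "i < n" for i
  proof -
    obtain v where v: "v \<in> carrier_vec n" "v \<noteq> 0\<^sub>v n" "S *\<^sub>v v = d i \<cdot>\<^sub>v v"
      using D.eigenvalue_d[OF i] S by (auto simp: eigenvalue_def eigenvector_def)
    then have "0 \<le> d i * (v \<bullet> v)" using ge[OF v(1)] by simp
    moreover have "0 < v \<bullet> v" using v scalar_prod_self_nonneg[of v] scalar_prod_self_eq_0[OF v(1)] by linarith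
    ultimately show ?thesis by (simp add: zero_le_mult_iff)
  qed
  have "(\<Sum>i<n. d i * (D.coord x i)\<^sup>2) = 0"
    using 0 unfolding D.A_mult[OF x] using x
    by (simp add: D.scalar_prod_coords D.coords_fv power2_eq_square algebra_simps)
  then have "\<forall>i\<in>{..<n}. d i * (D.coord x i)\<^sup>2 = 0"
    using d by (subst (asm) sum_nonneg_eq_0_iff) auto
  then have "D.coord (S *\<^sub>v x) i = 0" if "i < n" for i
    using that unfolding D.A_mult[OF x] by (auto simp: D.coords_fv)
  then have "(S *\<^sub>v x) \<bullet> (S *\<^sub>v x) = 0" using S x by (simp add: D.scalar_prod_coords)
  then show ?thesis using S x by (subst (asm) scalar_prod_self_eq_0[of _ n]) auto
qed

text \<open>By Pythagoras the radicand is the squared length of P y. That length is nonzero because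
  \<open>y\<close> is not orthogonal to the range, as \<open>w\<close> witnesses.\<close>

lemma orthogonal_projector_residual:
  assumes P: "orthogonal_projector N W P" and y: "y \<in> carrier_vec N" "norm2 y = 1"
    and w: "w \<in> W" "y \<bullet> w \<noteq> 0"
  shows "0 < sqrt (1 - (norm2 ((1\<^sub>m N - P) *\<^sub>v y))\<^sup>2)"
    and "sqrt (1 - (norm2 ((1\<^sub>m N - P) *\<^sub>v y))\<^sup>2) \<le> 1"
proof -
  have PC: "P \<in> carrier_mat N N" and sym: "transpose_mat P = P" and PP: "P * P = P"
    and img: "(\<lambda>x. P *\<^sub>v x) ` carrier_vec N = W"
    using P by (auto simp: orthogonal_projector_def)
  have Py: "P *\<^sub>v y \<in> carrier_vec N" using PC y by simp
  have "y \<bullet> (P *\<^sub>v y) = y \<bullet> (P *\<^sub>v (P *\<^sub>v y))"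
    using assoc_mult_mat_vec[OF PC PC y(1)] PP by simp
  also have "\<dots> = (norm2 (P *\<^sub>v y))\<^sup>2"
    unfolding norm2_power2 by (rule symmetric_scalar_prod[OF PC sym y(1) Py])
  finally have yPy: "y \<bullet> (P *\<^sub>v y) = (norm2 (P *\<^sub>v y))\<^sup>2" .
  have "(1\<^sub>m N - P) *\<^sub>v y = y - P *\<^sub>v y"
    using PC y(1) by (subst minus_mult_distrib_mat_vec[of _ N N]) auto
  then have eps: "1 - (norm2 ((1\<^sub>m N - P) *\<^sub>v y))\<^sup>2 = (norm2 (P *\<^sub>v y))\<^sup>2"
    using norm2_diff_power2[OF y(1) Py] yPy y(2) by simp
  obtain x where x: "x \<in> carrier_vec N" "w = P *\<^sub>v x" using w(1) img by auto
  have "(P *\<^sub>v y) \<bullet> x \<noteq> 0" using w(2) symmetric_scalar_prod[OF PC sym y(1) x(1)] x(2) by simp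
  then have "P *\<^sub>v y \<noteq> 0\<^sub>v N" using x(1) by auto
  then have "0 < norm2 (P *\<^sub>v y)" by (rule norm2_pos[OF Py])
  then show "0 < sqrt (1 - (norm2 ((1\<^sub>m N - P) *\<^sub>v y))\<^sup>2)" unfolding eps by simp
  show "sqrt (1 - (norm2 ((1\<^sub>m N - P) *\<^sub>v y))\<^sup>2) \<le> 1" by simp
qed

text \<open>The \<open>d i\<close> come from an abstract diagonalization and carry no order. Each is
  located by matching it with a root of the characteristic polynomial of \<open>A\<close>;
  definiteness tested on an eigenvector for the last root gives positivity.\<close>

lemma shifted_spectrum:
  fixes A :: "real mat" and \<alpha> :: "nat \<Rightarrow> real"
  assumes A: "A \<in> carrier_mat n n" and sym: "transpose_mat A = A" and n: "0 < n"
    and eigs: "char_poly A = (\<Prod>i = 1..n. [:- \<alpha> i, 1:])"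
    and desc: "\<And>i j. 1 \<le> i \<Longrightarrow> i \<le> j \<Longrightarrow> j \<le> n \<Longrightarrow> \<alpha> j \<le> \<alpha> i"
    and pd: "pos_def (shift_mat A c)"
  obtains U d where "diagonalized n (shift_mat A c) U d"
    "\<And>i. i < n \<Longrightarrow> \<alpha> n + c \<le> d i" "\<And>i. i < n \<Longrightarrow> d i \<le> \<alpha> 1 + c" "0 < \<alpha> n + c"
proof -
  let ?B = "shift_mat A c"
  have B: "?B \<in> carrier_mat n n" using A by simp
  obtain U d where D: "diagonalized n ?B U d" using symmetric_diagonalized[OF B shift_mat_sym[OF A sym]] .
  then interpret D: diagonalized n ?B U d .
  have root: "eigenvalue A e \<longleftrightarrow> (\<exists>i\<in>{1..n}. e = \<alpha> i)" for e
    unfolding eigenvalue_root_char_poly[OF A] eigs by (auto simp: poly_prod)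
  have d: "\<exists>j\<in>{1..n}. d i = \<alpha> j + c" if i: "i < n" for i
  proof -
    obtain v where v: "v \<in> carrier_vec n" "v \<noteq> 0\<^sub>v n" "?B *\<^sub>v v = d i \<cdot>\<^sub>v v"
      using D.eigenvalue_d[OF i] B by (auto simp: eigenvalue_def eigenvector_def)
    have "A *\<^sub>v v = (d i - c) \<cdot>\<^sub>v v"
    proof (rule eq_vecI)
      fix j assume "j < dim_vec ((d i - c) \<cdot>\<^sub>v v)"
      then have j: "j < n" using v by simp
      have "(A *\<^sub>v v + c \<cdot>\<^sub>v v) $ j = (d i \<cdot>\<^sub>v v) $ j" using v(3) shift_mat_mult[OF A v(1)] by simp
      then show "(A *\<^sub>v v) $ j = ((d i - c) \<cdot>\<^sub>v v) $ j" using j A v(1) by (simp add: algebra_simps)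
    qed (use A v in auto)
    then have "eigenvalue A (d i - c)" unfolding eigenvalue_def eigenvector_def using v A by auto
    then show ?thesis unfolding root by (auto simp: algebra_simps)
  qed
  have "0 < \<alpha> n + c"
  proof -
    have "eigenvalue A (\<alpha> n)" unfolding root using n by auto
    then obtain v where v: "v \<in> carrier_vec n" "v \<noteq> 0\<^sub>v n" "A *\<^sub>v v = \<alpha> n \<cdot>\<^sub>v v"
      using A by (auto simp: eigenvalue_def eigenvector_def)
    have "0 < v \<bullet> (?B *\<^sub>v v)" using pd v B by (auto simp: pos_def_def)
    also have "?B *\<^sub>v v = (\<alpha> n + c) \<cdot>\<^sub>v v"
      unfolding shift_mat_mult[OF A v(1)] v(3) using v(1) by (intro eq_vecI) (auto simp: algebra_simps)
    finally have "0 < (\<alpha> n + c) * (v \<bullet> v)" using v by simp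
    then show ?thesis using scalar_prod_self_nonneg[of v] by (simp add: zero_less_mult_iff)
  qed
  then show thesis using that[OF D] d desc by (metis atLeastAtMost_iff add_le_cancel_right order_refl)
qed

section \<open>Krylov approximation and the projected subproblem\<close>

context lanczos
begin

text \<open>Horner's scheme: \<open>pCons e f\<close> corresponds to e g + B f(B) g, and each
  application of \<open>A\<close> raises the index of the span by one. The zero tail is separate
  because there the degree does not grow.\<close>

lemma poly_krylov:
  assumes D: "diagonalized n (shift_mat A c) U d" and "degree f \<le> k"
  shows "diagonalized.fv n U d (poly f) g \<in> lspan (q ` {..k})"
proof -
  interpret D: diagonalized n "shift_mat A c" U d by (rule D)
  show ?thesis using assms(2)
  proof (induction f arbitrary: k)
    case 0
    have "D.fv (poly 0) g = 0 \<cdot>\<^sub>v g"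
      using g by (intro D.eq_by_coords) (auto simp: D.coords_fv D.coords_smult)
    then show ?case using g_lspan by (simp only: lspan.smult)
  next
    case (pCons e f)
    show ?case
    proof (cases "f = 0")
      case True
      have "D.fv (poly (pCons e f)) g = e \<cdot>\<^sub>v g"
        using g True by (intro D.eq_by_coords) (auto simp: D.coords_fv D.coords_smult)
      then show ?thesis using g_lspan by (simp only: lspan.smult)
    next
      case False
      then obtain l where k: "k = Suc l" and "degree f \<le> l" using pCons.prems by (cases k) auto
      define x where "x = D.fv (poly f) g"
      have x: "x \<in> carrier_vec n" "x \<in> lspan (q ` {..l})"
        using pCons.IH[OF \<open>degree f \<le> l\<close>] by (auto simp: x_def)
      have "D.fv (poly (pCons e f)) g = e \<cdot>\<^sub>v g + shift_mat A c *\<^sub>v x"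
        unfolding D.A_mult[OF x(1)] using g
        by (intro D.eq_by_coords) (auto simp: x_def D.coords_fv D.coords_smult D.coords_add algebra_simps)
      also have "\<dots> = e \<cdot>\<^sub>v g + (A *\<^sub>v x + c \<cdot>\<^sub>v x)" unfolding shift_mat_mult[OF A x(1)] ..
      also have "\<dots> \<in> lspan (q ` {..k})"
      proof (intro lspan.add lspan.smult g_lspan)
        show "A *\<^sub>v x \<in> lspan (q ` {..k})" by (rule A_lspan[OF x(2)]) (simp add: k)
        show "x \<in> lspan (q ` {..k})" by (rule subsetD[OF lspan_mono x(2)]) (auto simp: k)
      qed
      finally show ?thesis .
    qed
  qed
qed

lemma projection_le:
  assumes k: "k \<le> k_max A g" and x: "x \<in> carrier_vec n" and w: "w \<in> lspan (q ` {..k})"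
  shows "norm2 (x - lanczos_Q A g k *\<^sub>v (transpose_mat (lanczos_Q A g k) *\<^sub>v x)) \<le> norm2 (x - w)"
proof (rule power2_le_imp_le)
  obtain c where c: "c \<in> carrier_vec (Suc k)" "w = lanczos_Q A g k *\<^sub>v c" using lspan_Q[OF w] by blast
  show "(norm2 (x - lanczos_Q A g k *\<^sub>v (transpose_mat (lanczos_Q A g k) *\<^sub>v x)))\<^sup>2 \<le> (norm2 (x - w))\<^sup>2"
    using isometry_projection_best[OF Q_carrier Q_orthonormal[OF k] x c(1)] c(2) by simp
qed simp

lemma rhs_carrier [simp]: "lanczos_rhs g k \<in> carrier_vec (Suc k)"
  by (simp add: lanczos_rhs_def)

lemma rhs_dim [simp]: "dim_vec (lanczos_rhs g k) = Suc k"
  by (rule carrier_vecD[OF rhs_carrier])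

lemma rhs_scalar_prod:
  assumes k: "k \<le> k_max A g" and x: "x \<in> carrier_vec (Suc k)"
  shows "lanczos_rhs g k \<bullet> x = g \<bullet> (lanczos_Q A g k *\<^sub>v x)"
  using transpose_scalar_prod[OF Q_carrier g x] Q_transpose_g[OF k] by simp

lemma T_scalar_prod:
  assumes x: "x \<in> carrier_vec (Suc k)" and w: "w \<in> carrier_vec (Suc k)"
  shows "w \<bullet> (lanczos_T A g k *\<^sub>v x) = (lanczos_Q A g k *\<^sub>v w) \<bullet> (A *\<^sub>v (lanczos_Q A g k *\<^sub>v x))"
  unfolding T_mult[OF x] using transpose_scalar_prod[of "transpose_mat (lanczos_Q A g k)" "Suc k" n w] A x w
  by simp

text \<open>The easy case is automatic for the projected problem. A null vector of the shifted
  matrix is orthogonal to its range, which contains the right side beta_0 e_1, so its first entry is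
  0; an eigenvector of an unreduced tridiagonal matrix cannot have this.\<close>

lemma T_shift_pos_def:
  assumes k: "k \<le> k_max A g" and psd: "pos_semidef (shift_mat (lanczos_T A g k) lam)"
    and h: "h \<in> carrier_vec (Suc k)" "shift_mat (lanczos_T A g k) lam *\<^sub>v h = - lanczos_rhs g k"
  shows "pos_def (shift_mat (lanczos_T A g k) lam)"
proof -
  let ?T = "lanczos_T A g k" and ?S = "shift_mat (lanczos_T A g k) lam"
  have S: "?S \<in> carrier_mat (Suc k) (Suc k)" by simp
  have sym: "transpose_mat ?S = ?S" by (rule shift_mat_sym[OF T_carrier T_sym])
  have "0 < x \<bullet> (?S *\<^sub>v x)" if x: "x \<in> carrier_vec (Suc k)" "x \<noteq> 0\<^sub>v (Suc k)" for x
  proof (rule ccontr)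
    assume "\<not> ?thesis"
    then have "x \<bullet> (?S *\<^sub>v x) = 0" using psd x(1) S by (fastforce simp: pos_semidef_def)
    then have Sx: "?S *\<^sub>v x = 0\<^sub>v (Suc k)" by (rule pos_semidef_kernel[OF S psd x(1)])
    have "x \<bullet> (- lanczos_rhs g k) = 0"
      unfolding h(2)[symmetric] symmetric_scalar_prod[OF S sym x(1) h(1)] Sx using h(1) by simp
    then have "lanczos_rhs g k \<bullet> x = 0"
      using scalar_prod_comm_real[OF rhs_carrier x(1)] x(1) by simp
    then have x0: "x $ 0 = 0" using norm_g_pos x(1) by (simp add: lanczos_rhs_def)
    have "?T *\<^sub>v x = (- lam) \<cdot>\<^sub>v x"
    proof (rule eq_vecI)
      fix i assume "i < dim_vec ((- lam) \<cdot>\<^sub>v x)"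
      then have i: "i < Suc k" using x(1) by simp
      have "(?T *\<^sub>v x + lam \<cdot>\<^sub>v x) $ i = 0"
        unfolding shift_mat_mult[OF T_carrier x(1), symmetric] Sx using i by simp
      then have "(?T *\<^sub>v x) $ i + lam * x $ i = 0"
        using i x(1) by (simp del: index_mult_mat_vec)
      then show "(?T *\<^sub>v x) $ i = ((- lam) \<cdot>\<^sub>v x) $ i" using i x(1) by (simp del: index_mult_mat_vec)
    qed (use x carrier_matD[OF T_carrier] in auto)
    then show False using T_eigenvector_first[OF k x(1) _ x0] x(2) by blast
  qed
  then show ?thesis using sym carrier_matD[OF S] by (simp add: pos_def_def)
qed

text \<open>The small block matrix is the compression of the large one by diag (Q, Q), because Q^T g
  = beta_0 e_1, Q^T A Q = T and Q^T Q = I.\<close>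

lemma block_compression:
  fixes \<Delta> :: real
  assumes k: "k \<le> k_max A g" and x: "x \<in> carrier_vec (Suc k + Suc k)"
  defines "Q \<equiv> lanczos_Q A g k"
  defines "Q2 \<equiv> four_block_mat Q (0\<^sub>m n (Suc k)) (0\<^sub>m n (Suc k)) Q"
  shows "trs_block_mat (lanczos_T A g k) (lanczos_rhs g k) \<Delta> *\<^sub>v x
    = transpose_mat Q2 *\<^sub>v (trs_block_mat A g \<Delta> *\<^sub>v (Q2 *\<^sub>v x))"
proof -
  have Q: "Q \<in> carrier_mat n (Suc k)" and Qt: "transpose_mat Q \<in> carrier_mat (Suc k) n"
    by (simp_all add: Q_def)
  define x1 x2 where "x1 = vec_first x (Suc k)" and "x2 = vec_last x (Suc k)"
  have x12: "x1 \<in> carrier_vec (Suc k)" "x2 \<in> carrier_vec (Suc k)" and x_eq: "x = x1 @\<^sub>v x2"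
    using x by (auto simp: x1_def x2_def)
  have Qx: "Q *\<^sub>v x1 \<in> carrier_vec n" "Q *\<^sub>v x2 \<in> carrier_vec n" using x12 by (auto simp: Q_def)
  have QQ: "transpose_mat Q *\<^sub>v (Q *\<^sub>v v) = v" if "v \<in> carrier_vec (Suc k)" for v
    using that Q Q_orthonormal[OF k] by (subst assoc_mult_mat_vec[symmetric, of _ "Suc k" n _ "Suc k"]) (auto simp: Q_def)
  have "transpose_mat Q2 *\<^sub>v (trs_block_mat A g \<Delta> *\<^sub>v (Q2 *\<^sub>v x))
      = transpose_mat Q2 *\<^sub>v (((g \<bullet> (Q *\<^sub>v x2) / \<Delta>\<^sup>2) \<cdot>\<^sub>v g - A *\<^sub>v (Q *\<^sub>v x1)) @\<^sub>v (Q *\<^sub>v x1 - A *\<^sub>v (Q *\<^sub>v x2)))"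
    unfolding x_eq Q2_def block_diag_mult[OF Q x12] trs_block_mat_mult[OF A g Qx] ..
  also have "\<dots> = (transpose_mat Q *\<^sub>v ((g \<bullet> (Q *\<^sub>v x2) / \<Delta>\<^sup>2) \<cdot>\<^sub>v g - A *\<^sub>v (Q *\<^sub>v x1)))
      @\<^sub>v (transpose_mat Q *\<^sub>v (Q *\<^sub>v x1 - A *\<^sub>v (Q *\<^sub>v x2)))"
    unfolding Q2_def block_diag_transpose[OF Q] using A g Qx by (intro block_diag_mult[OF Qt]) auto
  also have "transpose_mat Q *\<^sub>v ((g \<bullet> (Q *\<^sub>v x2) / \<Delta>\<^sup>2) \<cdot>\<^sub>v g - A *\<^sub>v (Q *\<^sub>v x1))
      = (lanczos_rhs g k \<bullet> x2 / \<Delta>\<^sup>2) \<cdot>\<^sub>v lanczos_rhs g k - lanczos_T A g k *\<^sub>v x1"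
    using mult_minus_distrib_mat_vec[OF Qt, of "(g \<bullet> (Q *\<^sub>v x2) / \<Delta>\<^sup>2) \<cdot>\<^sub>v g" "A *\<^sub>v (Q *\<^sub>v x1)"]
      mult_mat_vec[OF Qt g] A g Qx Q_transpose_g[OF k] rhs_scalar_prod[OF k x12(2)] T_mult[OF x12(1)]
    by (simp add: Q_def)
  also have "transpose_mat Q *\<^sub>v (Q *\<^sub>v x1 - A *\<^sub>v (Q *\<^sub>v x2)) = x1 - lanczos_T A g k *\<^sub>v x2"
    using mult_minus_distrib_mat_vec[OF Qt Qx(1), of "A *\<^sub>v (Q *\<^sub>v x2)"] A Qx QQ[OF x12(1)] T_mult[OF x12(2)]
    by (simp add: Q_def)
  finally show ?thesis
    unfolding x_eq trs_block_mat_mult[OF T_carrier rhs_carrier x12] by simp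
qed

text \<open>As B s' = - g, the squared B-distance of a vector to \<open>s'\<close> is twice its
  objective plus a term depending only on its length, so on the sphere both are minimized together.
  For the second claim the multiplier term drops out in directions orthogonal to
  \<open>h\<close>.\<close>

lemma trs_iterate_optimal:
  fixes s' h :: "real vec"
  assumes k: "k \<le> k_max A g" and s': "s' \<in> carrier_vec n" "shift_mat A lam *\<^sub>v s' = - g" "norm2 s' = \<Delta>"
    and sol: "trs_solution (lanczos_T A g k) (lanczos_rhs g k) \<Delta> h"
    and mult: "shift_mat (lanczos_T A g k) lamk *\<^sub>v h = - lanczos_rhs g k"
    and h: "h \<in> carrier_vec (Suc k)" "norm2 h = \<Delta>"
  defines "Q \<equiv> lanczos_Q A g k" and "B \<equiv> shift_mat A lam"
  shows "\<And>x. x \<in> carrier_vec (Suc k) \<Longrightarrow> norm2 x = \<Delta> \<Longrightarrow>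
      (Q *\<^sub>v h - s') \<bullet> (B *\<^sub>v (Q *\<^sub>v h - s')) \<le> (Q *\<^sub>v x - s') \<bullet> (B *\<^sub>v (Q *\<^sub>v x - s'))"
    and "\<And>w. w \<in> carrier_vec (Suc k) \<Longrightarrow> w \<bullet> h = 0 \<Longrightarrow> (Q *\<^sub>v w) \<bullet> (B *\<^sub>v (Q *\<^sub>v h - s')) = 0"
proof -
  have B: "B \<in> carrier_mat n n" and Bsym: "transpose_mat B = B"
    using A shift_mat_sym[OF A A_sym] by (auto simp: B_def)
  have Qx: "Q *\<^sub>v x \<in> carrier_vec n" if "x \<in> carrier_vec (Suc k)" for x using that by (simp add: Q_def)
  have Bs': "B *\<^sub>v s' = - g" using s'(2) by (simp add: B_def)
  have BQ: "B *\<^sub>v (Q *\<^sub>v x - s') = A *\<^sub>v (Q *\<^sub>v x) + lam \<cdot>\<^sub>v (Q *\<^sub>v x) + g" if x: "x \<in> carrier_vec (Suc k)" for x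
  proof -
    have "B *\<^sub>v (Q *\<^sub>v x - s') = B *\<^sub>v (Q *\<^sub>v x) - (- g)"
      unfolding Bs'[symmetric] by (rule mult_minus_distrib_mat_vec[OF B Qx[OF x] s'(1)])
    also have "B *\<^sub>v (Q *\<^sub>v x) = A *\<^sub>v (Q *\<^sub>v x) + lam \<cdot>\<^sub>v (Q *\<^sub>v x)"
      unfolding B_def by (rule shift_mat_mult[OF A Qx[OF x]])
    finally show ?thesis using A g Qx[OF x] by (auto intro!: eq_vecI)
  qed
  have obj: "(Q *\<^sub>v x - s') \<bullet> (B *\<^sub>v (Q *\<^sub>v x - s'))
      = 2 * trs_objective (lanczos_T A g k) (lanczos_rhs g k) x + lam * \<Delta>\<^sup>2 - s' \<bullet> g"
    if x: "x \<in> carrier_vec (Suc k)" "norm2 x = \<Delta>" for x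
  proof -
    let ?v = "Q *\<^sub>v x"
    note v = Qx[OF x(1)]
    have vv: "?v \<bullet> ?v = \<Delta>\<^sup>2"
      using isometry_norm2[OF Q_carrier Q_orthonormal[OF k] x(1)] x(2) norm2_power2[of ?v] by (simp add: Q_def)
    have s'B: "s' \<bullet> (A *\<^sub>v ?v + lam \<cdot>\<^sub>v ?v) = - (g \<bullet> ?v)"
      using symmetric_scalar_prod[OF B Bsym s'(1) v] Bs' shift_mat_mult[OF A v] g v carrier_vecD[OF v]
      by (simp add: B_def)
    have "(?v - s') \<bullet> (B *\<^sub>v (?v - s'))
        = ?v \<bullet> (A *\<^sub>v ?v + lam \<cdot>\<^sub>v ?v) + ?v \<bullet> g - s' \<bullet> (A *\<^sub>v ?v + lam \<cdot>\<^sub>v ?v) - s' \<bullet> g"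
      unfolding BQ[OF x(1)] using A g v s'(1)
      by (simp add: minus_scalar_prod_distrib[of _ n] scalar_prod_add_distrib[of _ n])
    also have "\<dots> = ?v \<bullet> (A *\<^sub>v ?v) + lam * \<Delta>\<^sup>2 + 2 * (g \<bullet> ?v) - s' \<bullet> g"
      unfolding s'B using A g v vv scalar_prod_comm_real[OF v g] by (simp add: scalar_prod_add_distrib[of _ n])
    finally show ?thesis
      using rhs_scalar_prod[OF k x(1)] T_scalar_prod[OF x(1) x(1)] by (simp add: trs_objective_def Q_def)
  qed
  show "(Q *\<^sub>v h - s') \<bullet> (B *\<^sub>v (Q *\<^sub>v h - s')) \<le> (Q *\<^sub>v x - s') \<bullet> (B *\<^sub>v (Q *\<^sub>v x - s'))"
    if x: "x \<in> carrier_vec (Suc k)" "norm2 x = \<Delta>" for x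
  proof -
    have "trs_objective (lanczos_T A g k) (lanczos_rhs g k) h \<le> trs_objective (lanczos_T A g k) (lanczos_rhs g k) x"
      using sol x by (force simp: trs_solution_def is_arg_min_def lanczos_rhs_def not_less)
    then show ?thesis unfolding obj[OF x] obj[OF h] by simp
  qed
  show "(Q *\<^sub>v w) \<bullet> (B *\<^sub>v (Q *\<^sub>v h - s')) = 0" if w: "w \<in> carrier_vec (Suc k)" "w \<bullet> h = 0" for w
  proof -
    have Qwh: "(Q *\<^sub>v w) \<bullet> (Q *\<^sub>v h) = 0"
      using isometry_scalar_prod[OF Q_carrier Q_orthonormal[OF k] w(1) h(1)] w(2) by (simp add: Q_def)
    have "w \<bullet> (lanczos_T A g k *\<^sub>v h + lamk \<cdot>\<^sub>v h) = - (w \<bullet> lanczos_rhs g k)"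
      using mult shift_mat_mult[OF T_carrier h(1)] w(1) by simp
    then have "w \<bullet> (lanczos_T A g k *\<^sub>v h) = - (w \<bullet> lanczos_rhs g k)"
      using w h(1) by (simp add: scalar_prod_add_distrib[of _ "Suc k"] mult_mat_vec_carrier[OF T_carrier])
    then have "(Q *\<^sub>v w) \<bullet> (A *\<^sub>v (Q *\<^sub>v h)) + (Q *\<^sub>v w) \<bullet> g = 0"
      using T_scalar_prod[OF h(1) w(1)] rhs_scalar_prod[OF k w(1)]
        scalar_prod_comm_real[OF w(1) rhs_carrier] scalar_prod_comm_real[OF Qx[OF w(1)] g] by (simp add: Q_def)
    then show ?thesis unfolding BQ[OF h(1)] using A g Qx[OF w(1)] Qx[OF h(1)] Qwh
      by (simp add: scalar_prod_add_distrib[of _ n])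
  qed
qed

end

text \<open>Here \<open>\<beta>\<close> is ((sqrt a + sqrt b) / 2)^2. In these parameters the ends
  of the spectral interval, the Chebyshev estimates and c_k, apart from the logarithm, are rational
  in \<open>t\<close>.\<close>

lemma condition_number_parameters:
  fixes a b \<kappa> t :: real
  assumes ab: "0 < a" "a < b" and \<kappa>: "\<kappa> = b / a" and t: "t = (sqrt \<kappa> - 1) / (sqrt \<kappa> + 1)"
  obtains \<beta> where "0 < t" "t < 1" "0 < \<beta>" "a = \<beta> * (1 - t)\<^sup>2" "b = \<beta> * (1 + t)\<^sup>2"
proof -
  define r where "r = sqrt \<kappa>"
  have "1 < \<kappa>" using ab by (simp add: \<kappa>)
  then have r: "1 < r" and "r\<^sup>2 = \<kappa>" by (simp_all add: r_def)
  then have b: "b = a * r\<^sup>2" using ab by (simp add: \<kappa>)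
  have t': "1 - t = 2 / (r + 1)" "1 + t = 2 * r / (r + 1)"
    using r by (simp_all add: t r_def[symmetric] field_simps)
  show thesis
  proof (rule that[of "a * (r + 1)\<^sup>2 / 4"])
    show "0 < t" "t < 1" using r by (simp_all add: t r_def[symmetric])
    show "0 < a * (r + 1)\<^sup>2 / 4" using ab r by simp
    show "a = a * (r + 1)\<^sup>2 / 4 * (1 - t)\<^sup>2" "b = a * (r + 1)\<^sup>2 / 4 * (1 + t)\<^sup>2"
      unfolding t' b using r by (simp_all add: power_divide power_mult_distrib)
  qed
qed

lemma append_vec_minus:
  fixes a b c d :: "real vec"
  assumes "a \<in> carrier_vec n" "c \<in> carrier_vec n" "b \<in> carrier_vec m" "d \<in> carrier_vec m"
  shows "(a @\<^sub>v b) - (c @\<^sub>v d) = (a - c) @\<^sub>v (b - d)"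
  using assms by (intro eq_vecI) auto

text \<open>Since g = - B s, a Krylov vector f(B) g equals - B f(B) s. Suitable choices leave the
  errors (1 - x f1)(B) s and, because B y = gamma s, (1/x - x f2)(B) (gamma s); the projections can
  only do better.\<close>

lemma (in lanczos) krylov_residuals:
  fixes \<beta> t :: real
  assumes k: "k \<le> k_max A g" and D: "diagonalized n (shift_mat A lam) U d"
    and \<beta>: "0 < \<beta>" and t: "0 < t" "t < 1"
    and d: "\<And>i. i < n \<Longrightarrow> \<beta> * (1 - t)\<^sup>2 \<le> d i" "\<And>i. i < n \<Longrightarrow> d i \<le> \<beta> * (1 + t)\<^sup>2"
    and s: "s \<in> carrier_vec n" "shift_mat A lam *\<^sub>v s = - g"
  defines "proj \<equiv> \<lambda>x. lanczos_Q A g k *\<^sub>v (transpose_mat (lanczos_Q A g k) *\<^sub>v x)"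
  shows "norm2 (s - proj s) \<le> 2 * t ^ Suc k / (1 + (t ^ Suc k)\<^sup>2) * norm2 s"
    and "\<And>y \<gamma>. y \<in> carrier_vec n \<Longrightarrow> shift_mat A lam *\<^sub>v y = \<gamma> \<cdot>\<^sub>v s \<Longrightarrow>
      norm2 (y - proj y) \<le> 2 * t ^ Suc k *
        (1 / (\<beta> * (1 - t)\<^sup>2) + real (Suc k) / (\<beta> * (1 - t\<^sup>2))) * norm2 (\<gamma> \<cdot>\<^sub>v s)"
proof -
  interpret D: diagonalized n "shift_mat A lam" U d by (rule D)
  obtain f1 f2 where f: "degree f1 \<le> k" "degree f2 \<le> k"
    and f1: "\<And>x. \<beta> * (1 - t)\<^sup>2 \<le> x \<Longrightarrow> x \<le> \<beta> * (1 + t)\<^sup>2 \<Longrightarrow>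
       \<bar>1 - x * poly f1 x\<bar> \<le> 2 * t ^ Suc k / (1 + (t ^ Suc k)\<^sup>2)"
    and f2: "\<And>x. \<beta> * (1 - t)\<^sup>2 \<le> x \<Longrightarrow> x \<le> \<beta> * (1 + t)\<^sup>2 \<Longrightarrow>
       \<bar>1 / x - x * poly f2 x\<bar>
         \<le> 2 * t ^ Suc k * (1 / (\<beta> * (1 - t)\<^sup>2) + real (Suc k) / (\<beta> * (1 - t\<^sup>2)))"
    using chebyshev_inverse_approximation[OF \<beta> t, of k] by blast
  have g_eq: "g = (- 1) \<cdot>\<^sub>v D.fv (\<lambda>x. x) s"
    unfolding D.A_mult[OF s(1), symmetric] s(2) using g by (intro eq_vecI) auto
  have g_coord: "D.coord g i = - (d i * D.coord s i)" if "i < n" for i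
    using that by (subst g_eq) (simp add: D.coords_smult D.coords_fv)
  define w1 where "w1 = (- 1) \<cdot>\<^sub>v D.fv (poly f1) g"
  have "w1 \<in> lspan (q ` {..k})" unfolding w1_def by (intro lspan.smult poly_krylov[OF D] f)
  then have "norm2 (s - proj s) \<le> norm2 (s - w1)" unfolding proj_def by (rule projection_le[OF k s(1)])
  also have "s - w1 = D.fv (\<lambda>x. 1 - x * poly f1 x) s"
  proof (rule D.eq_by_coords)
    fix i assume i: "i < n"
    then have "D.coord (s - w1) i = D.coord s i + poly f1 (d i) * D.coord g i"
      using s(1) by (simp add: w1_def D.coords_diff D.coords_smult D.coords_fv)
    then show "D.coord (s - w1) i = D.coord (D.fv (\<lambda>x. 1 - x * poly f1 x) s) i"
      using i g_coord[OF i] by (simp add: D.coords_fv algebra_simps)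
  qed (use s(1) in \<open>auto simp: w1_def\<close>)
  also have "norm2 \<dots> \<le> 2 * t ^ Suc k / (1 + (t ^ Suc k)\<^sup>2) * norm2 s"
    using t d by (intro D.norm2_fv_le s(1) f1) auto
  finally show "norm2 (s - proj s) \<le> 2 * t ^ Suc k / (1 + (t ^ Suc k)\<^sup>2) * norm2 s" .
  fix y \<gamma> assume y: "y \<in> carrier_vec n" "shift_mat A lam *\<^sub>v y = \<gamma> \<cdot>\<^sub>v s"
  have y_coord: "d i * D.coord y i = \<gamma> * D.coord s i" if i: "i < n" for i
    using arg_cong[OF y(2), of "\<lambda>v. D.coord v i"] i s(1)
    unfolding D.A_mult[OF y(1)] by (simp add: D.coords_fv D.coords_smult)
  define w2 where "w2 = (- \<gamma>) \<cdot>\<^sub>v D.fv (poly f2) g"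
  have "w2 \<in> lspan (q ` {..k})" unfolding w2_def by (intro lspan.smult poly_krylov[OF D] f)
  then have "norm2 (y - proj y) \<le> norm2 (y - w2)" unfolding proj_def by (rule projection_le[OF k y(1)])
  also have "y - w2 = D.fv (\<lambda>x. 1 / x - x * poly f2 x) (\<gamma> \<cdot>\<^sub>v s)"
  proof (rule D.eq_by_coords)
    fix i assume i: "i < n"
    have "0 < \<beta> * (1 - t)\<^sup>2" using \<beta> t by simp
    then have di: "0 < d i" using d(1)[OF i] by linarith
    have "D.coord (y - w2) i = D.coord y i + \<gamma> * (poly f2 (d i) * D.coord g i)"
      using i y(1) by (simp add: w2_def D.coords_diff D.coords_smult D.coords_fv)
    also have "\<dots> = \<gamma> * D.coord s i / d i - d i * poly f2 (d i) * (\<gamma> * D.coord s i)"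
      using y_coord[OF i] g_coord[OF i] di by (simp add: field_simps)
    also have "\<dots> = D.coord (D.fv (\<lambda>x. 1 / x - x * poly f2 x) (\<gamma> \<cdot>\<^sub>v s)) i"
      using i s(1) by (simp add: D.coords_fv D.coords_smult algebra_simps)
    finally show "D.coord (y - w2) i = D.coord (D.fv (\<lambda>x. 1 / x - x * poly f2 x) (\<gamma> \<cdot>\<^sub>v s)) i" .
  qed (use y(1) s(1) in \<open>auto simp: w2_def\<close>)
  also have "norm2 \<dots> \<le> 2 * t ^ Suc k *
        (1 / (\<beta> * (1 - t)\<^sup>2) + real (Suc k) / (\<beta> * (1 - t\<^sup>2))) * norm2 (\<gamma> \<cdot>\<^sub>v s)"
    using t d \<beta> s(1) by (intro D.norm2_fv_le f2) (auto simp: power_le_one)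
  finally show "norm2 (y - proj y) \<le> 2 * t ^ Suc k *
        (1 / (\<beta> * (1 - t)\<^sup>2) + real (Suc k) / (\<beta> * (1 - t\<^sup>2))) * norm2 (\<gamma> \<cdot>\<^sub>v s)" .
qed

section \<open>The bound for the angle between s_k and s_opt\<close>

theorem theorem5p4:
  fixes A M Mk P Zperp Ck :: "real mat" and n k :: nat
    and g sopt y z :: "real vec"
    and h s :: "nat \<Rightarrow> real vec"
    and \<alpha> lam :: "nat \<Rightarrow> real"
    and \<Delta> lamopt mu1 mu1k \<epsilon> \<kappa> t c :: real
  assumes A_dim: "A \<in> carrier_mat n n"
    and A_sym: "transpose_mat A = A"
    and A_nonsing: "invertible_mat A"
    and alpha_eigs: "char_poly A = (\<Prod>i = 1..n. [:- \<alpha> i, 1:])"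
    and alpha_desc: "\<And>i j. 1 \<le> i \<Longrightarrow> i \<le> j \<Longrightarrow> j \<le> n \<Longrightarrow> \<alpha> j \<le> \<alpha> i"
    and alpha_spread: "\<alpha> 1 > \<alpha> n"
    and g_dim: "g \<in> carrier_vec n"
    and g_nz: "g \<noteq> 0\<^sub>v n"
    and Delta_pos: "\<Delta> > 0"
    and sopt_sol: "trs_solution A g \<Delta> sopt"
    and lamopt: "trs_multiplier A g \<Delta> sopt lamopt"
    and easy_case: "pos_def (shift_mat A lamopt)"
    and sopt_norm: "norm2 sopt = \<Delta>"
    and h_sol: "\<And>j. j \<le> k_max A g \<Longrightarrow> trs_solution (lanczos_T A g j) (lanczos_rhs g j) \<Delta> (h j)"
    and h_mult: "\<And>j. j \<le> k_max A g \<Longrightarrow>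
      trs_multiplier (lanczos_T A g j) (lanczos_rhs g j) \<Delta> (h j) (lam j)"
    and s_eq: "\<And>j. j \<le> k_max A g \<Longrightarrow> s j = lanczos_Q A g j *\<^sub>v h j"
    and s_norm: "\<And>j. j \<le> k_max A g \<Longrightarrow> norm2 (s j) = \<Delta>"
    and lam_pos: "\<And>j. j \<le> k_max A g \<Longrightarrow> lam j > 0"
    and k_le: "k \<le> k_max A g"
    and M_eq: "M = trs_block_mat A g \<Delta>"
    and Mk_eq: "Mk = trs_block_mat (lanczos_T A g k) (lanczos_rhs g k) \<Delta>"
    and mu1: "rightmost_eigenvalue M (complex_of_real mu1)"
    and mu1k: "rightmost_eigenvalue Mk (complex_of_real mu1k)"
    and y_eig: "eigenvector M y mu1"
    and y_unit: "norm2 y = 1"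
    and z_eig: "eigenvector Mk z mu1k"
    and z_unit: "norm2 z = 1"
    and Zperp_dim: "Zperp \<in> carrier_mat (2 * (k + 1)) (2 * (k + 1) - 1)"
    and Z_orth: "orthonormal_mat (2 * (k + 1)) (mat_of_cols (2 * (k + 1)) (z # cols Zperp))"
    and Ck_eq: "Ck = transpose_mat Zperp * Mk * Zperp"
    and sep_pos: "sep mu1 Ck > 0"
    and P_proj: "orthogonal_projector (2 * n) (krylov_product A g k) P"
    and eps_eq: "\<epsilon> = norm2 ((1\<^sub>m (2 * n) - P) *\<^sub>v y)"
    and kappa_eq: "\<kappa> = (\<alpha> 1 + lamopt) / (\<alpha> n + lamopt)"
    and t_eq: "t = (sqrt \<kappa> - 1) / (sqrt \<kappa> + 1)"
    and c_eq: "c = 2 + 16 * (\<alpha> 1 + lamopt) / ((\<alpha> 1 - \<alpha> n)\<^sup>2 * (1 - t\<^sup>2))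
      * (1 + (real k + 2) / \<bar>ln t\<bar>) * ((sqrt \<kappa> - 1) / (sqrt \<kappa> + 1))\<^sup>2"
  shows "sin (vec_angle (s k) sopt)
    \<le> c * (1 + mat_norm2 M / (sqrt (1 - \<epsilon>\<^sup>2) * sep mu1 Ck))
        * ((sqrt \<kappa> - 1) / (sqrt \<kappa> + 1)) ^ (k + 1)"
proof -
  have n: "0 < n" using g_dim g_nz by (cases n) (auto intro!: eq_vecI)
  interpret lanczos n A g by unfold_locales (fact A_dim A_sym g_dim g_nz)+
  define B where "B = shift_mat A lamopt"
  define a where "a = \<alpha> n + lamopt"
  define b where "b = \<alpha> 1 + lamopt"
  define Q where "Q = lanczos_Q A g k"
  define \<tau> where "\<tau> = t ^ Suc k"
  define X where "X = mat_norm2 M / sep mu1 Ck"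
  have B: "B \<in> carrier_mat n n" using A_dim by (simp add: B_def)
  have Q: "Q \<in> carrier_mat n (Suc k)" and Qo: "transpose_mat Q * Q = 1\<^sub>m (Suc k)"
    using Q_orthonormal[OF k_le] by (simp_all add: Q_def)
  have sopt: "sopt \<in> carrier_vec n" "B *\<^sub>v sopt = - g"
    using sopt_sol lamopt g_dim by (auto simp: trs_solution_def is_arg_min_def trs_multiplier_def B_def)
  have h: "h k \<in> carrier_vec (Suc k)"
    using h_sol[OF k_le] by (simp add: trs_solution_def is_arg_min_def)
  have sk: "s k = Q *\<^sub>v h k" using s_eq[OF k_le] by (simp add: Q_def)
  have h_norm: "norm2 (h k) = \<Delta>" using s_norm[OF k_le] isometry_norm2[OF Q Qo h] by (simp add: sk)
  have T_h: "shift_mat (lanczos_T A g k) (lam k) *\<^sub>v h k = - lanczos_rhs g k"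
    and T_psd: "pos_semidef (shift_mat (lanczos_T A g k) (lam k))"
    using h_mult[OF k_le] by (auto simp: trs_multiplier_def)
  \<comment> \<open>Definiteness makes \<open>rightmost_eigenvector\<close> applicable to the
    projected problem as well, which identifies the first half of \<open>z\<close>.\<close>
  have T_pd: "pos_def (shift_mat (lanczos_T A g k) (lam k))"
    by (rule T_shift_pos_def[OF k_le T_psd h T_h])

  obtain U d where D: "diagonalized n B U d" and d: "\<And>i. i < n \<Longrightarrow> a \<le> d i" "\<And>i. i < n \<Longrightarrow> d i \<le> b"
    and a: "0 < a"
    using shifted_spectrum[OF A_dim A_sym n alpha_eigs alpha_desc easy_case]
    unfolding a_def b_def B_def by blast
  interpret D: diagonalized n B U d by (rule D)
  have ab: "a < b" using alpha_spread by (simp add: a_def b_def)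
  obtain \<beta> where t: "0 < t" "t < 1" and \<beta>: "0 < \<beta>" and a_eq: "a = \<beta> * (1 - t)\<^sup>2" and b_eq: "b = \<beta> * (1 + t)\<^sup>2"
    using condition_number_parameters[OF a ab _ t_eq] kappa_eq by (auto simp: a_def b_def)
  have \<tau>: "0 < \<tau>" "\<tau> < 1" using t power_Suc_less_one[of t k] by (auto simp: \<tau>_def)
  have ba: "b / a = ((1 + t) / (1 - t))\<^sup>2" "(b - a) / (b + a) = 2 * t / (1 + t\<^sup>2)"
  proof -
    show "b / a = ((1 + t) / (1 - t))\<^sup>2" unfolding a_eq b_eq using \<beta> by (simp add: power_divide)
    have ba': "b - a = (2 * \<beta>) * (2 * t)" "b + a = (2 * \<beta>) * (1 + t\<^sup>2)"
      unfolding a_eq b_eq by (simp_all add: power2_eq_square algebra_simps)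
    show "(b - a) / (b + a) = 2 * t / (1 + t\<^sup>2)"
      unfolding ba' using \<beta> by (subst mult_divide_mult_cancel_left) auto
  qed

  define F where "F = 2 * (1 / (\<beta> * (1 - t)\<^sup>2) + real (Suc k) / (\<beta> * (1 - t\<^sup>2)))"
  have F: "0 \<le> F" using \<beta> t by (simp add: F_def power_le_one)
  have res_s: "norm2 (sopt - Q *\<^sub>v (transpose_mat Q *\<^sub>v sopt)) \<le> 2 * \<tau> / (1 + \<tau>\<^sup>2) * norm2 sopt"
    using krylov_residuals(1)[OF k_le D[unfolded B_def] \<beta> t _ _ sopt(1) sopt(2)[unfolded B_def]] d a_eq b_eq
    by (simp add: Q_def \<tau>_def)
  have res_y: "norm2 (v - Q *\<^sub>v (transpose_mat Q *\<^sub>v v)) \<le> F * \<tau> * norm2 (\<gamma> \<cdot>\<^sub>v sopt)"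
    if "v \<in> carrier_vec n" "B *\<^sub>v v = \<gamma> \<cdot>\<^sub>v sopt" for v \<gamma>
  proof -
    have "norm2 (v - Q *\<^sub>v (transpose_mat Q *\<^sub>v v)) \<le> 2 * t ^ Suc k *
        (1 / (\<beta> * (1 - t)\<^sup>2) + real (Suc k) / (\<beta> * (1 - t\<^sup>2))) * norm2 (\<gamma> \<cdot>\<^sub>v sopt)"
      unfolding Q_def using d a_eq b_eq that(2)
      by (intro krylov_residuals(2)[OF k_le D[unfolded B_def] \<beta> t _ _ sopt(1) sopt(2)[unfolded B_def] that(1)])
        (auto simp: B_def)
    then show ?thesis unfolding F_def \<tau>_def by (simp only: mult_ac)
  qed

  define u where "u = (1 - (s k \<bullet> sopt) / \<Delta>\<^sup>2) / 2"
  have centre: "norm2 (B *\<^sub>v x - ((a + b) / 2) \<cdot>\<^sub>v x) \<le> (b - a) / 2 * norm2 x" if x: "x \<in> carrier_vec n" for x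
  proof -
    have "B *\<^sub>v x - ((a + b) / 2) \<cdot>\<^sub>v x = D.fv (\<lambda>r. r - (a + b) / 2) x"
      unfolding D.A_mult[OF x] using x
      by (intro D.eq_by_coords) (auto simp: D.coords_diff D.coords_smult D.coords_fv algebra_simps)
    moreover have "\<bar>d i - (a + b) / 2\<bar> \<le> (b - a) / 2" if "i < n" for i
      using d[OF that] by (simp add: abs_le_iff field_simps)
    ultimately show ?thesis using D.norm2_fv_le[OF x, of "\<lambda>r. r - (a + b) / 2" "(b - a) / 2"] ab by simp
  qed
  have sphere: "sin (vec_angle (s k) sopt) = sqrt (4 * u * (1 - u))" "0 \<le> u" "u \<le> 1"
    "u \<le> b / a * \<tau>\<^sup>2" "4 * u * (1 - u - ((b - a) / (b + a))\<^sup>2) \<le> 4 * \<tau>\<^sup>2"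
    "Suc k = 1 \<Longrightarrow> 4 * u * (1 - u) \<le> 4 * \<tau>\<^sup>2"
  proof -
    note opt = trs_iterate_optimal[OF k_le sopt(1) sopt(2)[unfolded B_def] sopt_norm h_sol[OF k_le] T_h h h_norm,
        folded Q_def B_def]
    have lower: "a * (norm2 x)\<^sup>2 \<le> x \<bullet> (B *\<^sub>v x)" and upper: "x \<bullet> (B *\<^sub>v x) \<le> b * (norm2 x)\<^sup>2"
      if "x \<in> carrier_vec n" for x
      unfolding D.A_mult[OF that] using d that by (auto intro: D.scalar_prod_fv_ge D.scalar_prod_fv_le)
    note geo = sphere_minimizer_angle[OF B a less_imp_le[OF ab] Delta_pos lower upper centre Q Qo h h_norm
        sopt(1) sopt_norm opt \<tau> res_s[unfolded sopt_norm], folded sk, folded u_def]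
    show "sin (vec_angle (s k) sopt) = sqrt (4 * u * (1 - u))" by (rule geo(1))
    show "0 \<le> u" by (rule geo(2))
    show "u \<le> 1" by (rule geo(3))
    show "u \<le> b / a * \<tau>\<^sup>2" by (rule geo(4))
    show "4 * u * (1 - u - ((b - a) / (b + a))\<^sup>2) \<le> 4 * \<tau>\<^sup>2" by (rule geo(5))
    show "Suc k = 1 \<Longrightarrow> 4 * u * (1 - u) \<le> 4 * \<tau>\<^sup>2" by (rule geo(6))
  qed
  define S where "S = sin (vec_angle (s k) sopt)"
  have S2: "S\<^sup>2 = 4 * u * (1 - u)" using sphere(2,3) unfolding S_def sphere(1) by simp
  have S0: "0 \<le> S" using sphere(2,3) unfolding S_def sphere(1) by simp

  have M: "M \<in> carrier_mat (n + n) (n + n)" unfolding M_eq by (rule trs_block_mat_carrier[OF A_dim g_dim])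
  have y: "y \<in> carrier_vec (n + n)" "M *\<^sub>v y = mu1 \<cdot>\<^sub>v y"
    using y_eig M by (auto simp: eigenvector_def)
  obtain \<gamma> y1 y2 where y12: "y1 \<in> carrier_vec n" "y2 \<in> carrier_vec n" and y_eq: "y = y1 @\<^sub>v y2"
    and "mu1 = lamopt" and \<gamma>: "\<gamma> \<noteq> 0" and y1: "y1 = \<gamma> \<cdot>\<^sub>v sopt" and y2: "B *\<^sub>v y2 = y1"
    unfolding B_def
    by (rule rightmost_eigenvector[OF A_dim A_sym g_dim Delta_pos easy_case sopt(1) sopt(2)[unfolded B_def]
        sopt_norm mu1[unfolded M_eq] y_eig[unfolded M_eq]])
  have Mk: "Mk \<in> carrier_mat (Suc k + Suc k) (Suc k + Suc k)"
    unfolding Mk_eq by (rule trs_block_mat_carrier[OF T_carrier rhs_carrier])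
  have z: "z \<in> carrier_vec (Suc k + Suc k)" "Mk *\<^sub>v z = mu1k \<cdot>\<^sub>v z"
    using z_eig Mk by (auto simp: eigenvector_def)
  obtain \<zeta> z1 z2 where z12: "z1 \<in> carrier_vec (Suc k)" "z2 \<in> carrier_vec (Suc k)" and z_eq: "z = z1 @\<^sub>v z2"
    and "mu1k = lam k" "\<zeta> \<noteq> 0" and z1: "z1 = \<zeta> \<cdot>\<^sub>v h k"
    and "shift_mat (lanczos_T A g k) (lam k) *\<^sub>v z2 = z1"
    by (rule rightmost_eigenvector[OF T_carrier T_sym rhs_carrier Delta_pos T_pd h T_h h_norm
        mu1k[unfolded Mk_eq] z_eig[unfolded Mk_eq]])

  define Q2 where "Q2 = four_block_mat Q (0\<^sub>m n (Suc k)) (0\<^sub>m n (Suc k)) Q"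
  have Q2: "Q2 \<in> carrier_mat (n + n) (Suc k + Suc k)" unfolding Q2_def using Q by (rule four_block_carrier_mat[OF _ Q])
  have Q2o: "transpose_mat Q2 * Q2 = 1\<^sub>m (Suc k + Suc k)"
    unfolding Q2_def by (rule block_diag_isometry[OF Q Qo])
  define N where "N = Suc (k + k)"
  have N: "Suc k + Suc k = Suc N" "2 * (k + 1) = Suc N" "2 * (k + 1) - 1 = N" by (auto simp: N_def)
  define e where "e = y - Q2 *\<^sub>v (transpose_mat Q2 *\<^sub>v y)"
  have Zp: "Zperp \<in> carrier_mat (Suc N) N" using Zperp_dim by (simp add: N_def mult_2)
  have Mk_mult: "Mk *\<^sub>v x = transpose_mat Q2 *\<^sub>v (M *\<^sub>v (Q2 *\<^sub>v x))" if "x \<in> carrier_vec (Suc N)" for x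
    unfolding Mk_eq M_eq Q2_def Q_def using that by (intro block_compression[OF k_le]) (simp add: N_def)
  have "0 < N" by (simp add: N_def)
  note pert = eigenvector_perturbation[OF M Mk[unfolded N] \<open>0 < N\<close> Q2[unfolded N] Q2o[unfolded N] Mk_mult y y_unit
      z[unfolded N] Zp Z_orth[unfolded N] Ck_eq sep_pos]
  have X: "1 / 2 \<le> X" using pert(1) sep_pos by (simp add: X_def field_simps)
  obtain c' where c': "(norm2 (y - Q2 *\<^sub>v (c' \<cdot>\<^sub>v z)))\<^sup>2 \<le> (norm2 e)\<^sup>2 * (1 + X\<^sup>2)"
    using pert(2) unfolding X_def e_def by blast

  have sk_carrier: "s k \<in> carrier_vec n" unfolding sk using Q h by simp
  have g\<Delta>: "0 < \<bar>\<gamma>\<bar> * \<Delta>" using \<gamma> Delta_pos by simp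
  have y1_norm: "norm2 y1 = \<bar>\<gamma>\<bar> * \<Delta>" unfolding y1 norm2_smult sopt_norm ..
  have e_le: "norm2 e \<le> (2 + F) * \<tau> * (\<bar>\<gamma>\<bar> * \<Delta>)"
  proof (rule power2_le_imp_le)
    let ?r = "\<lambda>v. v - Q *\<^sub>v (transpose_mat Q *\<^sub>v v)"
    have Qt: "transpose_mat Q \<in> carrier_mat (Suc k) n" using Q by simp
    have Qv: "Q *\<^sub>v (transpose_mat Q *\<^sub>v v) \<in> carrier_vec n"
      if "v \<in> carrier_vec n" for v
      using that by (intro mult_mat_vec_carrier[OF Q] mult_mat_vec_carrier[OF Qt])
    have "Q2 *\<^sub>v (transpose_mat Q2 *\<^sub>v y) = (Q *\<^sub>v (transpose_mat Q *\<^sub>v y1)) @\<^sub>v (Q *\<^sub>v (transpose_mat Q *\<^sub>v y2))"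
      unfolding Q2_def block_diag_transpose[OF Q] y_eq block_diag_mult[OF Qt y12]
      using Qt y12 by (intro block_diag_mult[OF Q]) auto
    then have "e = ?r y1 @\<^sub>v ?r y2" unfolding e_def y_eq using y12 Q by (simp add: append_vec_minus)
    then have "(norm2 e)\<^sup>2 = (norm2 (?r y1))\<^sup>2 + (norm2 (?r y2))\<^sup>2"
      using Qv y12 norm2_append[of "?r y1" n "?r y2" n] by simp
    \<comment> \<open>Passing to the sum of the norms produces the coefficient 2 + F, the form that
      can be matched with c_k.\<close>
    also have "\<dots> \<le> (norm2 (?r y1) + norm2 (?r y2))\<^sup>2" by (simp add: power2_sum)
    also have "\<dots> \<le> ((2 + F) * \<tau> * (\<bar>\<gamma>\<bar> * \<Delta>))\<^sup>2"
    proof (rule power_mono)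
      have "?r y1 = \<gamma> \<cdot>\<^sub>v ?r sopt"
        unfolding y1 using sopt(1) Qv[OF sopt(1)] Q Qt
        by (intro eq_vecI) (auto simp: mult_mat_vec[OF Qt] mult_mat_vec[OF Q] right_diff_distrib simp del: index_mult_mat_vec)
      then have "norm2 (?r y1) = \<bar>\<gamma>\<bar> * norm2 (?r sopt)" by (simp add: norm2_smult)
      also have "\<dots> \<le> \<bar>\<gamma>\<bar> * (2 * \<tau> / (1 + \<tau>\<^sup>2) * \<Delta>)"
        using res_s sopt_norm by (intro mult_left_mono) auto
      also have "\<dots> \<le> \<bar>\<gamma>\<bar> * (2 * \<tau> * \<Delta>)"
      proof -
        have "2 * \<tau> / (1 + \<tau>\<^sup>2) \<le> 2 * \<tau>" using \<tau> by (simp add: divide_le_eq add_pos_nonneg)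
        then show ?thesis using Delta_pos by (intro mult_left_mono mult_right_mono) auto
      qed
      finally have "norm2 (?r y1) \<le> \<bar>\<gamma>\<bar> * (2 * \<tau> * \<Delta>)" .
      moreover have "norm2 (?r y2) \<le> F * \<tau> * (\<bar>\<gamma>\<bar> * \<Delta>)"
        using res_y[OF y12(2) y2[unfolded y1]] y1_norm y1 by simp
      ultimately show "norm2 (?r y1) + norm2 (?r y2) \<le> (2 + F) * \<tau> * (\<bar>\<gamma>\<bar> * \<Delta>)"
        by (simp add: algebra_simps)
    qed simp
    finally show "(norm2 e)\<^sup>2 \<le> ((2 + F) * \<tau> * (\<bar>\<gamma>\<bar> * \<Delta>))\<^sup>2" .
  qed (use F \<tau> g\<Delta> in simp)
  \<comment> \<open>The second halves are dropped. What remains is the distance of gamma s_opt from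
    a point on the line through s_k, which is at least the sine times the length.\<close>
  have "(\<gamma> * \<Delta>)\<^sup>2 * S\<^sup>2 \<le> (norm2 (y - Q2 *\<^sub>v (c' \<cdot>\<^sub>v z)))\<^sup>2"
  proof -
    define c1 where "c1 = c' * \<zeta>"
    have "c' \<cdot>\<^sub>v z = (c' \<cdot>\<^sub>v z1) @\<^sub>v (c' \<cdot>\<^sub>v z2)" unfolding z_eq by (intro eq_vecI) auto
    then have "Q2 *\<^sub>v (c' \<cdot>\<^sub>v z) = (Q *\<^sub>v (c' \<cdot>\<^sub>v z1)) @\<^sub>v (Q *\<^sub>v (c' \<cdot>\<^sub>v z2))"
      unfolding Q2_def using z12 by (simp add: block_diag_mult[OF Q])
    moreover have "Q *\<^sub>v (c' \<cdot>\<^sub>v z1) = c1 \<cdot>\<^sub>v s k"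
      unfolding z1 sk c1_def using h by (simp add: smult_smult_assoc mult_mat_vec[OF Q])
    ultimately have "y - Q2 *\<^sub>v (c' \<cdot>\<^sub>v z) = (y1 - c1 \<cdot>\<^sub>v s k) @\<^sub>v (y2 - Q *\<^sub>v (c' \<cdot>\<^sub>v z2))"
      unfolding y_eq using y12 sk_carrier Q z12 by (simp add: append_vec_minus)
    then have "(norm2 (y1 - c1 \<cdot>\<^sub>v s k))\<^sup>2 \<le> (norm2 (y - Q2 *\<^sub>v (c' \<cdot>\<^sub>v z)))\<^sup>2"
      using y12 sk_carrier Q z12
        norm2_append[of "y1 - c1 \<cdot>\<^sub>v s k" n "y2 - Q *\<^sub>v (c' \<cdot>\<^sub>v z2)" n] by simp
    moreover have "(\<gamma> * \<Delta>)\<^sup>2 * S\<^sup>2 \<le> (norm2 (y1 - c1 \<cdot>\<^sub>v s k))\<^sup>2"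
    proof -
      have "sopt \<bullet> s k = (1 - 2 * u) * \<Delta>\<^sup>2"
        using Delta_pos scalar_prod_comm_real[OF sopt(1) sk_carrier] by (simp add: u_def field_simps)
      then have "(norm2 (y1 - c1 \<cdot>\<^sub>v s k))\<^sup>2
          = (\<gamma> * \<Delta>)\<^sup>2 - 2 * (\<gamma> * (c1 * ((1 - 2 * u) * \<Delta>\<^sup>2))) + (c1 * \<Delta>)\<^sup>2"
        using norm2_diff_power2[of y1 n "c1 \<cdot>\<^sub>v s k"] y12(1) sk_carrier sopt(1) s_norm[OF k_le] sopt_norm
        unfolding y1 by (simp add: norm2_smult power_mult_distrib)
      \<comment> \<open>Completing the square in \<open>c1\<close>; \<open>1 - 2 * u\<close> is the
        cosine of the angle.\<close>
      also have "\<dots> = (\<gamma> * \<Delta>)\<^sup>2 * S\<^sup>2 + \<Delta>\<^sup>2 * (c1 - \<gamma> * (1 - 2 * u))\<^sup>2"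
        unfolding S2 by (simp add: power2_eq_square algebra_simps)
      finally show ?thesis by simp
    qed
    ultimately show ?thesis by linarith
  qed
  also note c'
  also have "(norm2 e)\<^sup>2 * (1 + X\<^sup>2) \<le> ((2 + F) * \<tau> * (\<bar>\<gamma>\<bar> * \<Delta>))\<^sup>2 * (1 + X\<^sup>2)"
    using power_mono[OF e_le, of 2] by (intro mult_right_mono) auto
  finally have "(\<gamma> * \<Delta>)\<^sup>2 * S\<^sup>2 \<le> (\<gamma> * \<Delta>)\<^sup>2 * (((2 + F) * \<tau>)\<^sup>2 * (1 + X\<^sup>2))"
    by (simp add: power_mult_distrib mult_ac)
  then have "S\<^sup>2 \<le> ((2 + F) * \<tau>)\<^sup>2 * (1 + X\<^sup>2)" using \<gamma> Delta_pos by (subst (asm) mult_le_cancel_left_pos) auto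
  then have "sqrt (S\<^sup>2) \<le> sqrt (((2 + F) * \<tau>)\<^sup>2 * (1 + X\<^sup>2))" by (rule real_sqrt_le_mono)
  then have residual: "S \<le> (2 + F) * \<tau> * sqrt (1 + X\<^sup>2)"
    using S0 F \<tau> by (simp add: real_sqrt_mult)

  have optimal: "S \<le> 2 * ((1 + t) / (1 - t)) * \<tau>"
  proof (rule power2_le_imp_le)
    have "4 * u * (1 - u) \<le> 4 * u * 1" using sphere(2) by (intro mult_left_mono) auto
    then show "S\<^sup>2 \<le> (2 * ((1 + t) / (1 - t)) * \<tau>)\<^sup>2"
      using sphere(4) unfolding S2 ba(1) power_mult_distrib by simp
  qed (use t \<tau> in simp)
  have small: "S \<le> 3 * \<tau>" if t38: "t < 3 / 8"
  proof (rule power2_le_imp_le)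
    have "4 * u * (1 - u) \<le> 9 * \<tau>\<^sup>2"
    \<comment> \<open>For k = 0 the condition \<open>\<tau> \<le> t\<^sup>2\<close> of
      \<open>small_t_bound\<close> fails, and the one-dimensional case of the sphere argument takes
      its place.\<close>
    proof (cases k)
      case 0
      then have "4 * u * (1 - u) \<le> 4 * \<tau>\<^sup>2" by (intro sphere(6)) simp
      also have "\<dots> \<le> 9 * \<tau>\<^sup>2" by simp
      finally show ?thesis .
    next
      case (Suc l)
      have "\<tau> \<le> t\<^sup>2" unfolding \<tau>_def Suc using t by (intro power_decreasing) auto
      then show ?thesis
        using sphere(4,5) unfolding ba by (intro small_t_bound[OF t(1) t38 \<tau>(1) _ sphere(2)])
    qed
    then show "S\<^sup>2 \<le> (3 * \<tau>)\<^sup>2" unfolding S2 by (simp add: power_mult_distrib)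
  qed (use \<tau> in simp)
  define E where "E = (1 + t) / (\<beta> * (1 - t)) * (1 + (real k + 2) / \<bar>ln t\<bar>)"
  have S_le: "S \<le> (2 + E) * (1 + X) * \<tau>"
    unfolding E_def using residual
    by (intro combine_bounds[OF \<beta> t \<tau>(1) X _ optimal small]) (simp_all add: F_def)
  have E: "0 \<le> E" unfolding E_def using \<beta> t
    by (intro mult_nonneg_nonneg divide_nonneg_pos add_nonneg_nonneg) auto
  have c: "c = 2 + E"
  proof -
    \<comment> \<open>The squared spread 16 beta^2 t^2 cancels the constant 16 and the factor t^2 in
      c_k.\<close>
    have ab': "\<alpha> 1 - \<alpha> n = 4 * \<beta> * t" using a_eq b_eq
      by (simp add: a_def b_def power2_eq_square algebra_simps)
    have *: "16 * (\<alpha> 1 + lamopt) / ((\<alpha> 1 - \<alpha> n)\<^sup>2 * (1 - t\<^sup>2)) * t\<^sup>2 = (1 + t) / (\<beta> * (1 - t))"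
    proof -
      have t2: "1 - t\<^sup>2 = (1 - t) * (1 + t)" by (simp add: power2_eq_square algebra_simps)
      show ?thesis unfolding ab' b_def[symmetric] b_eq t2 using \<beta> t by (simp add: power2_eq_square)
    qed
    show ?thesis unfolding c_eq t_eq[symmetric] E_def *[symmetric] by (simp only: mult_ac)
  qed

  define \<sigma> where "\<sigma> = sqrt (1 - \<epsilon>\<^sup>2)"
  have \<sigma>: "0 < \<sigma>" "\<sigma> \<le> 1"
  proof -
    \<comment> \<open>The witness for positivity: (g, 0) lies in the product space, and its inner
      product with \<open>y\<close> is - gamma times s_opt . B s_opt, nonzero by
      definiteness.\<close>
    have w: "g @\<^sub>v 0\<^sub>v n \<in> krylov_product A g k"
      unfolding krylov_product_def using g_krylov zero_krylov by blast
    have yw: "y \<bullet> (g @\<^sub>v 0\<^sub>v n) \<noteq> 0"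
    proof -
      have "sopt \<noteq> 0\<^sub>v n" using sopt_norm Delta_pos by (auto simp: norm2_def)
      then have "0 < sopt \<bullet> (B *\<^sub>v sopt)"
        using easy_case sopt(1) carrier_matD[OF B] by (auto simp: pos_def_def B_def)
      then have "sopt \<bullet> g \<noteq> 0" unfolding sopt(2) using sopt(1) g_dim by auto
      moreover have "y \<bullet> (g @\<^sub>v 0\<^sub>v n) = \<gamma> * (sopt \<bullet> g)"
        unfolding y_eq y1 using sopt(1) y12 g_dim by (subst scalar_prod_append[of _ n _ n]) auto
      ultimately show ?thesis using \<gamma> by simp
    qed
    have y_dim: "y \<in> carrier_vec (2 * n)" using y(1) by (simp add: mult_2)
    show "0 < \<sigma>" "\<sigma> \<le> 1"
      unfolding \<sigma>_def eps_eq by (rule orthogonal_projector_residual[OF P_proj y_dim y_unit w yw])+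
  qed
  \<comment> \<open>Dividing by \<open>\<sigma>\<close>, which lies in (0, 1], only increases the
    positive quantity \<open>X\<close>, so the bound proved with \<open>X\<close> suffices.\<close>
  have "X \<le> mat_norm2 M / (\<sigma> * sep mu1 Ck)"
  proof -
    have "0 < X" using X by simp
    then have "X \<le> X / \<sigma>" using \<sigma> by (simp add: le_divide_eq)
    also have "\<dots> = mat_norm2 M / (\<sigma> * sep mu1 Ck)" by (simp add: X_def mult.commute)
    finally show ?thesis .
  qed
  then have "(2 + E) * (1 + X) * \<tau> \<le> (2 + E) * (1 + mat_norm2 M / (\<sigma> * sep mu1 Ck)) * \<tau>"
    using E \<tau> by (intro mult_right_mono mult_left_mono) auto
  then show ?thesis
    using S_le unfolding S_def c \<sigma>_def \<tau>_def t_eq[symmetric] by simp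
qed

end
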